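(* Let $G$ be a discrete group, let $\omega$ be a weight on $G$ with $\omega(e_G)=1$, and let $\mathcal{A}=\ell^1(G,\omega)$. Consider the following statements: (1) $\mathcal{A}$ is pointwise amenable. (2) $\mathcal{A}$ is pointwise Connes amenable. (3) $G$ is pointwise $\omega$-amenable. (4) $\mathcal{A}$ is pointwise amenable at $\delta_k$ for each $k\in G$. Then $(1)\Longrightarrow(2)\Longrightarrow(3)\Longrightarrow(4)$.
   Context: A weight on $G$ is a function $\omega:G\to[1,\infty)$ with $\omega(gh)\le\omega(g)\omega(h)$ for all $g,h\in G$. Put $\Omega(g,h):=\dfrac{\omega(gh)}{\omega(g)\omega(h)}$. The Beurling algebra $\ell^1(G,\omega)$ is regarded as the Banach space $\ell^1(G)$ with product $\delta_g\star_\omega\delta_h:=\Omega(g,h)\,\delta_{gh}$, extended by linearity and continuity, where $\delta_g$ is the characteristic function of $\{g\}$. It is a dual Banach algebra with predual $c_0(G)$. For $h\in G$ define the bounded linear map $J_h:\ell^\infty(G)\to\ell^\infty(G)$ by $$J_h(f):=\big(f_{hg}\,\Omega(h,g)\,\omega(h)\,\Omega(g^{-1},h^{-1})\,\omega(h^{-1})\big)_{g\in G}\qquad(f=(f_g)_g\in\ell^\infty(G)).$$ $G$ is pointwise $\omega$-amenable at $h_0\in G$ if there exists $N\in\ell^\infty(G)^*$ such that $\langle(\Omega(g,g^{-1}))_{g\in G},N\rangle=1$ and $J_{h_0}^*(N)=N$. $G$ is pointwise $\omega$-amenable if it is pointwise $\omega$-amenable at each $h\in G$. A derivation from a Banach algebra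 $\mathcal{A}$ to a Banach $\mathcal{A}$-bimodule is a bounded linear map $D$ with $D(ab)=D(a)\cdot b+a\cdot D(b)$. $\mathcal{A}$ is pointwise amenable at $a_0\in\mathcal{A}$ if for every Banach $\mathcal{A}$-bimodule $E$ and every derivation $D:\mathcal{A}\to E^*$ there is $\phi\in E^*$ with $D(a_0)=a_0\cdot\phi-\phi\cdot a_0$; $\mathcal{A}$ is pointwise amenable if this holds at each $a_0\in\mathcal{A}$. A Banach $\mathcal{A}$-bimodule $E$ is dual if there is a closed submodule $E_*$ of $E^*$ with $E=(E_* )^*$; a Banach algebra is a dual Banach algebra if it is dual as a Banach bimodule over itself. For a dual Banach algebra $\mathcal{A}$, a dual Banach $\mathcal{A}$-bimodule $E$ is normal if for each $x\in E$ the maps $a\mapsto a\cdot x$ and $a\mapsto x\cdot a$ from $\mathcal{A}$ to $E$ are $w^*$-$w^*$-continuous. A dual Banach algebra $\mathcal{A}$ is pointwise Connes amenable if for each $a_0\in\mathcal{A}$, every normal, dual Banach $\mathcal{A}$-bimodule $E$ and every $w^*$-$w^*$-continuous derivation $D:\mathcal{A}\to E$ there is $x\in E$ with $D(a_0)=a_0\cdot x-x\cdot a_0$. *)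

theory Defs
  imports "HOL-Analysis.Analysis" "HOL-Algebra.Module"
begin

text \<open>
  Modules have to be quantified over inside formulas, so complex normed spaces, normed algebras and
  bimodules are carrier-based: they are \<^const>\<open>module\<close>s in the sense of HOL-Algebra over the
  field of complex numbers, with a norm. For a normed algebra the product is the field
  \<^const>\<open>mult\<close> of the record; for a normed space \<^const>\<open>mult\<close> and \<^const>\<open>one\<close> are junk.
\<close>

record 'e normed_module = "(complex, 'e) module" +
  nrm :: "'e \<Rightarrow> real"

record ('a, 'e) normed_bimodule = "'e normed_module" +
  lact :: "'a \<Rightarrow> 'e \<Rightarrow> 'e"
  ract :: "'e \<Rightarrow> 'a \<Rightarrow> 'e"

definition scalars :: "complex normed_module" where
  "scalars = \<lparr>carrier = UNIV, mult = (*), one = 1, zero = 0, add = (+), smult = (*), nrm = cmod\<rparr>"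

text \<open>Zero outside the carrier, because \<^locale>\<open>Metric_space\<close> asks for symmetry everywhere.\<close>

definition ndist :: "('e, 'm) normed_module_scheme \<Rightarrow> 'e \<Rightarrow> 'e \<Rightarrow> real" where
  "ndist E x y = (if x \<in> carrier E \<and> y \<in> carrier E then nrm E (x \<ominus>\<^bsub>E\<^esub> y) else 0)"

locale complex_normed_space = module scalars E
  for E :: "('e, 'm) normed_module_scheme" (structure) +
  assumes nrm_nonneg: "x \<in> carrier E \<Longrightarrow> 0 \<le> nrm E x"
    and nrm_eq_0_iff: "x \<in> carrier E \<Longrightarrow> nrm E x = 0 \<longleftrightarrow> x = \<zero>"
    and nrm_smult: "x \<in> carrier E \<Longrightarrow> nrm E (c \<odot> x) = cmod c * nrm E x"
    and nrm_triangle: "x \<in> carrier E \<Longrightarrow> y \<in> carrier E \<Longrightarrow> nrm E (x \<oplus> y) \<le> nrm E x + nrm E y"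

locale complex_banach_space = complex_normed_space E
  for E :: "('e, 'm) normed_module_scheme" (structure) +
  assumes complete: "Metric_space.mcomplete (carrier E) (ndist E)"

definition cbounded_linear ::
    "('e, 'm) normed_module_scheme \<Rightarrow> ('f, 'n) normed_module_scheme \<Rightarrow> ('e \<Rightarrow> 'f) \<Rightarrow> bool" where
  "cbounded_linear E F T \<longleftrightarrow>
     T \<in> carrier E \<rightarrow> carrier F \<and>
     (\<forall>x\<in>carrier E. \<forall>y\<in>carrier E. T (x \<oplus>\<^bsub>E\<^esub> y) = T x \<oplus>\<^bsub>F\<^esub> T y) \<and>
     (\<forall>c. \<forall>x\<in>carrier E. T (c \<odot>\<^bsub>E\<^esub> x) = c \<odot>\<^bsub>F\<^esub> T x) \<and>
     (\<exists>K. \<forall>x\<in>carrier E. nrm F (T x) \<le> K * nrm E x)"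


subsection \<open>Dual spaces and bimodules\<close>

text \<open>Functionals are \<^const>\<open>extensional\<close>, so that equal functionals are equal as HOL functions.\<close>

definition dual_space :: "('e, 'm) normed_module_scheme \<Rightarrow> ('e \<Rightarrow> complex) normed_module" where
  "dual_space E =
     \<lparr>carrier = {\<phi> \<in> extensional (carrier E). cbounded_linear E scalars \<phi>},
      mult = undefined, one = undefined,
      zero = (\<lambda>x\<in>carrier E. 0),
      add = (\<lambda>\<phi> \<psi>. \<lambda>x\<in>carrier E. \<phi> x + \<psi> x),
      smult = (\<lambda>c \<phi>. \<lambda>x\<in>carrier E. c * \<phi> x),
      nrm = (\<lambda>\<phi>. SUP x\<in>{x \<in> carrier E. nrm E x \<le> 1}. cmod (\<phi> x))\<rparr>"

definition adjoint_map ::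
    "('e, 'm) normed_module_scheme \<Rightarrow> ('e \<Rightarrow> 'f) \<Rightarrow> ('f \<Rightarrow> complex) \<Rightarrow> ('e \<Rightarrow> complex)" where
  "adjoint_map E T \<phi> = (\<lambda>x\<in>carrier E. \<phi> (T x))"

text \<open>The dual actions: \<open>(a \<cdot> \<phi>)(x) = \<phi>(x \<cdot> a)\<close> and \<open>(\<phi> \<cdot> a)(x) = \<phi>(a \<cdot> x)\<close>.\<close>

definition dual_bimodule ::
    "('a, 'e, 'm) normed_bimodule_scheme \<Rightarrow> ('a, 'e \<Rightarrow> complex) normed_bimodule" where
  "dual_bimodule E =
     normed_module.extend (dual_space E)
       (normed_bimodule.fields
         (\<lambda>a \<phi>. adjoint_map E (\<lambda>x. ract E x a) \<phi>)
         (\<lambda>\<phi> a. adjoint_map E (\<lambda>x. lact E a x) \<phi>))"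

locale banach_bimodule = complex_banach_space E
  for A :: "('a, 'l) normed_module_scheme"
    and E :: "('a, 'e, 'm) normed_bimodule_scheme" (structure) +
  assumes lact_closed: "a \<in> carrier A \<Longrightarrow> x \<in> carrier E \<Longrightarrow> lact E a x \<in> carrier E"
    and ract_closed: "a \<in> carrier A \<Longrightarrow> x \<in> carrier E \<Longrightarrow> ract E x a \<in> carrier E"
    and lact_add_left: "a \<in> carrier A \<Longrightarrow> b \<in> carrier A \<Longrightarrow> x \<in> carrier E \<Longrightarrow>
          lact E (a \<oplus>\<^bsub>A\<^esub> b) x = lact E a x \<oplus> lact E b x"
    and lact_add_right: "a \<in> carrier A \<Longrightarrow> x \<in> carrier E \<Longrightarrow> y \<in> carrier E \<Longrightarrow>
          lact E a (x \<oplus> y) = lact E a x \<oplus> lact E a y"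
    and lact_smult_left: "a \<in> carrier A \<Longrightarrow> x \<in> carrier E \<Longrightarrow>
          lact E (c \<odot>\<^bsub>A\<^esub> a) x = c \<odot> lact E a x"
    and lact_smult_right: "a \<in> carrier A \<Longrightarrow> x \<in> carrier E \<Longrightarrow>
          lact E a (c \<odot> x) = c \<odot> lact E a x"
    and ract_add_left: "a \<in> carrier A \<Longrightarrow> x \<in> carrier E \<Longrightarrow> y \<in> carrier E \<Longrightarrow>
          ract E (x \<oplus> y) a = ract E x a \<oplus> ract E y a"
    and ract_add_right: "a \<in> carrier A \<Longrightarrow> b \<in> carrier A \<Longrightarrow> x \<in> carrier E \<Longrightarrow>
          ract E x (a \<oplus>\<^bsub>A\<^esub> b) = ract E x a \<oplus> ract E x b"
    and ract_smult_left: "a \<in> carrier A \<Longrightarrow> x \<in> carrier E \<Longrightarrow>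
          ract E (c \<odot> x) a = c \<odot> ract E x a"
    and ract_smult_right: "a \<in> carrier A \<Longrightarrow> x \<in> carrier E \<Longrightarrow>
          ract E x (c \<odot>\<^bsub>A\<^esub> a) = c \<odot> ract E x a"
    and lact_lact: "a \<in> carrier A \<Longrightarrow> b \<in> carrier A \<Longrightarrow> x \<in> carrier E \<Longrightarrow>
          lact E a (lact E b x) = lact E (a \<otimes>\<^bsub>A\<^esub> b) x"
    and ract_ract: "a \<in> carrier A \<Longrightarrow> b \<in> carrier A \<Longrightarrow> x \<in> carrier E \<Longrightarrow>
          ract E (ract E x a) b = ract E x (a \<otimes>\<^bsub>A\<^esub> b)"
    and lact_ract: "a \<in> carrier A \<Longrightarrow> b \<in> carrier A \<Longrightarrow> x \<in> carrier E \<Longrightarrow>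
          lact E a (ract E x b) = ract E (lact E a x) b"
    and lact_bounded: "\<exists>K. \<forall>a\<in>carrier A. \<forall>x\<in>carrier E. nrm E (lact E a x) \<le> K * nrm A a * nrm E x"
    and ract_bounded: "\<exists>K. \<forall>a\<in>carrier A. \<forall>x\<in>carrier E. nrm E (ract E x a) \<le> K * nrm A a * nrm E x"

definition derivation ::
    "('a, 'l) normed_module_scheme \<Rightarrow> ('a, 'e, 'm) normed_bimodule_scheme \<Rightarrow> ('a \<Rightarrow> 'e) \<Rightarrow> bool" where
  "derivation A E D \<longleftrightarrow>
     cbounded_linear A E D \<and>
     (\<forall>a\<in>carrier A. \<forall>b\<in>carrier A.
        D (a \<otimes>\<^bsub>A\<^esub> b) = ract E (D a) b \<oplus>\<^bsub>E\<^esub> lact E a (D b))"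


subsection \<open>Pointwise amenability\<close>

text \<open>
  HOL cannot quantify over all types inside a formula. The type argument \<open>U\<close> is the universe from
  which the elements of the modules are drawn; any subset of it may be a carrier.
\<close>

definition pointwise_amenable_at ::
    "'e itself \<Rightarrow> ('a, 'l) normed_module_scheme \<Rightarrow> 'a \<Rightarrow> bool" where
  "pointwise_amenable_at U A a\<^sub>0 \<longleftrightarrow>
     (\<forall>(E :: ('a, 'e) normed_bimodule) D.
        banach_bimodule A E \<longrightarrow> derivation A (dual_bimodule E) D \<longrightarrow>
        (\<exists>\<phi>\<in>carrier (dual_bimodule E).
           D a\<^sub>0 = lact (dual_bimodule E) a\<^sub>0 \<phi> \<ominus>\<^bsub>dual_bimodule E\<^esub> ract (dual_bimodule E) \<phi> a\<^sub>0))"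

definition pointwise_amenable :: "'e itself \<Rightarrow> ('a, 'l) normed_module_scheme \<Rightarrow> bool" where
  "pointwise_amenable U A \<longleftrightarrow> (\<forall>a\<^sub>0\<in>carrier A. pointwise_amenable_at U A a\<^sub>0)"


subsection \<open>Dual bimodules and pointwise Connes amenability\<close>

text \<open>
  The last two assumptions say \<open>E = (E\<^sub>*)\<^sup>*\<close>: the canonical map \<open>x \<mapsto> (\<phi> \<mapsto> \<phi>(x))\<close> is
  an isometric bijection of \<open>E\<close> onto the dual of \<open>P = E\<^sub>*\<close>.
\<close>

definition eval_on :: "('e \<Rightarrow> complex) set \<Rightarrow> 'e \<Rightarrow> ('e \<Rightarrow> complex) \<Rightarrow> complex" where
  "eval_on P x = (\<lambda>\<phi>\<in>P. \<phi> x)"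

locale dual_banach_bimodule = banach_bimodule A E
  for A :: "('a, 'l) normed_module_scheme"
    and E :: "('a, 'e, 'm) normed_bimodule_scheme" (structure)
    and P :: "('e \<Rightarrow> complex) set" +
  assumes predual_submodule: "submodule P scalars (dual_bimodule E)"
    and predual_lact: "a \<in> carrier A \<Longrightarrow> \<phi> \<in> P \<Longrightarrow> lact (dual_bimodule E) a \<phi> \<in> P"
    and predual_ract: "a \<in> carrier A \<Longrightarrow> \<phi> \<in> P \<Longrightarrow> ract (dual_bimodule E) \<phi> a \<in> P"
    and predual_closed:
      "closedin (Metric_space.mtopology (carrier (dual_bimodule E)) (ndist (dual_bimodule E))) P"
    and predual_bij: "bij_betw (eval_on P) (carrier E)
      (carrier (dual_space ((dual_bimodule E)\<lparr>carrier := P\<rparr>)))"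
    and predual_isometric: "x \<in> carrier E \<Longrightarrow>
      nrm (dual_space ((dual_bimodule E)\<lparr>carrier := P\<rparr>)) (eval_on P x) = nrm E x"

text \<open>The topology \<open>\<sigma>(E, P)\<close>.\<close>

definition weak_star :: "('e, 'm) normed_module_scheme \<Rightarrow> ('e \<Rightarrow> complex) set \<Rightarrow> 'e topology" where
  "weak_star E P =
     pullback_topology (carrier E) (eval_on P) (product_topology (\<lambda>_. euclidean) P)"

definition normal_bimodule ::
    "('a, 'l) normed_module_scheme \<Rightarrow> ('a \<Rightarrow> complex) set \<Rightarrow>
     ('a, 'e, 'm) normed_bimodule_scheme \<Rightarrow> ('e \<Rightarrow> complex) set \<Rightarrow> bool" where
  "normal_bimodule A Q E P \<longleftrightarrow>
     (\<forall>x\<in>carrier E.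
        continuous_map (weak_star A Q) (weak_star E P) (\<lambda>a. lact E a x) \<and>
        continuous_map (weak_star A Q) (weak_star E P) (\<lambda>a. ract E x a))"

text \<open>Here \<open>A\<close> is meant to be a dual Banach algebra with predual \<open>Q = A\<^sub>*\<close>.\<close>

definition pointwise_connes_amenable ::
    "'e itself \<Rightarrow> ('a, 'l) normed_module_scheme \<Rightarrow> ('a \<Rightarrow> complex) set \<Rightarrow> bool" where
  "pointwise_connes_amenable U A Q \<longleftrightarrow>
     (\<forall>a\<^sub>0\<in>carrier A. \<forall>(E :: ('a, 'e) normed_bimodule) P D.
        dual_banach_bimodule A E P \<longrightarrow> normal_bimodule A Q E P \<longrightarrow>
        derivation A E D \<longrightarrow> continuous_map (weak_star A Q) (weak_star E P) D \<longrightarrow>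
        (\<exists>x\<in>carrier E. D a\<^sub>0 = lact E a\<^sub>0 x \<ominus>\<^bsub>E\<^esub> ract E x a\<^sub>0))"


subsection \<open>Beurling algebras\<close>

text \<open>
  The discrete group is a type of class \<^class>\<open>group_add\<close>, which is not assumed commutative: \<open>g + h\<close>,
  \<open>0\<close> and \<open>- g\<close> stand for the product, the identity and the inverse.
\<close>

definition weight :: "('g::group_add \<Rightarrow> real) \<Rightarrow> bool" where
  "weight \<omega> \<longleftrightarrow> (\<forall>g. 1 \<le> \<omega> g) \<and> (\<forall>g h. \<omega> (g + h) \<le> \<omega> g * \<omega> h)"

definition weight_quot :: "('g::group_add \<Rightarrow> real) \<Rightarrow> 'g \<Rightarrow> 'g \<Rightarrow> real" where
  "weight_quot \<omega> g h = \<omega> (g + h) / (\<omega> g * \<omega> h)"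

definition delta :: "'g \<Rightarrow> 'g \<Rightarrow> complex" where
  "delta g = (\<lambda>h. if h = g then 1 else 0)"

text \<open>The product is \<open>(a \<star> b)(k) = \<Sum>\<^bsub>gh = k\<^esub> \<Omega>(g, h) a(g) b(h)\<close>.\<close>

definition beurling :: "('g::group_add \<Rightarrow> real) \<Rightarrow> ('g \<Rightarrow> complex) normed_module" where
  "beurling \<omega> =
     \<lparr>carrier = {a. (\<lambda>g. cmod (a g)) summable_on UNIV},
      mult = (\<lambda>a b k. \<Sum>\<^sub>\<infinity>g. of_real (weight_quot \<omega> g (- g + k)) * a g * b (- g + k)),
      one = delta 0,
      zero = (\<lambda>g. 0),
      add = (\<lambda>a b g. a g + b g),
      smult = (\<lambda>c a g. c * a g),
      nrm = (\<lambda>a. \<Sum>\<^sub>\<infinity>g. cmod (a g))\<rparr>"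

lemma beurling_delta_mult:
  "delta g \<otimes>\<^bsub>beurling \<omega>\<^esub> delta h =
     complex_of_real (weight_quot \<omega> g h) \<odot>\<^bsub>beurling \<omega>\<^esub> delta (g + h)"
proof
  fix k :: 'a
  have eq: "- g + k = h \<longleftrightarrow> k = g + h"
    by (metis add.assoc add.left_neutral left_minus right_minus)
  have "(\<Sum>\<^sub>\<infinity>x. of_real (weight_quot \<omega> x (- x + k)) * delta g x * delta h (- x + k)) =
        (\<Sum>\<^sub>\<infinity>x\<in>{g}. of_real (weight_quot \<omega> x (- x + k)) * delta g x * delta h (- x + k) :: complex)"
    by (rule infsum_cong_neutral) (auto simp: delta_def)
  then show "(delta g \<otimes>\<^bsub>beurling \<omega>\<^esub> delta h) k =
     (complex_of_real (weight_quot \<omega> g h) \<odot>\<^bsub>beurling \<omega>\<^esub> delta (g + h)) k"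
    using eq by (auto simp: beurling_def delta_def)
qed

text \<open>The predual \<open>c\<^sub>0(G)\<close>, as a set of functionals on \<open>\<ell>\<^sup>1(G)\<close>; \<open>f\<close> vanishes at infinity if it
  tends to \<open>0\<close> along the cofinite filter.\<close>

definition c0_predual :: "('g::group_add \<Rightarrow> real) \<Rightarrow> (('g \<Rightarrow> complex) \<Rightarrow> complex) set" where
  "c0_predual \<omega> =
     (\<lambda>f. \<lambda>a\<in>carrier (beurling \<omega>). \<Sum>\<^sub>\<infinity>g. f g * a g) ` {f. (f \<longlongrightarrow> 0) cofinite}"

definition ell_infinity :: "('g \<Rightarrow> complex) normed_module" where
  "ell_infinity =
     \<lparr>carrier = {f. bounded (range f)},
      mult = (\<lambda>f f' g. f g * f' g),
      one = (\<lambda>g. 1),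
      zero = (\<lambda>g. 0),
      add = (\<lambda>f f' g. f g + f' g),
      smult = (\<lambda>c f g. c * f g),
      nrm = (\<lambda>f. SUP g. cmod (f g))\<rparr>"

definition J_map :: "('g::group_add \<Rightarrow> real) \<Rightarrow> 'g \<Rightarrow> ('g \<Rightarrow> complex) \<Rightarrow> ('g \<Rightarrow> complex)" where
  "J_map \<omega> h f = (\<lambda>g. f (h + g) *
     of_real (weight_quot \<omega> h g * \<omega> h * weight_quot \<omega> (- g) (- h) * \<omega> (- h)))"

definition pointwise_weight_amenable_at :: "('g::group_add \<Rightarrow> real) \<Rightarrow> 'g \<Rightarrow> bool" where
  "pointwise_weight_amenable_at \<omega> h\<^sub>0 \<longleftrightarrow>
     (\<exists>N\<in>carrier (dual_space ell_infinity).
        N (\<lambda>g. of_real (weight_quot \<omega> g (- g))) = 1 \<and>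
        adjoint_map ell_infinity (J_map \<omega> h\<^sub>0) N = N)"

definition pointwise_weight_amenable :: "('g::group_add \<Rightarrow> real) \<Rightarrow> bool" where
  "pointwise_weight_amenable \<omega> \<longleftrightarrow> (\<forall>h. pointwise_weight_amenable_at \<omega> h)"


subsection \<open>Universes\<close>

text \<open>
  A universe for the dual modules: \<open>'u\<close> is arbitrary, so it can be made to contain any given module,
  and the second summand ensures that functionals on spaces of functions on \<open>G \<times> G\<close> are available,
  whatever \<open>'u\<close> is. Preduals of modules in \<open>'v\<close> have their elements in \<open>'v \<Rightarrow> complex\<close>.
\<close>

type_synonym ('g, 'u) dual_universe = "'u + (('g \<times> 'g \<Rightarrow> complex) \<Rightarrow> complex)"
type_synonym ('g, 'u) predual_universe = "('g, 'u) dual_universe \<Rightarrow> complex"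

end

theory Submission
  imports Defs
begin

text \<open>
  Write \<open>\<delta>\<^sub>g\<close> for \<open>delta g\<close>, \<open>\<Omega>\<close> for the quotient \<open>weight_quot \<omega>\<close> and \<open>w(g) = \<omega>(g) \<omega>(- g)\<close>. As
  \<open>\<omega>(0) = 1\<close>, the element \<open>\<delta>\<^sub>0\<close> is the identity of the algebra, \<open>\<Omega>(g, - g) = 1 / w(g)\<close>, and \<open>\<delta>\<^sub>g\<close> is
  invertible with inverse \<open>w(g) \<delta>\<^bsub>- g\<^esub>\<close>.

  From pointwise amenability to pointwise Connes amenability: the predual of a dual Banach bimodule
  \<open>E\<close> is a closed submodule of \<open>E\<^sup>*\<close>, hence a Banach bimodule, and \<open>E\<close> is its dual bimodule. So a
  derivation into \<open>E\<close> is a derivation into a dual bimodule, and nothing remains to be done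
  (\<open>pointwise_amenable_imp_pointwise_connes_amenable\<close>).

  From pointwise Connes amenability to pointwise \<open>\<omega>\<close>-amenability: it is enough to exhibit one normal
  dual bimodule and one derivation such that an element implementing the derivation at \<open>\<delta>\<^sub>h\<close> yields
  the functional \<open>N\<close>. Let the algebra act on its tensor square by
  \<open>a \<cdot> (b \<otimes> c) = ab \<otimes> c - a \<otimes> bc\<close> and \<open>(b \<otimes> c) \<cdot> a = b \<otimes> ca\<close>. Then \<open>a \<mapsto> a \<otimes> 1\<close> is a derivation
  (think of \<open>b \<otimes> c\<close> as the differential form \<open>db c\<close>). To obtain a normal dual module, the tensor
  square is replaced by the dual of the space \<open>X\<close> of bounded functions on the square of the group
  that vanish at infinity uniformly along the fibres \<open>{(g, k). g + k = s}\<close>, \<open>s \<rightarrow> \<infinity>\<close>. The actions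
  permute the fibres, so the translates under different group elements of a function on one fibre
  have disjoint supports; any functional on \<open>X\<close> is therefore summable along such translates, which
  gives the weak-star continuity (\<open>dual_coefficients_vanish\<close>).

  If \<open>m \<in> X\<^sup>*\<close> implements the derivation at \<open>\<delta>\<^sub>h\<close>, let \<open>n\<close> be its restriction to the fibre over \<open>0\<close>,
  regarded as a functional on \<open>\<ell>\<^sup>\<infinity>\<close>, and \<open>c = n (1 / w)\<close>. Testing against functions on the fibre over
  \<open>h\<close> gives, for each bounded \<open>f\<close>,
  \<open>(1 + c) f(h) = n (g \<mapsto> \<Omega>(h, g) f(h + g)) - n (g \<mapsto> \<Omega>(- g, h) f(g))\<close>.
  For \<open>f(g) = \<Omega>(g, - g + h)\<close> both terms on the right are \<open>n (1 / w)\<close> while \<open>f(h) = 1\<close>; so \<open>c = - 1\<close>,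
  the right-hand side vanishes for every \<open>f\<close>, and \<open>N = - n\<close> is as required
  (\<open>connes_amenable_imp_weight_amenable\<close>).

  From pointwise \<open>\<omega>\<close>-amenability to pointwise amenability at \<open>\<delta>\<^sub>k\<close>: this is the classical averaging
  argument. With \<open>e = \<delta>\<^sub>0\<close>, a derivation \<open>D\<close> into a dual bimodule differs from \<open>a \<mapsto> e \<cdot> D(a) \<cdot> e\<close> by
  an inner derivation, and the latter is implemented at \<open>\<delta>\<^sub>k\<close> by minus the \<open>N\<close>-average over \<open>g\<close> of
  \<open>e \<cdot> D(\<delta>\<^sub>g) \<cdot> \<delta>\<^bsub>- g\<^esub>\<close>, by the invariance of \<open>N\<close>
  (\<open>weight_amenable_imp_amenable_at_delta\<close>).
\<close>

section \<open>Normed spaces on carriers\<close>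

lemma scalars_simps [simp]:
  "carrier scalars = UNIV" "zero scalars = 0" "one scalars = 1"
  "add scalars = (+)" "mult scalars = (*)" "smult scalars = (*)" "nrm scalars = cmod"
  by (simp_all add: scalars_def)

lemma cring_scalars: "cring scalars"
proof (intro cringI abelian_groupI comm_monoidI)
  show "\<exists>y\<in>carrier scalars. y \<oplus>\<^bsub>scalars\<^esub> x = \<zero>\<^bsub>scalars\<^esub>" for x :: complex
    by (simp add: bexI[of _ "-x"] exI[of _ "-x"])
qed (auto simp: algebra_simps)

lemma complex_normed_spaceI:
  fixes E (structure)
  assumes add: "\<And>x y. x \<in> carrier E \<Longrightarrow> y \<in> carrier E \<Longrightarrow> x \<oplus> y \<in> carrier E"
    and zero: "\<zero> \<in> carrier E"
    and smult: "\<And>c x. x \<in> carrier E \<Longrightarrow> c \<odot> x \<in> carrier E"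
    and assoc: "\<And>x y z. x \<in> carrier E \<Longrightarrow> y \<in> carrier E \<Longrightarrow> z \<in> carrier E \<Longrightarrow> (x \<oplus> y) \<oplus> z = x \<oplus> (y \<oplus> z)"
    and comm: "\<And>x y. x \<in> carrier E \<Longrightarrow> y \<in> carrier E \<Longrightarrow> x \<oplus> y = y \<oplus> x"
    and lzero: "\<And>x. x \<in> carrier E \<Longrightarrow> \<zero> \<oplus> x = x"
    and distr1: "\<And>c d x. x \<in> carrier E \<Longrightarrow> (c + d) \<odot> x = c \<odot> x \<oplus> d \<odot> x"
    and distr2: "\<And>c x y. x \<in> carrier E \<Longrightarrow> y \<in> carrier E \<Longrightarrow> c \<odot> (x \<oplus> y) = c \<odot> x \<oplus> c \<odot> y"
    and sassoc: "\<And>c d x. x \<in> carrier E \<Longrightarrow> (c * d) \<odot> x = c \<odot> (d \<odot> x)"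
    and sone: "\<And>x. x \<in> carrier E \<Longrightarrow> 1 \<odot> x = x"
    and szero: "\<And>x. x \<in> carrier E \<Longrightarrow> 0 \<odot> x = \<zero>"
    and nonneg: "\<And>x. x \<in> carrier E \<Longrightarrow> 0 \<le> nrm E x"
    and definite: "\<And>x. x \<in> carrier E \<Longrightarrow> nrm E x = 0 \<Longrightarrow> x = \<zero>"
    and nsmult: "\<And>c x. x \<in> carrier E \<Longrightarrow> nrm E (c \<odot> x) = cmod c * nrm E x"
    and triangle: "\<And>x y. x \<in> carrier E \<Longrightarrow> y \<in> carrier E \<Longrightarrow> nrm E (x \<oplus> y) \<le> nrm E x + nrm E y"
  shows "complex_normed_space E"
proof -
  have inv: "\<exists>y\<in>carrier E. y \<oplus> x = \<zero>" if "x \<in> carrier E" for x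
    using distr1[OF that, of "-1" 1] smult[OF that, of "-1"] sone[OF that] szero[OF that]
    by (intro bexI[of _ "(-1) \<odot> x"]) auto
  have "abelian_group E"
    by (rule abelian_groupI) (fact add zero assoc comm lzero inv)+
  then have "module scalars E"
    by (rule moduleI[OF cring_scalars]) (simp_all add: smult distr1 distr2 sassoc sone)
  moreover have "nrm E \<zero> = 0"
    using nsmult[OF zero, of 0] szero[OF zero] by simp
  ultimately show ?thesis
    by (intro complex_normed_space.intro complex_normed_space_axioms.intro)
       (blast intro: nonneg nsmult triangle definite)+
qed

context complex_normed_space
begin

lemma smult_in [simp]: "x \<in> carrier E \<Longrightarrow> c \<odot> x \<in> carrier E"
  using smult_closed by simp

lemma uminus_eq_smult: "x \<in> carrier E \<Longrightarrow> \<ominus> x = (-1) \<odot> x"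
proof -
  assume x: "x \<in> carrier E"
  have "x \<oplus> (-1) \<odot> x = \<zero>"
    using smult_l_distr[of 1 "-1" x] smult_l_null[of x] smult_one[of x] x by simp
  then have "(-1) \<odot> x \<oplus> x = \<zero>"
    using x by (simp add: M.a_comm)
  then show ?thesis
    using x by (intro M.minus_equality) auto
qed

lemma minus_eq_smult: "x \<in> carrier E \<Longrightarrow> y \<in> carrier E \<Longrightarrow> x \<ominus> y = x \<oplus> (-1) \<odot> y"
  by (simp add: a_minus_def uminus_eq_smult)

lemma smult_zero_left: "x \<in> carrier E \<Longrightarrow> 0 \<odot> x = \<zero>"
  using smult_l_null[of x] by simp

lemma nrm_zero [simp]: "nrm E \<zero> = 0"
  using nrm_eq_0_iff[of \<zero>] by simp

lemma nrm_minus: "x \<in> carrier E \<Longrightarrow> y \<in> carrier E \<Longrightarrow> nrm E (x \<ominus> y) = nrm E (y \<ominus> x)"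
proof -
  assume x: "x \<in> carrier E" and y: "y \<in> carrier E"
  have "x \<ominus> y = (-1) \<odot> (y \<ominus> x)"
    using x y smult_r_distr[of "-1" y "(-1) \<odot> x"] smult_assoc1[of "-1" "-1" x] smult_one[of x]
    by (simp add: minus_eq_smult M.a_comm)
  then show ?thesis
    using nrm_smult[of "y \<ominus> x" "-1"] x y by simp
qed

lemma minus_add_minus: "x \<in> carrier E \<Longrightarrow> y \<in> carrier E \<Longrightarrow> z \<in> carrier E \<Longrightarrow>
    (x \<ominus> y) \<oplus> (y \<ominus> z) = x \<ominus> z"
  unfolding a_minus_def by (simp add: M.a_assoc M.r_neg1)

lemma minus_eq_zero_iff: "x \<in> carrier E \<Longrightarrow> y \<in> carrier E \<Longrightarrow> x \<ominus> y = \<zero> \<longleftrightarrow> x = y"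
proof
  assume x: "x \<in> carrier E" and y: "y \<in> carrier E" and "x \<ominus> y = \<zero>"
  then have "(x \<ominus> y) \<oplus> y = y"
    by simp
  then show "x = y"
    using x y by (simp add: a_minus_def M.a_assoc M.l_neg)
qed (simp add: a_minus_def M.r_neg)

lemma metric_space_ndist: "Metric_space (carrier E) (ndist E)"
proof
  show "0 \<le> ndist E x y" for x y
    by (auto simp: ndist_def intro: nrm_nonneg)
  show "ndist E x y = ndist E y x" for x y
    by (auto simp: ndist_def nrm_minus)
  show "ndist E x y = 0 \<longleftrightarrow> x = y" if "x \<in> carrier E" "y \<in> carrier E" for x y
    using that by (simp add: ndist_def nrm_eq_0_iff minus_eq_zero_iff)
  show "ndist E x z \<le> ndist E x y + ndist E y z"
    if "x \<in> carrier E" "y \<in> carrier E" "z \<in> carrier E" for x y z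
  proof -
    have "nrm E ((x \<ominus> y) \<oplus> (y \<ominus> z)) \<le> nrm E (x \<ominus> y) + nrm E (y \<ominus> z)"
      using that by (intro nrm_triangle M.minus_closed)
    then show ?thesis
      unfolding minus_add_minus[OF that] ndist_def using that by (simp only: if_True simp_thms)
  qed
qed

lemma limitin_iff:
  assumes "range \<sigma> \<subseteq> carrier E"
  shows "limitin (Metric_space.mtopology (carrier E) (ndist E)) \<sigma> l sequentially \<longleftrightarrow>
    l \<in> carrier E \<and> (\<forall>e>0. \<exists>N. \<forall>n\<ge>N. nrm E (\<sigma> n \<ominus> l) < e)"
proof -
  have "\<sigma> n \<in> carrier E" for n
    using assms by blast
  then show ?thesis
    unfolding Metric_space.limit_metric_sequentially[OF metric_space_ndist]
    by (simp add: ndist_def cong: conj_cong)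
qed

lemma MCauchy_iff:
  assumes "range \<sigma> \<subseteq> carrier E"
  shows "Metric_space.MCauchy (carrier E) (ndist E) \<sigma> \<longleftrightarrow>
    (\<forall>e>0. \<exists>N. \<forall>m\<ge>N. \<forall>n\<ge>N. nrm E (\<sigma> m \<ominus> \<sigma> n) < e)"
proof -
  have "\<sigma> n \<in> carrier E" for n
    using assms by blast
  then show ?thesis
    unfolding Metric_space.MCauchy_def[OF metric_space_ndist] using assms
    by (simp add: ndist_def all_conj_distrib imp_conjL)
qed

lemma complex_banach_spaceI:
  assumes "\<And>\<sigma> :: nat \<Rightarrow> 'e. range \<sigma> \<subseteq> carrier E \<Longrightarrow>
      \<forall>e>0. \<exists>N. \<forall>m\<ge>N. \<forall>n\<ge>N. nrm E (\<sigma> m \<ominus> \<sigma> n) < e \<Longrightarrow>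
      \<exists>l\<in>carrier E. \<forall>e>0. \<exists>N. \<forall>n\<ge>N. nrm E (\<sigma> n \<ominus> l) < e"
  shows "complex_banach_space E"
proof (intro complex_banach_space.intro complex_normed_space_axioms complex_banach_space_axioms.intro)
  show "Metric_space.mcomplete (carrier E) (ndist E)"
    unfolding Metric_space.mcomplete_def[OF metric_space_ndist]
  proof (intro allI impI)
    fix \<sigma> assume C: "Metric_space.MCauchy (carrier E) (ndist E) \<sigma>"
    then have r: "range \<sigma> \<subseteq> carrier E"
      unfolding Metric_space.MCauchy_def[OF metric_space_ndist] by blast
    show "\<exists>l. limitin (Metric_space.mtopology (carrier E) (ndist E)) \<sigma> l sequentially"
      using assms[OF r] C unfolding MCauchy_iff[OF r] limitin_iff[OF r] by blast
  qed
qed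

lemma closed_sequentially:
  fixes S :: "'e set"
  shows "closedin (Metric_space.mtopology (carrier E) (ndist E)) S \<longleftrightarrow>
     S \<subseteq> carrier E \<and>
     (\<forall>(\<sigma> :: nat \<Rightarrow> 'e) l. range \<sigma> \<subseteq> S \<longrightarrow> l \<in> carrier E \<longrightarrow>
        (\<forall>e>0. \<exists>N. \<forall>n\<ge>N. nrm E (\<sigma> n \<ominus> l) < e) \<longrightarrow> l \<in> S)"
proof -
  have "range \<sigma> \<subseteq> S \<and> limitin (Metric_space.mtopology (carrier E) (ndist E)) \<sigma> l sequentially \<longleftrightarrow>
      range \<sigma> \<subseteq> S \<and> l \<in> carrier E \<and> (\<forall>e>0. \<exists>N. \<forall>n\<ge>N. nrm E (\<sigma> n \<ominus> l) < e)"
    if "S \<subseteq> carrier E" for \<sigma> l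
    by (rule conj_cong[OF refl]) (rule limitin_iff[OF order_trans[OF _ that]])
  then show ?thesis
    unfolding Metric_space.metric_closedin_iff_sequentially_closed[OF metric_space_ndist]
    by (simp add: imp_conjL cong: conj_cong)
qed

end

lemma (in complex_banach_space) cauchy_converges:
  fixes \<sigma> :: "nat \<Rightarrow> 'e"
  assumes r: "range \<sigma> \<subseteq> carrier E" and C: "\<forall>e>0. \<exists>N. \<forall>m\<ge>N. \<forall>n\<ge>N. nrm E (\<sigma> m \<ominus> \<sigma> n) < e"
  obtains l where "l \<in> carrier E" "\<forall>e>0. \<exists>N. \<forall>n\<ge>N. nrm E (\<sigma> n \<ominus> l) < e"
proof -
  have "Metric_space.MCauchy (carrier E) (ndist E) \<sigma>"
    using C unfolding MCauchy_iff[OF r] .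
  then obtain l where "limitin (Metric_space.mtopology (carrier E) (ndist E)) \<sigma> l sequentially"
    using complete unfolding Metric_space.mcomplete_def[OF metric_space_ndist] by blast
  then show ?thesis
    using that unfolding limitin_iff[OF r] by blast
qed

text \<open>
  Closure of \<open>E\<close> under its own operations is part of the definition, so that a record about which nothing
  else is known inherits the structure of \<open>V\<close>.
\<close>

definition isometric_iso ::
    "('e, 'm) normed_module_scheme \<Rightarrow> ('f, 'n) normed_module_scheme \<Rightarrow> ('e \<Rightarrow> 'f) \<Rightarrow> bool" where
  "isometric_iso E V T \<longleftrightarrow>
     bij_betw T (carrier E) (carrier V) \<and>
     \<zero>\<^bsub>E\<^esub> \<in> carrier E \<and> T \<zero>\<^bsub>E\<^esub> = \<zero>\<^bsub>V\<^esub> \<and>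
     (\<forall>x\<in>carrier E. \<forall>y\<in>carrier E. x \<oplus>\<^bsub>E\<^esub> y \<in> carrier E \<and> T (x \<oplus>\<^bsub>E\<^esub> y) = T x \<oplus>\<^bsub>V\<^esub> T y) \<and>
     (\<forall>c. \<forall>x\<in>carrier E. c \<odot>\<^bsub>E\<^esub> x \<in> carrier E \<and> T (c \<odot>\<^bsub>E\<^esub> x) = c \<odot>\<^bsub>V\<^esub> T x) \<and>
     (\<forall>x\<in>carrier E. nrm E x = nrm V (T x))"

lemma complex_normed_space_iso:
  assumes "complex_normed_space V" and iso: "isometric_iso E V T"
  shows "complex_normed_space E"
proof -
  interpret V: complex_normed_space V by fact
  have bij: "bij_betw T (carrier E) (carrier V)" and z: "\<zero>\<^bsub>E\<^esub> \<in> carrier E" "T \<zero>\<^bsub>E\<^esub> = \<zero>\<^bsub>V\<^esub>"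
    and a: "\<And>x y. x \<in> carrier E \<Longrightarrow> y \<in> carrier E \<Longrightarrow> x \<oplus>\<^bsub>E\<^esub> y \<in> carrier E"
       "\<And>x y. x \<in> carrier E \<Longrightarrow> y \<in> carrier E \<Longrightarrow> T (x \<oplus>\<^bsub>E\<^esub> y) = T x \<oplus>\<^bsub>V\<^esub> T y"
    and s: "\<And>c x. x \<in> carrier E \<Longrightarrow> c \<odot>\<^bsub>E\<^esub> x \<in> carrier E"
       "\<And>c x. x \<in> carrier E \<Longrightarrow> T (c \<odot>\<^bsub>E\<^esub> x) = c \<odot>\<^bsub>V\<^esub> T x"
    and n: "\<And>x. x \<in> carrier E \<Longrightarrow> nrm E x = nrm V (T x)"
    using iso unfolding isometric_iso_def by auto
  have T [simp]: "T x \<in> carrier V" if "x \<in> carrier E" for x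
    using bij that by (auto simp: bij_betw_def)
  have inj: "x = y" if "T x = T y" "x \<in> carrier E" "y \<in> carrier E" for x y
    using bij that by (auto simp: bij_betw_def inj_on_def)
  show ?thesis
  proof (rule complex_normed_spaceI)
    show "x \<oplus>\<^bsub>E\<^esub> y \<oplus>\<^bsub>E\<^esub> w = x \<oplus>\<^bsub>E\<^esub> (y \<oplus>\<^bsub>E\<^esub> w)"
      if "x \<in> carrier E" "y \<in> carrier E" "w \<in> carrier E" for x y w
      by (rule inj) (use that in \<open>simp_all add: a V.M.a_assoc\<close>)
    show "x \<oplus>\<^bsub>E\<^esub> y = y \<oplus>\<^bsub>E\<^esub> x" if "x \<in> carrier E" "y \<in> carrier E" for x y
      by (rule inj) (use that in \<open>simp_all add: a V.M.a_comm\<close>)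
    show "\<zero>\<^bsub>E\<^esub> \<oplus>\<^bsub>E\<^esub> x = x" if "x \<in> carrier E" for x
      by (rule inj) (use that in \<open>simp_all add: a z\<close>)
    show "(c + d) \<odot>\<^bsub>E\<^esub> x = c \<odot>\<^bsub>E\<^esub> x \<oplus>\<^bsub>E\<^esub> d \<odot>\<^bsub>E\<^esub> x" if "x \<in> carrier E" for c d x
      by (rule inj) (use that V.smult_l_distr[of c d "T x"] in \<open>simp_all add: a s\<close>)
    show "c \<odot>\<^bsub>E\<^esub> (x \<oplus>\<^bsub>E\<^esub> y) = c \<odot>\<^bsub>E\<^esub> x \<oplus>\<^bsub>E\<^esub> c \<odot>\<^bsub>E\<^esub> y" if "x \<in> carrier E" "y \<in> carrier E" for c x y
      by (rule inj) (use that V.smult_r_distr[of c "T x" "T y"] in \<open>simp_all add: a s\<close>)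
    show "(c * d) \<odot>\<^bsub>E\<^esub> x = c \<odot>\<^bsub>E\<^esub> (d \<odot>\<^bsub>E\<^esub> x)" if "x \<in> carrier E" for c d x
      by (rule inj) (use that V.smult_assoc1[of c d "T x"] in \<open>simp_all add: s\<close>)
    show "1 \<odot>\<^bsub>E\<^esub> x = x" if "x \<in> carrier E" for x
      by (rule inj) (use that V.smult_one[of "T x"] in \<open>simp_all add: s\<close>)
    show "0 \<odot>\<^bsub>E\<^esub> x = \<zero>\<^bsub>E\<^esub>" if "x \<in> carrier E" for x
      by (rule inj) (use that V.smult_zero_left[of "T x"] in \<open>simp_all add: s z\<close>)
    show "x = \<zero>\<^bsub>E\<^esub>" if "x \<in> carrier E" "nrm E x = 0" for x
      by (rule inj) (use that in \<open>simp_all add: n z V.nrm_eq_0_iff\<close>)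
  qed (simp_all add: a s z n V.nrm_nonneg V.nrm_smult V.nrm_triangle)
qed

lemma complex_banach_space_iso:
  assumes "complex_banach_space V" and iso: "isometric_iso E V T"
  shows "complex_banach_space E"
proof -
  interpret V: complex_banach_space V by fact
  interpret E: complex_normed_space E
    by (rule complex_normed_space_iso[OF V.complex_normed_space_axioms iso])
  have im: "T ` carrier E = carrier V"
    using iso by (auto simp: isometric_iso_def bij_betw_def)
  have d: "nrm E (x \<ominus>\<^bsub>E\<^esub> y) = nrm V (T x \<ominus>\<^bsub>V\<^esub> T y)" if "x \<in> carrier E" "y \<in> carrier E" for x y
  proof -
    have "T x \<in> carrier V" "T y \<in> carrier V"
      using that im by auto
    then show ?thesis
      using that iso by (simp add: isometric_iso_def E.minus_eq_smult V.minus_eq_smult)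
  qed
  show ?thesis
  proof (rule E.complex_banach_spaceI)
    fix \<sigma> :: "nat \<Rightarrow> _"
    assume r: "range \<sigma> \<subseteq> carrier E"
      and C: "\<forall>e>0. \<exists>N. \<forall>m\<ge>N. \<forall>n\<ge>N. nrm E (\<sigma> m \<ominus>\<^bsub>E\<^esub> \<sigma> n) < e"
    then have rn: "\<sigma> n \<in> carrier E" for n
      by auto
    have "range (T \<circ> \<sigma>) \<subseteq> carrier V"
      using r im by auto
    moreover have "\<forall>e>0. \<exists>N. \<forall>m\<ge>N. \<forall>n\<ge>N. nrm V ((T \<circ> \<sigma>) m \<ominus>\<^bsub>V\<^esub> (T \<circ> \<sigma>) n) < e"
      using C by (simp add: d rn)
    ultimately obtain l where l: "l \<in> carrier V"
        "\<forall>e>0. \<exists>N. \<forall>n\<ge>N. nrm V ((T \<circ> \<sigma>) n \<ominus>\<^bsub>V\<^esub> l) < e"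
      by (rule V.cauchy_converges)
    moreover obtain x where "x \<in> carrier E" "l = T x"
      using l(1) im by auto
    ultimately show "\<exists>l\<in>carrier E. \<forall>e>0. \<exists>N. \<forall>n\<ge>N. nrm E (\<sigma> n \<ominus>\<^bsub>E\<^esub> l) < e"
      by (intro bexI[of _ x]) (auto simp: d rn)
  qed
qed

section \<open>Dual spaces and dual bimodules\<close>

lemma dual_space_simps [simp]:
  "zero (dual_space E) = (\<lambda>x\<in>carrier E. 0)"
  "add (dual_space E) = (\<lambda>\<phi> \<psi>. \<lambda>x\<in>carrier E. \<phi> x + \<psi> x)"
  "smult (dual_space E) = (\<lambda>c \<phi>. \<lambda>x\<in>carrier E. c * \<phi> x)"
  by (simp_all add: dual_space_def)

lemma dual_spaceI:
  assumes "\<phi> \<in> extensional (carrier E)"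
    and "\<And>x y. x \<in> carrier E \<Longrightarrow> y \<in> carrier E \<Longrightarrow> \<phi> (x \<oplus>\<^bsub>E\<^esub> y) = \<phi> x + \<phi> y"
    and "\<And>c x. x \<in> carrier E \<Longrightarrow> \<phi> (c \<odot>\<^bsub>E\<^esub> x) = c * \<phi> x"
    and "\<And>x. x \<in> carrier E \<Longrightarrow> cmod (\<phi> x) \<le> K * nrm E x"
  shows "\<phi> \<in> carrier (dual_space E)"
  using assms(1-3) assms(4) by (auto simp: dual_space_def cbounded_linear_def intro!: exI[of _ K])

lemma dual_spaceD:
  assumes "\<phi> \<in> carrier (dual_space E)"
  shows "\<phi> \<in> extensional (carrier E)"
    and "\<And>x y. x \<in> carrier E \<Longrightarrow> y \<in> carrier E \<Longrightarrow> \<phi> (x \<oplus>\<^bsub>E\<^esub> y) = \<phi> x + \<phi> y"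
    and "\<And>c x. x \<in> carrier E \<Longrightarrow> \<phi> (c \<odot>\<^bsub>E\<^esub> x) = c * \<phi> x"
    and "\<exists>K. \<forall>x\<in>carrier E. cmod (\<phi> x) \<le> K * nrm E x"
  using assms by (auto simp: dual_space_def cbounded_linear_def)

lemma dual_space_eqI:
  assumes "\<phi> \<in> carrier (dual_space E)" "\<psi> \<in> carrier (dual_space E)"
    and "\<And>x. x \<in> carrier E \<Longrightarrow> \<phi> x = \<psi> x"
  shows "\<phi> = \<psi>"
  using assms by (meson dual_spaceD(1) extensionalityI)

context complex_normed_space
begin

lemma dual_zero_arg: "\<phi> \<in> carrier (dual_space E) \<Longrightarrow> \<phi> \<zero> = 0"
  using dual_spaceD(3)[of \<phi> E \<zero> 0] smult_zero_left[of \<zero>] by simp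

lemma nrm_scaled_le_1:
  assumes "x \<in> carrier E"
  shows "nrm E (complex_of_real (inverse (nrm E x)) \<odot> x) \<le> 1"
  using assms nrm_nonneg[of x] by (simp add: nrm_smult norm_inverse) (cases "nrm E x = 0", simp_all)

lemma dual_nrm_bound:
  assumes \<phi>: "\<phi> \<in> carrier (dual_space E)" and x: "x \<in> carrier E"
  shows "cmod (\<phi> x) \<le> nrm (dual_space E) \<phi> * nrm E x"
proof (cases "nrm E x = 0")
  case True
  then show ?thesis
    using x dual_zero_arg[OF \<phi>] by (simp add: nrm_eq_0_iff)
next
  case False
  obtain K where K: "\<And>x. x \<in> carrier E \<Longrightarrow> cmod (\<phi> x) \<le> K * nrm E x"
    using dual_spaceD(4)[OF \<phi>] by blast
  have "cmod (\<phi> y) \<le> \<bar>K\<bar>" if "y \<in> carrier E" "nrm E y \<le> 1" for y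
  proof -
    have "cmod (\<phi> y) \<le> \<bar>K\<bar> * nrm E y"
      using K[OF that(1)] nrm_nonneg[OF that(1)] by (meson abs_ge_self mult_right_mono order_trans)
    also have "\<dots> \<le> \<bar>K\<bar> * 1"
      using that by (intro mult_left_mono) auto
    finally show ?thesis by simp
  qed
  then have bdd: "bdd_above ((\<lambda>x. cmod (\<phi> x)) ` {x \<in> carrier E. nrm E x \<le> 1})"
    by (intro bdd_aboveI2) auto
  define y where "y = complex_of_real (inverse (nrm E x)) \<odot> x"
  have y: "y \<in> carrier E" "nrm E y \<le> 1"
    using x nrm_scaled_le_1[OF x] by (simp_all add: y_def)
  have "cmod (\<phi> y) \<le> nrm (dual_space E) \<phi>"
    using bdd y by (auto simp: dual_space_def intro!: cSUP_upper2[of _ _ y])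
  then show ?thesis
    using False nrm_nonneg[OF x] x \<phi>
    by (simp add: y_def dual_spaceD(3) norm_mult norm_divide norm_inverse field_simps)
qed

lemma dual_nrm_least:
  assumes "\<And>x. x \<in> carrier E \<Longrightarrow> nrm E x \<le> 1 \<Longrightarrow> cmod (\<phi> x) \<le> K"
  shows "nrm (dual_space E) \<phi> \<le> K"
proof -
  have "\<zero> \<in> {x \<in> carrier E. nrm E x \<le> 1}"
    by simp
  then show ?thesis
    using assms unfolding dual_space_def by (auto intro!: cSUP_least)
qed

lemma dual_nrm_least':
  assumes "0 \<le> K" "\<And>x. x \<in> carrier E \<Longrightarrow> cmod (\<phi> x) \<le> K * nrm E x"
  shows "nrm (dual_space E) \<phi> \<le> K"
proof (rule dual_nrm_least)
  fix x assume x: "x \<in> carrier E" "nrm E x \<le> 1"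
  then show "cmod (\<phi> x) \<le> K"
    using assms(2)[OF x(1)] mult_left_mono[OF x(2) assms(1)] by simp
qed

lemma dual_add_closed:
  assumes "\<phi> \<in> carrier (dual_space E)" "\<psi> \<in> carrier (dual_space E)"
  shows "(\<lambda>x\<in>carrier E. \<phi> x + \<psi> x) \<in> carrier (dual_space E)"
proof (rule dual_spaceI)
  show "cmod ((\<lambda>x\<in>carrier E. \<phi> x + \<psi> x) x)
      \<le> (nrm (dual_space E) \<phi> + nrm (dual_space E) \<psi>) * nrm E x" if "x \<in> carrier E" for x
    using that dual_nrm_bound[OF assms(1) that] dual_nrm_bound[OF assms(2) that]
      norm_triangle_ineq[of "\<phi> x" "\<psi> x"] by (simp add: algebra_simps)
qed (use assms in \<open>auto simp: dual_spaceD algebra_simps\<close>)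

lemma dual_smult_closed:
  assumes "\<phi> \<in> carrier (dual_space E)"
  shows "(\<lambda>x\<in>carrier E. c * \<phi> x) \<in> carrier (dual_space E)"
proof (rule dual_spaceI)
  show "cmod ((\<lambda>x\<in>carrier E. c * \<phi> x) x) \<le> (cmod c * nrm (dual_space E) \<phi>) * nrm E x"
    if "x \<in> carrier E" for x
    using that dual_nrm_bound[OF assms(1) that]
    by (simp add: norm_mult mult_left_mono mult.assoc)
qed (use assms in \<open>auto simp: dual_spaceD algebra_simps\<close>)

lemma dual_nrm_nonneg: "\<phi> \<in> carrier (dual_space E) \<Longrightarrow> 0 \<le> nrm (dual_space E) \<phi>"
proof -
  assume \<phi>: "\<phi> \<in> carrier (dual_space E)"
  show ?thesis
  proof (cases "\<exists>x\<in>carrier E. x \<noteq> \<zero>")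
    case True
    then obtain x where x: "x \<in> carrier E" "nrm E x > 0"
      using nrm_eq_0_iff nrm_nonneg by (metis less_eq_real_def)
    have "0 \<le> nrm (dual_space E) \<phi> * nrm E x"
      using dual_nrm_bound[OF \<phi> x(1)] norm_ge_zero order_trans by blast
    then show ?thesis
      using x by (simp add: zero_le_mult_iff)
  next
    case False
    then have "{x \<in> carrier E. nrm E x \<le> 1} = {\<zero>}"
      by auto
    then show ?thesis
      by (simp add: dual_space_def)
  qed
qed

lemma dual_normed: "complex_normed_space (dual_space E)"
proof (rule complex_normed_spaceI)
  show "\<zero>\<^bsub>dual_space E\<^esub> \<in> carrier (dual_space E)"
    by (rule dual_spaceI[where K = 0]) auto
  show "\<phi> = \<zero>\<^bsub>dual_space E\<^esub>"
    if \<phi>: "\<phi> \<in> carrier (dual_space E)" and "nrm (dual_space E) \<phi> = 0" for \<phi>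
    using dual_nrm_bound[OF \<phi>] that(2) dual_spaceD(1)[OF \<phi>]
    by (intro extensionalityI[where A = "carrier E"]) auto
  have le: "nrm (dual_space E) (c \<odot>\<^bsub>dual_space E\<^esub> \<phi>) \<le> cmod c * nrm (dual_space E) \<phi>"
    if \<phi>: "\<phi> \<in> carrier (dual_space E)" for c \<phi>
  proof (rule dual_nrm_least')
    show "cmod ((c \<odot>\<^bsub>dual_space E\<^esub> \<phi>) x) \<le> cmod c * nrm (dual_space E) \<phi> * nrm E x"
      if "x \<in> carrier E" for x
      using that dual_nrm_bound[OF \<phi> that] by (simp add: norm_mult mult_left_mono mult.assoc)
  qed (simp add: dual_nrm_nonneg \<phi>)
  show "nrm (dual_space E) (c \<odot>\<^bsub>dual_space E\<^esub> \<phi>) = cmod c * nrm (dual_space E) \<phi>"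
    if \<phi>: "\<phi> \<in> carrier (dual_space E)" for c \<phi>
  proof (cases "c = 0")
    case True
    have "c \<odot>\<^bsub>dual_space E\<^esub> \<phi> \<in> carrier (dual_space E)"
      using dual_smult_closed[OF \<phi>] by simp
    then show ?thesis
      using le[OF \<phi>, of c] dual_nrm_nonneg[of "c \<odot>\<^bsub>dual_space E\<^esub> \<phi>"] True by simp
  next
    case False
    have "inverse c \<odot>\<^bsub>dual_space E\<^esub> (c \<odot>\<^bsub>dual_space E\<^esub> \<phi>) = \<phi>"
      using False dual_spaceD(1)[OF \<phi>] by (intro extensionalityI[where A = "carrier E"]) auto
    then have "nrm (dual_space E) \<phi> \<le> cmod (inverse c) * nrm (dual_space E) (c \<odot>\<^bsub>dual_space E\<^esub> \<phi>)"
      using le[of "c \<odot>\<^bsub>dual_space E\<^esub> \<phi>" "inverse c"] dual_smult_closed[OF \<phi>, of c] by simp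
    then show ?thesis
      using le[OF \<phi>, of c] False by (intro antisym) (simp_all add: norm_inverse norm_divide field_simps)
  qed
  show "nrm (dual_space E) (\<phi> \<oplus>\<^bsub>dual_space E\<^esub> \<psi>) \<le> nrm (dual_space E) \<phi> + nrm (dual_space E) \<psi>"
    if \<phi>: "\<phi> \<in> carrier (dual_space E)" and \<psi>: "\<psi> \<in> carrier (dual_space E)" for \<phi> \<psi>
  proof (rule dual_nrm_least')
    show "cmod ((\<phi> \<oplus>\<^bsub>dual_space E\<^esub> \<psi>) x)
        \<le> (nrm (dual_space E) \<phi> + nrm (dual_space E) \<psi>) * nrm E x" if "x \<in> carrier E" for x
      using that dual_nrm_bound[OF \<phi> that] dual_nrm_bound[OF \<psi> that]
        norm_triangle_ineq[of "\<phi> x" "\<psi> x"] by (simp add: algebra_simps)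
  qed (simp add: dual_nrm_nonneg \<phi> \<psi>)
  show "\<zero>\<^bsub>dual_space E\<^esub> \<oplus>\<^bsub>dual_space E\<^esub> \<phi> = \<phi>" if "\<phi> \<in> carrier (dual_space E)" for \<phi>
    using dual_spaceD(1)[OF that] by (intro extensionalityI[where A = "carrier E"]) auto
  show "1 \<odot>\<^bsub>dual_space E\<^esub> \<phi> = \<phi>" if "\<phi> \<in> carrier (dual_space E)" for \<phi>
    using dual_spaceD(1)[OF that] by (intro extensionalityI[where A = "carrier E"]) auto
  show "\<phi> \<oplus>\<^bsub>dual_space E\<^esub> \<psi> \<in> carrier (dual_space E)"
    if "\<phi> \<in> carrier (dual_space E)" "\<psi> \<in> carrier (dual_space E)" for \<phi> \<psi>
    using dual_add_closed[OF that] by simp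
  show "c \<odot>\<^bsub>dual_space E\<^esub> \<phi> \<in> carrier (dual_space E)" if "\<phi> \<in> carrier (dual_space E)" for c \<phi>
    using dual_smult_closed[OF that] by simp
qed (simp_all add: dual_nrm_nonneg restrict_def fun_eq_iff algebra_simps)

lemma dual_minus_apply:
  "\<phi> \<in> carrier (dual_space E) \<Longrightarrow> \<psi> \<in> carrier (dual_space E) \<Longrightarrow> x \<in> carrier E \<Longrightarrow>
     (\<phi> \<ominus>\<^bsub>dual_space E\<^esub> \<psi>) x = \<phi> x - \<psi> x"
  by (simp add: complex_normed_space.minus_eq_smult[OF dual_normed])

text \<open>
  The Cauchy estimate is uniform on the unit ball, so the pointwise limit of a Cauchy sequence of
  functionals is also its limit in norm.
\<close>

lemma dual_banach: "complex_banach_space (dual_space E)"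
proof -
  interpret D: complex_normed_space "dual_space E"
    by (rule dual_normed)
  show ?thesis
  proof (rule D.complex_banach_spaceI)
    fix \<sigma> :: "nat \<Rightarrow> 'e \<Rightarrow> complex" assume r: "range \<sigma> \<subseteq> carrier (dual_space E)"
      and C: "\<forall>e>0. \<exists>N. \<forall>m\<ge>N. \<forall>n\<ge>N. nrm (dual_space E) (\<sigma> m \<ominus>\<^bsub>dual_space E\<^esub> \<sigma> n) < e"
    have \<sigma>: "\<sigma> n \<in> carrier (dual_space E)" for n
      using r by auto
    have diff: "cmod (\<sigma> m x - \<sigma> n x) \<le> nrm (dual_space E) (\<sigma> m \<ominus>\<^bsub>dual_space E\<^esub> \<sigma> n) * nrm E x"
      if "x \<in> carrier E" for m n x
      using dual_nrm_bound[of "\<sigma> m \<ominus>\<^bsub>dual_space E\<^esub> \<sigma> n" x] that \<sigma> by (simp add: dual_minus_apply)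
    define \<phi> where "\<phi> = (\<lambda>x\<in>carrier E. lim (\<lambda>n. \<sigma> n x))"
    have conv: "(\<lambda>n. \<sigma> n x) \<longlonglongrightarrow> \<phi> x" if x: "x \<in> carrier E" for x
    proof -
      have "Cauchy (\<lambda>n. \<sigma> n x)"
      proof (rule metric_CauchyI)
        fix e :: real assume e: "e > 0"
        have n0: "nrm E x \<ge> 0"
          by (simp add: nrm_nonneg x)
        have "e / (nrm E x + 1) > 0"
          using e n0 by simp
        then obtain N where N: "\<And>m n. m \<ge> N \<Longrightarrow> n \<ge> N \<Longrightarrow>
            nrm (dual_space E) (\<sigma> m \<ominus>\<^bsub>dual_space E\<^esub> \<sigma> n) < e / (nrm E x + 1)"
          using C by meson
        have "dist (\<sigma> m x) (\<sigma> n x) < e" if "m \<ge> N" "n \<ge> N" for m n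
        proof -
          have "dist (\<sigma> m x) (\<sigma> n x) \<le> e / (nrm E x + 1) * nrm E x"
            using diff[OF x, of m n] N[OF that] n0
            by (smt (verit) dist_norm mult_right_mono)
          also have "\<dots> < e"
            using e n0 by (simp add: field_simps)
          finally show ?thesis .
        qed
        then show "\<exists>N. \<forall>m\<ge>N. \<forall>n\<ge>N. dist (\<sigma> m x) (\<sigma> n x) < e"
          by blast
      qed
      then show ?thesis
        using x by (simp add: \<phi>_def Cauchy_convergent_iff convergent_LIMSEQ_iff)
    qed
    have close: "cmod (\<sigma> n x - \<phi> x) \<le> e * nrm E x"
      if N: "\<forall>m\<ge>N. \<forall>n\<ge>N. nrm (dual_space E) (\<sigma> m \<ominus>\<^bsub>dual_space E\<^esub> \<sigma> n) < e"
        and n: "n \<ge> N" and x: "x \<in> carrier E" for N e n x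
    proof (rule tendsto_upperbound)
      show "(\<lambda>m. cmod (\<sigma> n x - \<sigma> m x)) \<longlonglongrightarrow> cmod (\<sigma> n x - \<phi> x)"
        by (intro tendsto_intros conv x)
      show "\<forall>\<^sub>F m in sequentially. cmod (\<sigma> n x - \<sigma> m x) \<le> e * nrm E x"
      proof (rule eventually_sequentiallyI)
        fix m assume "N \<le> m"
        then show "cmod (\<sigma> n x - \<sigma> m x) \<le> e * nrm E x"
          using diff[OF x, of n m] N n nrm_nonneg[OF x]
          by (meson less_imp_le mult_right_mono order_trans)
      qed
    qed simp
    obtain N1 where N1: "\<forall>m\<ge>N1. \<forall>n\<ge>N1. nrm (dual_space E) (\<sigma> m \<ominus>\<^bsub>dual_space E\<^esub> \<sigma> n) < 1"
      using C zero_less_one by blast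
    have \<phi>: "\<phi> \<in> carrier (dual_space E)"
    proof (rule dual_spaceI)
      show "\<phi> (x \<oplus> y) = \<phi> x + \<phi> y" if "x \<in> carrier E" "y \<in> carrier E" for x y
        using conv[of "x \<oplus> y"] tendsto_add[OF conv[of x] conv[of y]] that \<sigma>
        by (simp add: dual_spaceD LIMSEQ_unique)
      show "\<phi> (c \<odot> x) = c * \<phi> x" if "x \<in> carrier E" for c x
        using conv[of "c \<odot> x"] tendsto_mult_left[OF conv[of x], of c] that \<sigma>
        by (simp add: dual_spaceD LIMSEQ_unique)
      show "cmod (\<phi> x) \<le> (nrm (dual_space E) (\<sigma> N1) + 1) * nrm E x" if "x \<in> carrier E" for x
        using close[OF N1, of N1 x] dual_nrm_bound[OF \<sigma>, of x N1] that
          norm_triangle_sub[of "\<phi> x" "\<sigma> N1 x"] norm_minus_commute[of "\<phi> x" "\<sigma> N1 x"]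
        by (simp add: algebra_simps)
    qed (simp add: \<phi>_def)
    have "\<exists>N. \<forall>n\<ge>N. nrm (dual_space E) (\<sigma> n \<ominus>\<^bsub>dual_space E\<^esub> \<phi>) < e" if "e > 0" for e
    proof -
      obtain N where N: "\<forall>m\<ge>N. \<forall>n\<ge>N. nrm (dual_space E) (\<sigma> m \<ominus>\<^bsub>dual_space E\<^esub> \<sigma> n) < e/2"
        using C \<open>e > 0\<close> half_gt_zero by blast
      have "nrm (dual_space E) (\<sigma> n \<ominus>\<^bsub>dual_space E\<^esub> \<phi>) \<le> e / 2" if "n \<ge> N" for n
        using close[OF N that] \<sigma> \<phi> \<open>e > 0\<close> by (intro dual_nrm_least') (auto simp: dual_minus_apply)
      moreover have "e / 2 < e"
        using \<open>e > 0\<close> by simp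
      ultimately show ?thesis
        using order_le_less_trans by blast
    qed
    then show "\<exists>l\<in>carrier (dual_space E). \<forall>e>0. \<exists>N. \<forall>n\<ge>N. nrm (dual_space E) (\<sigma> n \<ominus>\<^bsub>dual_space E\<^esub> l) < e"
      using \<phi> by blast
  qed
qed

end

lemma dual_bimodule_simps [simp]:
  "carrier (dual_bimodule E) = carrier (dual_space E)"
  "zero (dual_bimodule E) = (\<lambda>x\<in>carrier E. 0)"
  "add (dual_bimodule E) = (\<lambda>\<phi> \<psi>. \<lambda>x\<in>carrier E. \<phi> x + \<psi> x)"
  "smult (dual_bimodule E) = (\<lambda>c \<phi>. \<lambda>x\<in>carrier E. c * \<phi> x)"
  "nrm (dual_bimodule E) = nrm (dual_space E)"
  "lact (dual_bimodule E) a \<phi> = adjoint_map E (\<lambda>x. ract E x a) \<phi>"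
  "ract (dual_bimodule E) \<phi> a = adjoint_map E (\<lambda>x. lact E a x) \<phi>"
  by (simp_all add: dual_bimodule_def dual_space_def normed_module.extend_def normed_bimodule.fields_def)

lemma adjoint_map_apply [simp]: "x \<in> carrier E \<Longrightarrow> adjoint_map E T \<phi> x = \<phi> (T x)"
  by (simp add: adjoint_map_def)

lemma dual_bimodule_banach_space:
  fixes E :: "('a, 'e, 'm) normed_bimodule_scheme"
  assumes "complex_normed_space E"
  shows "complex_banach_space (dual_bimodule E)"
proof -
  interpret E: complex_normed_space E by fact
  interpret D: complex_normed_space "dual_space E"
    by (rule E.dual_normed)
  have "isometric_iso (dual_bimodule E) (dual_space E) (\<lambda>\<phi>. \<phi>)"
    unfolding isometric_iso_def using D.M.zero_closed E.dual_add_closed E.dual_smult_closed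
    by (auto simp: bij_betw_def)
  then show ?thesis
    by (rule complex_banach_space_iso[OF E.dual_banach])
qed

lemma dual_bimodule_normed:
  fixes E :: "('a, 'e, 'm) normed_bimodule_scheme"
  shows "complex_normed_space E \<Longrightarrow> complex_normed_space (dual_bimodule E)"
  using dual_bimodule_banach_space complex_banach_space.axioms(1) by blast

lemma dual_bimodule_minus_apply:
  fixes E :: "('a, 'e, 'm) normed_bimodule_scheme"
  shows "complex_normed_space E \<Longrightarrow> \<phi> \<in> carrier (dual_space E) \<Longrightarrow> \<psi> \<in> carrier (dual_space E) \<Longrightarrow>
    x \<in> carrier E \<Longrightarrow> (\<phi> \<ominus>\<^bsub>dual_bimodule E\<^esub> \<psi>) x = \<phi> x - \<psi> x"
  by (simp add: complex_normed_space.minus_eq_smult[OF dual_bimodule_normed])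

context complex_normed_space
begin

lemma adjoint_map_closed:
  assumes T: "cbounded_linear E E T" and \<phi>: "\<phi> \<in> carrier (dual_space E)"
  shows "adjoint_map E T \<phi> \<in> carrier (dual_space E)"
proof -
  obtain K where K: "\<And>x. x \<in> carrier E \<Longrightarrow> nrm E (T x) \<le> K * nrm E x"
    using T unfolding cbounded_linear_def by blast
  have T': "T x \<in> carrier E" if "x \<in> carrier E" for x
    using T that by (auto simp: cbounded_linear_def)
  show ?thesis
  proof (rule dual_spaceI)
    fix x assume x: "x \<in> carrier E"
    have "cmod (\<phi> (T x)) \<le> nrm (dual_space E) \<phi> * nrm E (T x)"
      by (rule dual_nrm_bound[OF \<phi> T'[OF x]])
    also have "\<dots> \<le> nrm (dual_space E) \<phi> * (K * nrm E x)"
      by (intro mult_left_mono K x dual_nrm_nonneg \<phi>)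
    finally show "cmod (adjoint_map E T \<phi> x) \<le> (nrm (dual_space E) \<phi> * K) * nrm E x"
      using x by (simp add: mult.assoc)
  qed (use T T' \<phi> in \<open>auto simp: cbounded_linear_def adjoint_map_def dual_spaceD\<close>)
qed

end

lemma (in complex_normed_space) submodule_normed:
  assumes "submodule P scalars E"
  shows "complex_normed_space (E\<lparr>carrier := P\<rparr>)"
proof (intro complex_normed_space.intro complex_normed_space_axioms.intro)
  show "module scalars (E\<lparr>carrier := P\<rparr>)"
    by (rule submodule.submodule_is_module[OF assms module_axioms])
  have "x \<in> carrier E" if "x \<in> P" for x
    using submoduleE(1)[OF assms] that by blast
  then show "x \<in> carrier (E\<lparr>carrier := P\<rparr>) \<Longrightarrow> 0 \<le> nrm (E\<lparr>carrier := P\<rparr>) x"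
    "x \<in> carrier (E\<lparr>carrier := P\<rparr>) \<Longrightarrow>
      nrm (E\<lparr>carrier := P\<rparr>) x = 0 \<longleftrightarrow> x = \<zero>\<^bsub>E\<lparr>carrier := P\<rparr>\<^esub>"
    "x \<in> carrier (E\<lparr>carrier := P\<rparr>) \<Longrightarrow>
      nrm (E\<lparr>carrier := P\<rparr>) (c \<odot>\<^bsub>E\<lparr>carrier := P\<rparr>\<^esub> x) = cmod c * nrm (E\<lparr>carrier := P\<rparr>) x"
    "x \<in> carrier (E\<lparr>carrier := P\<rparr>) \<Longrightarrow> y \<in> carrier (E\<lparr>carrier := P\<rparr>) \<Longrightarrow>
      nrm (E\<lparr>carrier := P\<rparr>) (x \<oplus>\<^bsub>E\<lparr>carrier := P\<rparr>\<^esub> y)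
        \<le> nrm (E\<lparr>carrier := P\<rparr>) x + nrm (E\<lparr>carrier := P\<rparr>) y" for x y c
    by (simp_all add: nrm_nonneg nrm_eq_0_iff nrm_smult nrm_triangle)
qed

section \<open>Banach bimodules, their duals and their preduals\<close>

locale complex_normed_magma = complex_normed_space A
  for A :: "('a, 'l) normed_module_scheme" (structure) +
  assumes mult_in [simp]: "a \<in> carrier A \<Longrightarrow> b \<in> carrier A \<Longrightarrow> a \<otimes> b \<in> carrier A"

context complex_normed_magma
begin

lemma banach_bimodule_iso:
  assumes V: "banach_bimodule A V" and iso: "isometric_iso E V T"
    and l: "\<And>a x. a \<in> carrier A \<Longrightarrow> x \<in> carrier E \<Longrightarrow> lact E a x \<in> carrier E"
      "\<And>a x. a \<in> carrier A \<Longrightarrow> x \<in> carrier E \<Longrightarrow> T (lact E a x) = lact V a (T x)"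
    and r: "\<And>a x. a \<in> carrier A \<Longrightarrow> x \<in> carrier E \<Longrightarrow> ract E x a \<in> carrier E"
      "\<And>a x. a \<in> carrier A \<Longrightarrow> x \<in> carrier E \<Longrightarrow> T (ract E x a) = ract V (T x) a"
  shows "banach_bimodule A E"
proof -
  interpret V: banach_bimodule A V by fact
  interpret E: complex_banach_space E
    by (rule complex_banach_space_iso[OF V.complex_banach_space_axioms iso])
  have inj: "x = y" if "T x = T y" "x \<in> carrier E" "y \<in> carrier E" for x y
    using iso that by (auto simp: isometric_iso_def bij_betw_def inj_on_def)
  have T: "T x \<in> carrier V" if "x \<in> carrier E" for x
    using iso that by (auto simp: isometric_iso_def bij_betw_def)
  have a: "T (x \<oplus>\<^bsub>E\<^esub> y) = T x \<oplus>\<^bsub>V\<^esub> T y" if "x \<in> carrier E" "y \<in> carrier E" for x y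
    using iso that by (auto simp: isometric_iso_def)
  have s: "T (c \<odot>\<^bsub>E\<^esub> x) = c \<odot>\<^bsub>V\<^esub> T x" if "x \<in> carrier E" for c x
    using iso that by (auto simp: isometric_iso_def)
  have n: "nrm E x = nrm V (T x)" if "x \<in> carrier E" for x
    using iso that by (auto simp: isometric_iso_def)
  note simps = l r T a s n E.M.a_closed E.smult_in M.a_closed smult_in
  show ?thesis
  proof (intro banach_bimodule.intro E.complex_banach_space_axioms banach_bimodule_axioms.intro l(1) r(1))
    fix a b x y c assume ab: "a \<in> carrier A" "b \<in> carrier A" and xy: "x \<in> carrier E" "y \<in> carrier E"
    show "lact E (a \<oplus> b) x = lact E a x \<oplus>\<^bsub>E\<^esub> lact E b x"
      using ab xy by (intro inj) (simp_all add: simps V.lact_add_left)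
    show "lact E a (x \<oplus>\<^bsub>E\<^esub> y) = lact E a x \<oplus>\<^bsub>E\<^esub> lact E a y"
      using ab xy by (intro inj) (simp_all add: simps V.lact_add_right)
    show "lact E (c \<odot> a) x = c \<odot>\<^bsub>E\<^esub> lact E a x"
      using ab xy by (intro inj) (simp_all add: simps V.lact_smult_left)
    show "lact E a (c \<odot>\<^bsub>E\<^esub> x) = c \<odot>\<^bsub>E\<^esub> lact E a x"
      using ab xy by (intro inj) (simp_all add: simps V.lact_smult_right)
    show "ract E (x \<oplus>\<^bsub>E\<^esub> y) a = ract E x a \<oplus>\<^bsub>E\<^esub> ract E y a"
      using ab xy by (intro inj) (simp_all add: simps V.ract_add_left)
    show "ract E x (a \<oplus> b) = ract E x a \<oplus>\<^bsub>E\<^esub> ract E x b"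
      using ab xy by (intro inj) (simp_all add: simps V.ract_add_right)
    show "ract E (c \<odot>\<^bsub>E\<^esub> x) a = c \<odot>\<^bsub>E\<^esub> ract E x a"
      using ab xy by (intro inj) (simp_all add: simps V.ract_smult_left)
    show "ract E x (c \<odot> a) = c \<odot>\<^bsub>E\<^esub> ract E x a"
      using ab xy by (intro inj) (simp_all add: simps V.ract_smult_right)
    show "lact E a (lact E b x) = lact E (a \<otimes> b) x"
      using ab xy by (intro inj) (simp_all add: simps V.lact_lact)
    show "ract E (ract E x a) b = ract E x (a \<otimes> b)"
      using ab xy by (intro inj) (simp_all add: simps V.ract_ract)
    show "lact E a (ract E x b) = ract E (lact E a x) b"
      using ab xy by (intro inj) (simp_all add: simps V.lact_ract)
  next
    show "\<exists>K. \<forall>a\<in>carrier A. \<forall>x\<in>carrier E. nrm E (lact E a x) \<le> K * nrm A a * nrm E x"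
    proof -
      obtain K where "\<And>a y. a \<in> carrier A \<Longrightarrow> y \<in> carrier V \<Longrightarrow> nrm V (lact V a y) \<le> K * nrm A a * nrm V y"
        using V.lact_bounded by blast
      then show ?thesis
        by (intro exI[of _ K]) (simp add: simps)
    qed
    show "\<exists>K. \<forall>a\<in>carrier A. \<forall>x\<in>carrier E. nrm E (ract E x a) \<le> K * nrm A a * nrm E x"
    proof -
      obtain K where "\<And>a y. a \<in> carrier A \<Longrightarrow> y \<in> carrier V \<Longrightarrow> nrm V (ract V y a) \<le> K * nrm A a * nrm V y"
        using V.ract_bounded by blast
      then show ?thesis
        by (intro exI[of _ K]) (simp add: simps)
    qed
  qed
qed

lemma bounded_mult_nonneg:
  assumes "\<exists>K. \<forall>a\<in>carrier A. \<forall>x\<in>carrier E. nrm E (f a x) \<le> K * nrm A a * nrm E x"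
    and "complex_normed_space E"
  obtains K where "K \<ge> 0" "\<And>a x. a \<in> carrier A \<Longrightarrow> x \<in> carrier E \<Longrightarrow> nrm E (f a x) \<le> K * nrm A a * nrm E x"
proof -
  obtain K where K: "\<And>a x. a \<in> carrier A \<Longrightarrow> x \<in> carrier E \<Longrightarrow> nrm E (f a x) \<le> K * nrm A a * nrm E x"
    using assms(1) by blast
  have "nrm E (f a x) \<le> \<bar>K\<bar> * nrm A a * nrm E x" if "a \<in> carrier A" "x \<in> carrier E" for a x
    using K[OF that] nrm_nonneg[OF that(1)] complex_normed_space.nrm_nonneg[OF assms(2) that(2)]
    by (meson abs_ge_self mult_right_mono order_trans)
  then show ?thesis
    using that[of "\<bar>K\<bar>"] by simp
qed

lemma lact_cbounded_linear:
  assumes "banach_bimodule A E" "a \<in> carrier A"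
  shows "cbounded_linear E E (lact E a)"
proof -
  interpret E: banach_bimodule A E by fact
  show ?thesis
    using E.lact_bounded assms(2)
    by (auto simp: cbounded_linear_def E.lact_closed E.lact_add_right E.lact_smult_right)
qed

lemma ract_cbounded_linear:
  assumes "banach_bimodule A E" "a \<in> carrier A"
  shows "cbounded_linear E E (\<lambda>x. ract E x a)"
proof -
  interpret E: banach_bimodule A E by fact
  show ?thesis
    using E.ract_bounded assms(2)
    by (auto simp: cbounded_linear_def E.ract_closed E.ract_add_left E.ract_smult_left)
qed

lemma dual_bimodule_banach:
  assumes "banach_bimodule A E"
  shows "banach_bimodule A (dual_bimodule E)"
proof -
  interpret E: banach_bimodule A E by fact
  have bound: "\<exists>K. \<forall>a\<in>carrier A. \<forall>\<phi>\<in>carrier (dual_bimodule E).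
      nrm (dual_bimodule E) (adjoint_map E (f a) \<phi>) \<le> K * nrm A a * nrm (dual_bimodule E) \<phi>"
    if f: "\<exists>K. \<forall>a\<in>carrier A. \<forall>x\<in>carrier E. nrm E (f a x) \<le> K * nrm A a * nrm E x"
      and cl: "\<And>a x. a \<in> carrier A \<Longrightarrow> x \<in> carrier E \<Longrightarrow> f a x \<in> carrier E" for f
  proof -
    obtain K where K: "K \<ge> 0"
        "\<And>a x. a \<in> carrier A \<Longrightarrow> x \<in> carrier E \<Longrightarrow> nrm E (f a x) \<le> K * nrm A a * nrm E x"
      using bounded_mult_nonneg[OF f E.complex_normed_space_axioms] by blast
    have "nrm (dual_space E) (adjoint_map E (f a) \<phi>) \<le> K * nrm A a * nrm (dual_space E) \<phi>"
      if a: "a \<in> carrier A" and \<phi>: "\<phi> \<in> carrier (dual_space E)" for a \<phi>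
    proof (rule E.dual_nrm_least')
      show "0 \<le> K * nrm A a * nrm (dual_space E) \<phi>"
        using K(1) nrm_nonneg[OF a] E.dual_nrm_nonneg[OF \<phi>] by simp
      fix x assume x: "x \<in> carrier E"
      have "cmod (\<phi> (f a x)) \<le> nrm (dual_space E) \<phi> * nrm E (f a x)"
        by (rule E.dual_nrm_bound[OF \<phi> cl[OF a x]])
      also have "\<dots> \<le> nrm (dual_space E) \<phi> * (K * nrm A a * nrm E x)"
        by (intro mult_left_mono K(2) a x E.dual_nrm_nonneg \<phi>)
      finally show "cmod (adjoint_map E (f a) \<phi> x) \<le> K * nrm A a * nrm (dual_space E) \<phi> * nrm E x"
        using x by (simp add: mult_ac)
    qed
    then show ?thesis
      by auto
  qed
  have cl: "adjoint_map E (\<lambda>x. ract E x a) \<phi> \<in> carrier (dual_space E)"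
       "adjoint_map E (lact E a) \<phi> \<in> carrier (dual_space E)"
    if "a \<in> carrier A" "\<phi> \<in> carrier (dual_space E)" for a \<phi>
    using E.adjoint_map_closed[OF ract_cbounded_linear] E.adjoint_map_closed[OF lact_cbounded_linear]
      assms that by auto
  note simps = adjoint_map_def restrict_def fun_eq_iff dual_spaceD E.lact_closed E.ract_closed
    E.lact_add_left E.lact_add_right E.lact_smult_left E.lact_smult_right
    E.ract_add_left E.ract_add_right E.ract_smult_left E.ract_smult_right
    E.lact_lact E.ract_ract E.lact_ract
  show ?thesis
  proof (intro banach_bimodule.intro dual_bimodule_banach_space[OF E.complex_normed_space_axioms] banach_bimodule_axioms.intro)
    show "\<exists>K. \<forall>a\<in>carrier A. \<forall>\<phi>\<in>carrier (dual_bimodule E).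
      nrm (dual_bimodule E) (lact (dual_bimodule E) a \<phi>) \<le> K * nrm A a * nrm (dual_bimodule E) \<phi>"
      using bound[OF E.ract_bounded] E.ract_closed by simp
    show "\<exists>K. \<forall>a\<in>carrier A. \<forall>\<phi>\<in>carrier (dual_bimodule E).
      nrm (dual_bimodule E) (ract (dual_bimodule E) \<phi> a) \<le> K * nrm A a * nrm (dual_bimodule E) \<phi>"
      using bound[OF E.lact_bounded] E.lact_closed by simp
  qed (simp_all add: cl, simp_all add: simps)
qed

text \<open>
  The predual is a closed subspace of the dual bimodule, which is complete.
\<close>

lemma predual_bimodule_banach:
  assumes "dual_banach_bimodule A E P"
  shows "banach_bimodule A ((dual_bimodule E)\<lparr>carrier := P\<rparr>)"
proof -
  interpret E: dual_banach_bimodule A E P by fact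
  interpret D: banach_bimodule A "dual_bimodule E"
    by (rule dual_bimodule_banach) (rule E.banach_bimodule_axioms)
  let ?V = "(dual_bimodule E)\<lparr>carrier := P\<rparr>"
  have PD: "P \<subseteq> carrier (dual_bimodule E)"
    using D.submoduleE(1)[OF E.predual_submodule] .
  then have PDD: "\<phi> \<in> carrier (dual_bimodule E)" if "\<phi> \<in> P" for \<phi>
    using that by blast
  interpret V: complex_normed_space ?V
    by (rule D.submodule_normed) (rule E.predual_submodule)
  have minus: "\<phi> \<ominus>\<^bsub>?V\<^esub> \<psi> = \<phi> \<ominus>\<^bsub>dual_bimodule E\<^esub> \<psi>" if "\<phi> \<in> P" "\<psi> \<in> P" for \<phi> \<psi>
    using V.minus_eq_smult[of \<phi> \<psi>] D.minus_eq_smult[of \<phi> \<psi>] that PDD by simp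
  have "complex_banach_space ?V"
  proof (rule V.complex_banach_spaceI)
    fix \<sigma> :: "nat \<Rightarrow> _"
    assume r: "range \<sigma> \<subseteq> carrier ?V"
      and C: "\<forall>e>0. \<exists>N. \<forall>m\<ge>N. \<forall>n\<ge>N. nrm ?V (\<sigma> m \<ominus>\<^bsub>?V\<^esub> \<sigma> n) < e"
    have \<sigma>: "\<sigma> n \<in> P" for n
      using r by auto
    have r': "range \<sigma> \<subseteq> carrier (dual_bimodule E)"
      using \<sigma> PD by blast
    have "\<forall>e>0. \<exists>N. \<forall>m\<ge>N. \<forall>n\<ge>N. nrm (dual_bimodule E) (\<sigma> m \<ominus>\<^bsub>dual_bimodule E\<^esub> \<sigma> n) < e"
      using C by (simp add: minus \<sigma>)
    from D.cauchy_converges[OF r' this] obtain l where l: "l \<in> carrier (dual_bimodule E)"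
        "\<forall>e>0. \<exists>N. \<forall>n\<ge>N. nrm (dual_bimodule E) (\<sigma> n \<ominus>\<^bsub>dual_bimodule E\<^esub> l) < e" .
    then have "l \<in> P"
      using E.predual_closed \<sigma> unfolding D.closed_sequentially by blast
    then show "\<exists>l\<in>carrier ?V. \<forall>e>0. \<exists>N. \<forall>n\<ge>N. nrm ?V (\<sigma> n \<ominus>\<^bsub>?V\<^esub> l) < e"
      using l(2) by (intro bexI[of _ l]) (simp_all add: minus \<sigma>)
  qed
  then show ?thesis
  proof (intro banach_bimodule.intro banach_bimodule_axioms.intro)
    show "\<exists>K. \<forall>a\<in>carrier A. \<forall>x\<in>carrier ?V. nrm ?V (lact ?V a x) \<le> K * nrm A a * nrm ?V x"
      using D.lact_bounded PDD by simp blast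
    show "\<exists>K. \<forall>a\<in>carrier A. \<forall>x\<in>carrier ?V. nrm ?V (ract ?V x a) \<le> K * nrm A a * nrm ?V x"
      using D.ract_bounded PDD by simp blast
  qed (use E.predual_lact E.predual_ract PDD D.lact_add_left D.lact_add_right D.lact_smult_left
      D.lact_smult_right D.ract_add_left D.ract_add_right D.ract_smult_left D.ract_smult_right
      D.lact_lact D.ract_ract D.lact_ract in \<open>simp_all del: dual_bimodule_simps(2-)\<close>)
qed

text \<open>
  Evaluation at the elements of the predual identifies \<open>E\<close> with the dual of its predual as a bimodule,
  and pointwise amenability applies to the derivation transported along it.
\<close>

lemma pointwise_amenable_imp_pointwise_connes_amenable:
  assumes "pointwise_amenable TYPE('e \<Rightarrow> complex) A"
  shows "pointwise_connes_amenable TYPE('e) A Q"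
  unfolding pointwise_connes_amenable_def
proof (intro ballI allI impI)
  fix a\<^sub>0 and E :: "('a, 'e) normed_bimodule" and P D
  assume a0: "a\<^sub>0 \<in> carrier A" and "dual_banach_bimodule A E P" and D: "derivation A E D"
  interpret E: dual_banach_bimodule A E P by fact
  let ?V = "(dual_bimodule E)\<lparr>carrier := P\<rparr>"
  have V: "banach_bimodule A ?V"
    by (rule predual_bimodule_banach) fact
  interpret V: banach_bimodule A ?V by (rule V)
  interpret D: complex_normed_space "dual_bimodule E"
    by (rule dual_bimodule_normed[OF E.complex_normed_space_axioms])
  have PD: "\<phi> \<in> carrier (dual_space E)" if "\<phi> \<in> P" for \<phi>
    using D.submoduleE(1)[OF E.predual_submodule] that by auto
  have ev: "eval_on P x \<in> carrier (dual_space ?V)" if "x \<in> carrier E" for x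
    using E.predual_bij that by (auto simp: bij_betw_def)
  have Dcl: "D a \<in> carrier E" if "a \<in> carrier A" for a
    using D that by (auto simp: derivation_def cbounded_linear_def)
  have act: "adjoint_map ?V (\<lambda>\<phi>. ract ?V \<phi> a) (eval_on P x) = eval_on P (lact E a x)"
      "adjoint_map ?V (lact ?V a) (eval_on P x) = eval_on P (ract E x a)"
    if "a \<in> carrier A" "x \<in> carrier E" for a x
    using that E.predual_lact E.predual_ract
    by (auto simp: adjoint_map_def eval_on_def restrict_def fun_eq_iff)
  have "derivation A (dual_bimodule ?V) (\<lambda>a. eval_on P (D a))"
    unfolding derivation_def
  proof (intro conjI ballI)
    have "\<exists>K. \<forall>a\<in>carrier A. nrm (dual_space ?V) (eval_on P (D a)) \<le> K * nrm A a"
      using D E.predual_isometric Dcl by (auto simp: derivation_def cbounded_linear_def)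
    then show "cbounded_linear A (dual_bimodule ?V) (\<lambda>a. eval_on P (D a))"
      using D PD Dcl ev unfolding derivation_def cbounded_linear_def
      by (auto simp: eval_on_def restrict_def fun_eq_iff dual_spaceD)
    fix a b assume ab: "a \<in> carrier A" "b \<in> carrier A"
    then have "D (a \<otimes> b) = ract E (D a) b \<oplus>\<^bsub>E\<^esub> lact E a (D b)"
      using D by (auto simp: derivation_def)
    then show "eval_on P (D (a \<otimes> b)) = ract (dual_bimodule ?V) (eval_on P (D a)) b
        \<oplus>\<^bsub>dual_bimodule ?V\<^esub> lact (dual_bimodule ?V) a (eval_on P (D b))"
      using ab Dcl PD unfolding dual_bimodule_simps(3,6,7)
      by (simp only: act) (simp add: eval_on_def restrict_def fun_eq_iff dual_spaceD E.lact_closed E.ract_closed)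
  qed
  then obtain \<phi> where \<phi>: "\<phi> \<in> carrier (dual_space ?V)"
    "eval_on P (D a\<^sub>0) = lact (dual_bimodule ?V) a\<^sub>0 \<phi> \<ominus>\<^bsub>dual_bimodule ?V\<^esub> ract (dual_bimodule ?V) \<phi> a\<^sub>0"
    using assms a0 V unfolding pointwise_amenable_def pointwise_amenable_at_def dual_bimodule_simps(1)
    by blast
  obtain x where x: "x \<in> carrier E" "\<phi> = eval_on P x"
    using E.predual_bij \<phi>(1) by (auto simp: bij_betw_def)
  let ?y = "lact E a\<^sub>0 x \<ominus>\<^bsub>E\<^esub> ract E x a\<^sub>0"
  have y: "lact E a\<^sub>0 x \<in> carrier E" "ract E x a\<^sub>0 \<in> carrier E"
    using a0 x(1) by (simp_all add: E.lact_closed E.ract_closed)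
  have "eval_on P (D a\<^sub>0) = eval_on P ?y"
  proof (rule dual_space_eqI[of _ ?V])
    fix \<psi> assume \<psi>: "\<psi> \<in> carrier ?V"
    have "eval_on P (D a\<^sub>0) \<psi> = eval_on P (lact E a\<^sub>0 x) \<psi> - eval_on P (ract E x a\<^sub>0) \<psi>"
      unfolding \<phi>(2) x(2) dual_bimodule_simps(6,7) act[OF a0 x(1)]
      by (rule dual_bimodule_minus_apply[OF V.complex_normed_space_axioms ev[OF y(1)] ev[OF y(2)] \<psi>])
    also have "\<dots> = eval_on P ?y \<psi>"
      using \<psi> y PD by (simp add: eval_on_def E.minus_eq_smult dual_spaceD)
    finally show "eval_on P (D a\<^sub>0) \<psi> = eval_on P ?y \<psi>" .
  qed (use y a0 Dcl ev in auto)
  then have "D a\<^sub>0 = ?y"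
    using E.predual_bij a0 y Dcl by (auto simp: bij_betw_def inj_on_def)
  then show "\<exists>x\<in>carrier E. D a\<^sub>0 = lact E a\<^sub>0 x \<ominus>\<^bsub>E\<^esub> ract E x a\<^sub>0"
    using x(1) by blast
qed

text \<open>
  Conversely, an isometric copy \<open>E\<close> of the dual of a Banach bimodule \<open>X\<close> is a dual Banach bimodule; its
  predual consists of the evaluations at the elements of \<open>X\<close>. A functional on the predual, composed with
  the evaluations, is a functional on \<open>X\<close>, so it comes from \<open>E\<close>. The hypothesis \<open>norming\<close> says that \<open>X\<close>
  embeds isometrically into its bidual, as the Hahn-Banach theorem asserts; for spaces with a supremum
  norm the point evaluations show it. It makes the predual complete, hence closed.
\<close>

lemma dual_banach_bimodule_evaluations:
  fixes X :: "('a, 'x, 'm) normed_bimodule_scheme" and E :: "('a, 'e, 'n) normed_bimodule_scheme"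
  assumes X: "banach_bimodule A X" and iso: "isometric_iso E (dual_bimodule X) T"
    and l: "\<And>a M. a \<in> carrier A \<Longrightarrow> M \<in> carrier E \<Longrightarrow> lact E a M \<in> carrier E"
      "\<And>a M. a \<in> carrier A \<Longrightarrow> M \<in> carrier E \<Longrightarrow> T (lact E a M) = lact (dual_bimodule X) a (T M)"
    and r: "\<And>a M. a \<in> carrier A \<Longrightarrow> M \<in> carrier E \<Longrightarrow> ract E M a \<in> carrier E"
      "\<And>a M. a \<in> carrier A \<Longrightarrow> M \<in> carrier E \<Longrightarrow> T (ract E M a) = ract (dual_bimodule X) (T M) a"
    and norming: "\<And>F c. F \<in> carrier X \<Longrightarrow>
      (\<And>m. m \<in> carrier (dual_space X) \<Longrightarrow> nrm (dual_space X) m \<le> 1 \<Longrightarrow> cmod (m F) \<le> c) \<Longrightarrow> nrm X F \<le> c"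
  shows "dual_banach_bimodule A E ((\<lambda>F. \<lambda>M\<in>carrier E. T M F) ` carrier X)"
proof -
  interpret X: banach_bimodule A X by (rule X)
  interpret XD: banach_bimodule A "dual_bimodule X" by (rule dual_bimodule_banach[OF X])
  interpret E: banach_bimodule A E
    by (rule banach_bimodule_iso[OF XD.banach_bimodule_axioms iso l r])
  interpret D: banach_bimodule A "dual_bimodule E"
    by (rule dual_bimodule_banach[OF E.banach_bimodule_axioms])
  define ev where "ev = (\<lambda>F. \<lambda>M\<in>carrier E. T M F)"
  define P where "P = ev ` carrier X"
  have T: "T M \<in> carrier (dual_space X)" if "M \<in> carrier E" for M
    using iso that by (auto simp: isometric_iso_def bij_betw_def)
  have Tsurj: "\<exists>M\<in>carrier E. T M = m" if "m \<in> carrier (dual_space X)" for m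
    using iso that unfolding isometric_iso_def bij_betw_def by (metis dual_bimodule_simps(1) imageE)
  have Tinj: "M = M'" if "T M = T M'" "M \<in> carrier E" "M' \<in> carrier E" for M M'
    using iso that by (auto simp: isometric_iso_def bij_betw_def inj_on_def)
  have Tadd: "T (M \<oplus>\<^bsub>E\<^esub> M') F = T M F + T M' F"
    if "M \<in> carrier E" "M' \<in> carrier E" "F \<in> carrier X" for M M' F
    using iso that by (auto simp: isometric_iso_def)
  have Tsmult: "T (c \<odot>\<^bsub>E\<^esub> M) F = c * T M F" if "M \<in> carrier E" "F \<in> carrier X" for c M F
    using iso that by (auto simp: isometric_iso_def)
  have Tnrm: "nrm (dual_space X) (T M) = nrm E M" if "M \<in> carrier E" for M
    using iso that by (auto simp: isometric_iso_def)
  have Tbound: "cmod (T M F) \<le> nrm E M * nrm X F" if "M \<in> carrier E" "F \<in> carrier X" for M F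
    using X.dual_nrm_bound[OF T[OF that(1)] that(2)] Tnrm[OF that(1)] by simp
  have ev_apply [simp]: "ev F M = T M F" if "M \<in> carrier E" for F M
    using that by (simp add: ev_def)
  have ev: "ev F \<in> carrier (dual_space E)" if "F \<in> carrier X" for F
    by (rule dual_spaceI[where K = "nrm X F"])
      (use that Tadd Tsmult Tbound in \<open>auto simp: ev_def mult.commute\<close>)
  have ev_add: "ev (F \<oplus>\<^bsub>X\<^esub> G) = ev F \<oplus>\<^bsub>dual_bimodule E\<^esub> ev G"
    if "F \<in> carrier X" "G \<in> carrier X" for F G
    using that dual_spaceD(2)[OF T] by (auto simp: ev_def restrict_def fun_eq_iff)
  have ev_smult: "ev (c \<odot>\<^bsub>X\<^esub> F) = c \<odot>\<^bsub>dual_bimodule E\<^esub> ev F" if "F \<in> carrier X" for c F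
    using that dual_spaceD(3)[OF T] by (auto simp: ev_def restrict_def fun_eq_iff)
  have ev_minus: "ev (F \<ominus>\<^bsub>X\<^esub> G) = ev F \<ominus>\<^bsub>dual_bimodule E\<^esub> ev G"
    if "F \<in> carrier X" "G \<in> carrier X" for F G
    using that ev by (simp add: X.minus_eq_smult D.minus_eq_smult ev_add ev_smult del: dual_bimodule_simps(3,4))
  have ev_le: "nrm (dual_space E) (ev F) \<le> nrm X F" if "F \<in> carrier X" for F
    by (rule E.dual_nrm_least') (use that X.nrm_nonneg Tbound in \<open>auto simp: mult.commute\<close>)
  have ev_ge: "nrm X F \<le> nrm (dual_space E) (ev F)" if F: "F \<in> carrier X" for F
  proof (rule norming[OF F])
    fix m assume m: "m \<in> carrier (dual_space X)" "nrm (dual_space X) m \<le> 1"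
    then obtain M where M: "M \<in> carrier E" "T M = m"
      using Tsurj by blast
    then have "cmod (m F) \<le> nrm (dual_space E) (ev F) * nrm E M"
      using E.dual_nrm_bound[OF ev[OF F], of M] by simp
    also have "\<dots> \<le> nrm (dual_space E) (ev F) * 1"
      using m M Tnrm[OF M(1)] E.dual_nrm_nonneg[OF ev[OF F]] by (intro mult_left_mono) auto
    finally show "cmod (m F) \<le> nrm (dual_space E) (ev F)"
      by simp
  qed
  have sub: "submodule P scalars (dual_bimodule E)"
  proof (rule D.submoduleI)
    show "\<zero>\<^bsub>dual_bimodule E\<^esub> \<in> P"
      using ev_smult[of "\<zero>\<^bsub>X\<^esub>" 0] X.smult_zero_left[of "\<zero>\<^bsub>X\<^esub>"] D.smult_zero_left ev
      unfolding P_def by (metis X.M.zero_closed dual_bimodule_simps(1) imageI)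
    show sm: "c \<odot>\<^bsub>dual_bimodule E\<^esub> \<phi> \<in> P" if "\<phi> \<in> P" for c \<phi>
      using that ev_smult unfolding P_def by (metis (no_types, lifting) X.smult_in image_iff)
    show "\<phi> \<oplus>\<^bsub>dual_bimodule E\<^esub> \<psi> \<in> P" if "\<phi> \<in> P" "\<psi> \<in> P" for \<phi> \<psi>
      using that ev_add unfolding P_def by (metis (no_types, lifting) X.M.a_closed image_iff)
    show "\<ominus>\<^bsub>dual_bimodule E\<^esub> \<phi> \<in> P" if "\<phi> \<in> P" for \<phi>
    proof -
      have "\<phi> \<in> carrier (dual_bimodule E)"
        using that ev by (auto simp: P_def)
      then show ?thesis
        using sm[OF that, of "-1"] by (simp only: D.uminus_eq_smult)
    qed
  qed (use ev in \<open>auto simp: P_def\<close>)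
  let ?V = "(dual_bimodule E)\<lparr>carrier := P\<rparr>"
  interpret V: complex_normed_space ?V
    by (rule D.submodule_normed[OF sub])
  have evV: "ev F \<in> carrier ?V" if "F \<in> carrier X" for F
    using that by (simp add: P_def)
  have evP: "eval_on P M (ev F) = T M F" if "M \<in> carrier E" "F \<in> carrier X" for M F
    using that by (simp add: eval_on_def P_def)
  have eval_dual: "eval_on P M \<in> carrier (dual_space ?V)" if M: "M \<in> carrier E" for M
  proof (rule dual_spaceI)
    show "eval_on P M (\<phi> \<oplus>\<^bsub>?V\<^esub> \<psi>) = eval_on P M \<phi> + eval_on P M \<psi>"
      if "\<phi> \<in> carrier ?V" "\<psi> \<in> carrier ?V" for \<phi> \<psi>
      using that V.M.a_closed[of \<phi> \<psi>] M by (simp add: eval_on_def)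
    show "eval_on P M (c \<odot>\<^bsub>?V\<^esub> \<phi>) = c * eval_on P M \<phi>" if "\<phi> \<in> carrier ?V" for c \<phi>
      using that V.smult_in[of \<phi> c] M by (simp add: eval_on_def)
    show "cmod (eval_on P M \<phi>) \<le> nrm E M * nrm ?V \<phi>" if "\<phi> \<in> carrier ?V" for \<phi>
      using that ev E.dual_nrm_bound[of \<phi> M] M by (auto simp: eval_on_def P_def mult.commute)
  qed (simp add: eval_on_def)
  have bij: "bij_betw (eval_on P) (carrier E) (carrier (dual_space ?V))"
    unfolding bij_betw_def
  proof
    show "inj_on (eval_on P) (carrier E)"
    proof (rule inj_onI)
      fix M M' assume M: "M \<in> carrier E" "M' \<in> carrier E" "eval_on P M = eval_on P M'"
      have "T M = T M'"
        using M evP by (intro dual_space_eqI[OF T T]) metis+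
      then show "M = M'"
        using M Tinj by blast
    qed
    have "\<Lambda> \<in> eval_on P ` carrier E" if \<Lambda>: "\<Lambda> \<in> carrier (dual_space ?V)" for \<Lambda>
    proof -
      define m where "m = (\<lambda>F\<in>carrier X. \<Lambda> (ev F))"
      have "m \<in> carrier (dual_space X)"
      proof (rule dual_spaceI)
        show "m (F \<oplus>\<^bsub>X\<^esub> G) = m F + m G" if "F \<in> carrier X" "G \<in> carrier X" for F G
          using dual_spaceD(2)[OF \<Lambda> evV evV, OF that] that
          by (simp add: m_def ev_add del: dual_bimodule_simps(3))
        show "m (c \<odot>\<^bsub>X\<^esub> F) = c * m F" if "F \<in> carrier X" for c F
          using dual_spaceD(3)[OF \<Lambda> evV, OF that] that
          by (simp add: m_def ev_smult del: dual_bimodule_simps(4))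
        show "cmod (m F) \<le> nrm (dual_space ?V) \<Lambda> * nrm X F" if F: "F \<in> carrier X" for F
        proof -
          have "cmod (m F) \<le> nrm (dual_space ?V) \<Lambda> * nrm (dual_space E) (ev F)"
            using V.dual_nrm_bound[OF \<Lambda> evV[OF F]] F by (simp add: m_def)
          also have "\<dots> \<le> nrm (dual_space ?V) \<Lambda> * nrm X F"
            by (intro mult_left_mono ev_le F V.dual_nrm_nonneg \<Lambda>)
          finally show ?thesis .
        qed
      qed (simp add: m_def)
      then obtain M where M: "M \<in> carrier E" "T M = m"
        using Tsurj by blast
      have "\<Lambda> = eval_on P M"
        by (rule dual_space_eqI[OF \<Lambda> eval_dual[OF M(1)]])
          (use M evP in \<open>auto simp: P_def m_def\<close>)
      then show ?thesis
        using M(1) by blast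
    qed
    then show "eval_on P ` carrier E = carrier (dual_space ?V)"
      using eval_dual by blast
  qed
  have isometric: "nrm (dual_space ?V) (eval_on P M) = nrm E M" if M: "M \<in> carrier E" for M
  proof (rule antisym)
    show "nrm (dual_space ?V) (eval_on P M) \<le> nrm E M"
    proof (rule V.dual_nrm_least')
      show "cmod (eval_on P M \<phi>) \<le> nrm E M * nrm ?V \<phi>" if "\<phi> \<in> carrier ?V" for \<phi>
        using that ev E.dual_nrm_bound[of \<phi> M] M by (auto simp: eval_on_def P_def mult.commute)
    qed (rule E.nrm_nonneg[OF M])
    have "nrm (dual_space X) (T M) \<le> nrm (dual_space ?V) (eval_on P M)"
    proof (rule X.dual_nrm_least')
      show "cmod (T M F) \<le> nrm (dual_space ?V) (eval_on P M) * nrm X F" if F: "F \<in> carrier X" for F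
      proof -
        have "cmod (T M F) \<le> nrm (dual_space ?V) (eval_on P M) * nrm (dual_space E) (ev F)"
          using V.dual_nrm_bound[OF eval_dual[OF M] evV[OF F]] by (simp add: evP[OF M F])
        also have "\<dots> \<le> nrm (dual_space ?V) (eval_on P M) * nrm X F"
          by (intro mult_left_mono ev_le F V.dual_nrm_nonneg eval_dual M)
        finally show ?thesis .
      qed
    qed (rule V.dual_nrm_nonneg[OF eval_dual[OF M]])
    then show "nrm E M \<le> nrm (dual_space ?V) (eval_on P M)"
      using Tnrm[OF M] by simp
  qed
  have closed: "closedin (Metric_space.mtopology (carrier (dual_bimodule E)) (ndist (dual_bimodule E))) P"
    unfolding D.closed_sequentially
  proof (intro conjI allI impI)
    show "P \<subseteq> carrier (dual_bimodule E)"
      using ev by (auto simp: P_def)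
    fix \<sigma> :: "nat \<Rightarrow> 'e \<Rightarrow> complex" and \<phi>
    assume "range \<sigma> \<subseteq> P" and \<phi>: "\<phi> \<in> carrier (dual_bimodule E)"
      and lim: "\<forall>e>0. \<exists>N. \<forall>n\<ge>N. nrm (dual_bimodule E) (\<sigma> n \<ominus>\<^bsub>dual_bimodule E\<^esub> \<phi>) < e"
    then have "\<forall>n. \<exists>F. F \<in> carrier X \<and> \<sigma> n = ev F"
      unfolding P_def by blast
    then obtain F where F: "\<And>n. F n \<in> carrier X" and \<sigma>: "\<And>n. \<sigma> n = ev (F n)"
      by metis
    have \<sigma>cl: "\<sigma> n \<in> carrier (dual_bimodule E)" for n
      using ev[OF F] by (simp add: \<sigma>)
    have XF: "nrm X (F m \<ominus>\<^bsub>X\<^esub> F n) \<le> nrm (dual_bimodule E) (\<sigma> m \<ominus>\<^bsub>dual_bimodule E\<^esub> \<phi>)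
        + nrm (dual_bimodule E) (\<sigma> n \<ominus>\<^bsub>dual_bimodule E\<^esub> \<phi>)" for m n
    proof -
      have "nrm X (F m \<ominus>\<^bsub>X\<^esub> F n) \<le> nrm (dual_bimodule E) (\<sigma> m \<ominus>\<^bsub>dual_bimodule E\<^esub> \<sigma> n)"
        using ev_ge[of "F m \<ominus>\<^bsub>X\<^esub> F n"] F by (simp add: \<sigma> ev_minus)
      also have "\<dots> = nrm (dual_bimodule E)
          ((\<sigma> m \<ominus>\<^bsub>dual_bimodule E\<^esub> \<phi>) \<oplus>\<^bsub>dual_bimodule E\<^esub> (\<phi> \<ominus>\<^bsub>dual_bimodule E\<^esub> \<sigma> n))"
        using D.minus_add_minus[OF \<sigma>cl \<phi> \<sigma>cl] by simp
      also have "\<dots> \<le> nrm (dual_bimodule E) (\<sigma> m \<ominus>\<^bsub>dual_bimodule E\<^esub> \<phi>)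
        + nrm (dual_bimodule E) (\<phi> \<ominus>\<^bsub>dual_bimodule E\<^esub> \<sigma> n)"
        by (intro D.nrm_triangle D.M.minus_closed \<sigma>cl \<phi>)
      finally show ?thesis
        using D.nrm_minus[OF \<phi> \<sigma>cl] by simp
    qed
    have "\<forall>e>0. \<exists>N. \<forall>m\<ge>N. \<forall>n\<ge>N. nrm X (F m \<ominus>\<^bsub>X\<^esub> F n) < e"
    proof (intro allI impI)
      fix e :: real assume "e > 0"
      then obtain N where N: "\<And>n. n \<ge> N \<Longrightarrow> nrm (dual_bimodule E) (\<sigma> n \<ominus>\<^bsub>dual_bimodule E\<^esub> \<phi>) < e / 2"
        using lim half_gt_zero by blast
      have "nrm X (F m \<ominus>\<^bsub>X\<^esub> F n) < e" if "m \<ge> N" "n \<ge> N" for m n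
        using XF[of m n] N[OF that(1)] N[OF that(2)] by linarith
      then show "\<exists>N. \<forall>m\<ge>N. \<forall>n\<ge>N. nrm X (F m \<ominus>\<^bsub>X\<^esub> F n) < e"
        by blast
    qed
    moreover have "range F \<subseteq> carrier X"
      using F by blast
    ultimately obtain G where G: "G \<in> carrier X" "\<forall>e>0. \<exists>N. \<forall>n\<ge>N. nrm X (F n \<ominus>\<^bsub>X\<^esub> G) < e"
      using X.cauchy_converges by metis
    have evG: "ev G \<in> carrier (dual_bimodule E)"
      using ev[OF G(1)] by simp
    have "nrm (dual_bimodule E) (\<phi> \<ominus>\<^bsub>dual_bimodule E\<^esub> ev G) < e" if "e > 0" for e
    proof -
      obtain N1 where N1: "\<And>n. n \<ge> N1 \<Longrightarrow> nrm (dual_bimodule E) (\<sigma> n \<ominus>\<^bsub>dual_bimodule E\<^esub> \<phi>) < e / 2"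
        using lim \<open>e > 0\<close> half_gt_zero by blast
      obtain N2 where N2: "\<And>n. n \<ge> N2 \<Longrightarrow> nrm X (F n \<ominus>\<^bsub>X\<^esub> G) < e / 2"
        using G(2) \<open>e > 0\<close> half_gt_zero by blast
      let ?n = "max N1 N2"
      have "nrm (dual_bimodule E) (\<phi> \<ominus>\<^bsub>dual_bimodule E\<^esub> ev G) = nrm (dual_bimodule E)
          ((\<phi> \<ominus>\<^bsub>dual_bimodule E\<^esub> \<sigma> ?n) \<oplus>\<^bsub>dual_bimodule E\<^esub> (\<sigma> ?n \<ominus>\<^bsub>dual_bimodule E\<^esub> ev G))"
        using D.minus_add_minus[OF \<phi> \<sigma>cl evG] by simp
      also have "\<dots> \<le> nrm (dual_bimodule E) (\<phi> \<ominus>\<^bsub>dual_bimodule E\<^esub> \<sigma> ?n)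
          + nrm (dual_bimodule E) (\<sigma> ?n \<ominus>\<^bsub>dual_bimodule E\<^esub> ev G)"
        by (intro D.nrm_triangle D.M.minus_closed \<sigma>cl \<phi> evG)
      also have "nrm (dual_bimodule E) (\<sigma> ?n \<ominus>\<^bsub>dual_bimodule E\<^esub> ev G) \<le> nrm X (F ?n \<ominus>\<^bsub>X\<^esub> G)"
        using ev_le[of "F ?n \<ominus>\<^bsub>X\<^esub> G"] F G(1) by (simp add: \<sigma> ev_minus)
      finally show ?thesis
        using N1[of ?n] N2[of ?n] D.nrm_minus[OF \<phi> \<sigma>cl[of ?n]] by simp
    qed
    then have "nrm (dual_bimodule E) (\<phi> \<ominus>\<^bsub>dual_bimodule E\<^esub> ev G) = 0"
      using D.nrm_nonneg[OF D.M.minus_closed[OF \<phi> evG]] by (metis less_irrefl less_eq_real_def)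
    then have "\<phi> = ev G"
      using D.nrm_eq_0_iff[OF D.M.minus_closed[OF \<phi> evG]] D.minus_eq_zero_iff[OF \<phi> evG] by blast
    then show "\<phi> \<in> P"
      using G(1) by (simp add: P_def)
  qed
  have "dual_banach_bimodule A E P"
  proof (intro dual_banach_bimodule.intro E.banach_bimodule_axioms dual_banach_bimodule_axioms.intro
      sub closed bij isometric)
    fix a \<phi> assume a: "a \<in> carrier A" and "\<phi> \<in> P"
    then obtain F where F: "F \<in> carrier X" "\<phi> = ev F"
      by (auto simp: P_def)
    have "lact (dual_bimodule E) a \<phi> = ev (lact X a F)"
      using a F l r by (auto simp: ev_def adjoint_map_def restrict_def fun_eq_iff)
    then show "lact (dual_bimodule E) a \<phi> \<in> P"
      using X.lact_closed[OF a F(1)] by (simp add: P_def)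
    have "ract (dual_bimodule E) \<phi> a = ev (ract X F a)"
      using a F l r by (auto simp: ev_def adjoint_map_def restrict_def fun_eq_iff)
    then show "ract (dual_bimodule E) \<phi> a \<in> P"
      using X.ract_closed[OF a F(1)] by (simp add: P_def)
  qed
  then show ?thesis
    by (simp add: P_def ev_def)
qed

end

section \<open>Weights and Beurling algebras\<close>

lemma beurling_simps:
  "carrier (beurling \<omega>) = {a. (\<lambda>g. cmod (a g)) summable_on UNIV}"
  "zero (beurling \<omega>) = (\<lambda>g. 0)" "add (beurling \<omega>) = (\<lambda>a b g. a g + b g)"
  "smult (beurling \<omega>) = (\<lambda>c a g. c * a g)" "nrm (beurling \<omega>) = (\<lambda>a. \<Sum>\<^sub>\<infinity>g. cmod (a g))"
  "mult (beurling \<omega>) = (\<lambda>a b k. \<Sum>\<^sub>\<infinity>g. of_real (weight_quot \<omega> g (- g + k)) * a g * b (- g + k))"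
  by (simp_all add: beurling_def)

lemma abs_summable_add:
  fixes a b :: "'g \<Rightarrow> complex"
  assumes "(\<lambda>g. cmod (a g)) summable_on S" "(\<lambda>g. cmod (b g)) summable_on S"
  shows "(\<lambda>g. cmod (a g + b g)) summable_on S"
  by (rule Infinite_Sum.abs_summable_on_comparison_test'[OF summable_on_add[OF assms]]) (rule norm_triangle_ineq)

lemma beurling_normed: "complex_normed_space (beurling \<omega>)"
proof (rule complex_normed_spaceI)
  show "a = \<zero>\<^bsub>beurling \<omega>\<^esub>" if "a \<in> carrier (beurling \<omega>)" "nrm (beurling \<omega>) a = 0" for a
    using that nonneg_infsum_le_0D[of "\<lambda>g. cmod (a g)" UNIV] by (simp add: beurling_simps fun_eq_iff)
  show "nrm (beurling \<omega>) (a \<oplus>\<^bsub>beurling \<omega>\<^esub> b) \<le> nrm (beurling \<omega>) a + nrm (beurling \<omega>) b"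
    if "a \<in> carrier (beurling \<omega>)" "b \<in> carrier (beurling \<omega>)" for a b
  proof -
    have a: "(\<lambda>g. cmod (a g)) summable_on UNIV" and b: "(\<lambda>g. cmod (b g)) summable_on UNIV"
      using that by (simp_all add: beurling_simps)
    have "(\<Sum>\<^sub>\<infinity>g. cmod (a g + b g)) \<le> (\<Sum>\<^sub>\<infinity>g. cmod (a g) + cmod (b g))"
      by (intro infsum_mono abs_summable_add summable_on_add a b norm_triangle_ineq)
    then show ?thesis
      by (simp add: beurling_simps infsum_add[OF a b])
  qed
qed (auto simp: beurling_simps abs_summable_add norm_mult algebra_simps infsum_nonneg
      intro: summable_on_cmult_right infsum_cmult_right')

lemma bij_shear: "bij_betw (\<lambda>(g::'g::group_add, k). (g, - g + k)) UNIV UNIV"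
  by (rule bij_betwI[where g = "\<lambda>(g, h). (g, g + h)"]) (auto simp: add.assoc[symmetric])

text \<open>
  The shear \<open>(g, k) \<mapsto> (g, - g + k)\<close> turns the convolution into a product of two independent sums.
\<close>

lemma convolution_summable:
  fixes a b :: "'g::group_add \<Rightarrow> complex"
  assumes a: "(\<lambda>g. cmod (a g)) summable_on UNIV" and b: "(\<lambda>g. cmod (b g)) summable_on UNIV"
  shows "((\<lambda>k. \<Sum>\<^sub>\<infinity>g. cmod (a g) * cmod (b (- g + k))) has_sum
      (\<Sum>\<^sub>\<infinity>g. cmod (a g)) * (\<Sum>\<^sub>\<infinity>g. cmod (b g))) UNIV"
    and "(\<lambda>g. cmod (a g) * cmod (b (- g + k))) summable_on UNIV"
proof -
  let ?f = "\<lambda>p. cmod (a (fst p)) * cmod (b (snd p))"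
  let ?S = "(\<Sum>\<^sub>\<infinity>g. cmod (a g)) * (\<Sum>\<^sub>\<infinity>g. cmod (b g))"
  have inner: "((\<lambda>h. ?f (g, h)) has_sum cmod (a g) * (\<Sum>\<^sub>\<infinity>g. cmod (b g))) UNIV" for g
    using has_sum_cmult_right[OF has_sum_infsum[OF b]] by simp
  have outer: "((\<lambda>g. cmod (a g) * (\<Sum>\<^sub>\<infinity>g. cmod (b g))) has_sum ?S) UNIV"
    by (rule has_sum_cmult_left[OF has_sum_infsum[OF a]])
  have "?f summable_on (SIGMA g:UNIV. UNIV)"
    by (rule summable_on_SigmaI[OF inner has_sum_imp_summable[OF outer]]) auto
  then have "(?f has_sum ?S) (SIGMA g:UNIV. UNIV)"
    by (intro has_sum_SigmaI[OF inner outer])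
  then have "((\<lambda>p. ?f (case p of (g, k) \<Rightarrow> (g, - g + k))) has_sum ?S) UNIV"
    by (subst has_sum_reindex_bij_betw[OF bij_shear]) simp
  then have "((\<lambda>(k, g). cmod (a g) * cmod (b (- g + k))) has_sum ?S) (UNIV \<times> UNIV)"
    by (subst has_sum_swap) (simp add: case_prod_unfold)
  then have *: "((\<lambda>(k, g). cmod (a g) * cmod (b (- g + k))) has_sum ?S) (SIGMA k:UNIV. UNIV)"
    by simp
  show "(\<lambda>g. cmod (a g) * cmod (b (- g + k))) summable_on UNIV" for k
    using summable_on_SigmaD1[OF has_sum_imp_summable[OF *]] by simp
  then show "((\<lambda>k. \<Sum>\<^sub>\<infinity>g. cmod (a g) * cmod (b (- g + k))) has_sum ?S) UNIV"
    by (intro has_sum_SigmaD[OF *]) simp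
qed

text \<open>
  This cocycle identity is the associativity of the product of the Beurling algebra.
\<close>

lemma weight_quot_cocycle:
  assumes "weight \<omega>"
  shows "weight_quot \<omega> g h * weight_quot \<omega> (g + h) k = weight_quot \<omega> g (h + k) * weight_quot \<omega> h k"
proof -
  have "\<omega> x > 0" for x
    using assms unfolding weight_def by (meson less_le_trans zero_less_one)
  then have "\<omega> x \<noteq> 0" for x
    by (metis less_irrefl)
  then show ?thesis
    by (simp add: weight_quot_def add.assoc)
qed

locale unital_weight =
  fixes \<omega> :: "'g::group_add \<Rightarrow> real"
  assumes weight: "weight \<omega>" and unit: "\<omega> 0 = 1"
begin

abbreviation Om where "Om g h \<equiv> complex_of_real (weight_quot \<omega> g h)"
abbreviation A where "A \<equiv> beurling \<omega>"

lemma weight_pos: "\<omega> g > 0"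
  using weight unfolding weight_def by (meson less_le_trans zero_less_one)

lemma weight_nonzero [simp]: "\<omega> g \<noteq> 0"
  using weight_pos[of g] by simp

lemma Om_nonneg: "0 \<le> weight_quot \<omega> g h"
  using weight_pos[of g] weight_pos[of h] weight_pos[of "g + h"] by (simp add: weight_quot_def)

lemma Om_le_1: "weight_quot \<omega> g h \<le> 1"
  using weight weight_pos[of g] weight_pos[of h] by (simp add: weight_quot_def weight_def)

lemma cmod_Om_le_1: "cmod (Om g h) \<le> 1"
  using Om_nonneg[of g h] Om_le_1[of g h] by simp

lemma Om_zero [simp]: "Om 0 g = 1" "Om g 0 = 1"
  by (simp_all add: weight_quot_def unit)

lemma Om_cocycle: "Om g h * Om (g + h) k = Om g (h + k) * Om h k"
  by (metis weight_quot_cocycle[OF weight] of_real_mult)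

lemma mult_summand_bound: "cmod (Om g h * x * y) \<le> cmod x * cmod y"
  using mult_right_mono[OF cmod_Om_le_1, of "cmod x * cmod y" g h]
  by (simp add: norm_mult mult.assoc)

lemma mult_bounds:
  assumes a: "a \<in> carrier A" and b: "b \<in> carrier A"
  shows "(\<lambda>g. Om g (- g + k) * a g * b (- g + k)) summable_on UNIV"
    and "a \<otimes>\<^bsub>A\<^esub> b \<in> carrier A"
    and "nrm A (a \<otimes>\<^bsub>A\<^esub> b) \<le> nrm A a * nrm A b"
proof -
  have a': "(\<lambda>g. cmod (a g)) summable_on UNIV" and b': "(\<lambda>g. cmod (b g)) summable_on UNIV"
    using a b by (simp_all add: beurling_simps)
  note conv = convolution_summable[OF a' b']
  let ?c = "\<lambda>k. \<Sum>\<^sub>\<infinity>g. cmod (a g) * cmod (b (- g + k))"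
  have sm: "(\<lambda>g. cmod (Om g (- g + k) * a g * b (- g + k))) summable_on UNIV" for k
    by (rule Infinite_Sum.abs_summable_on_comparison_test'[OF conv(2) mult_summand_bound])
  then show "(\<lambda>g. Om g (- g + k) * a g * b (- g + k)) summable_on UNIV"
    by (rule abs_summable_summable)
  have le: "cmod ((a \<otimes>\<^bsub>A\<^esub> b) k) \<le> ?c k" for k
  proof -
    have "cmod ((a \<otimes>\<^bsub>A\<^esub> b) k) \<le> (\<Sum>\<^sub>\<infinity>g. cmod (Om g (- g + k) * a g * b (- g + k)))"
      using norm_infsum_bound[OF sm] by (simp add: beurling_simps)
    also have "\<dots> \<le> ?c k"
      by (intro infsum_mono sm conv(2) mult_summand_bound)
    finally show ?thesis .
  qed
  have c: "(?c has_sum nrm A a * nrm A b) UNIV"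
    using conv(1) a b by (simp add: beurling_simps)
  show "a \<otimes>\<^bsub>A\<^esub> b \<in> carrier A"
    using Infinite_Sum.abs_summable_on_comparison_test'[OF has_sum_imp_summable[OF c] le] by (simp add: beurling_simps)
  then show "nrm A (a \<otimes>\<^bsub>A\<^esub> b) \<le> nrm A a * nrm A b"
    using infsum_mono[OF _ has_sum_imp_summable[OF c] le] infsumI[OF c] by (simp add: beurling_simps)
qed

sublocale A: complex_normed_magma A
  by (intro complex_normed_magma.intro beurling_normed complex_normed_magma_axioms.intro mult_bounds)

lemma delta_in [simp]: "delta g \<in> carrier A"
proof -
  have "(\<lambda>h. cmod (delta g h)) summable_on {g}"
    by simp
  also have "?this \<longleftrightarrow> (\<lambda>h. cmod (delta g h)) summable_on UNIV"
    by (rule summable_on_cong_neutral) (auto simp: delta_def)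
  finally show ?thesis
    by (simp add: beurling_simps)
qed

lemma nrm_delta [simp]: "nrm A (delta g) = 1"
proof -
  have "(\<Sum>\<^sub>\<infinity>h. cmod (delta g h)) = (\<Sum>\<^sub>\<infinity>h\<in>{g}. cmod (delta g h))"
    by (rule infsum_cong_neutral) (auto simp: delta_def)
  then show ?thesis
    by (simp add: beurling_simps) (simp add: delta_def)
qed

lemma delta_mult: "delta g \<otimes>\<^bsub>A\<^esub> delta h = Om g h \<odot>\<^bsub>A\<^esub> delta (g + h)"
  by (rule beurling_delta_mult)

end

section \<open>Averaging a derivation over the group\<close>

lemma functional_ell_infinity:
  assumes "N \<in> carrier (dual_space ell_infinity)"
  shows "\<And>f f'. bounded (range f) \<Longrightarrow> bounded (range f') \<Longrightarrow> N (\<lambda>g. f g + f' g) = N f + N f'"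
    and "\<And>c f. bounded (range f) \<Longrightarrow> N (\<lambda>g. c * f g) = c * N f"
    and "\<exists>K\<ge>0. \<forall>f C. (\<forall>g. cmod (f g) \<le> C) \<longrightarrow> cmod (N f) \<le> K * C"
proof -
  show "N (\<lambda>g. f g + f' g) = N f + N f'" if "bounded (range f)" "bounded (range f')" for f f'
    using dual_spaceD(2)[OF assms, of f f'] that by (simp add: ell_infinity_def)
  show "N (\<lambda>g. c * f g) = c * N f" if "bounded (range f)" for c f
    using dual_spaceD(3)[OF assms, of f c] that by (simp add: ell_infinity_def)
  obtain K where K: "\<And>f. bounded (range f) \<Longrightarrow> cmod (N f) \<le> K * (SUP g. cmod (f g))"
    using dual_spaceD(4)[OF assms] by (auto simp: ell_infinity_def)
  have "cmod (N f) \<le> \<bar>K\<bar> * C" if C: "\<forall>g. cmod (f g) \<le> C" for f C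
  proof -
    have b: "bounded (range f)"
      using C by (auto simp: bounded_iff)
    have s: "(SUP g. cmod (f g)) \<le> C"
      using C by (intro cSUP_least) auto
    have "0 \<le> cmod (f undefined)"
      by simp
    also have "\<dots> \<le> (SUP g. cmod (f g))"
      using C by (intro cSUP_upper bdd_aboveI2) auto
    finally have "K * (SUP g. cmod (f g)) \<le> \<bar>K\<bar> * C"
      using s by (meson abs_ge_self abs_ge_zero mult_mono order_trans)
    then show ?thesis
      using K[OF b] by simp
  qed
  then show "\<exists>K\<ge>0. \<forall>f C. (\<forall>g. cmod (f g) \<le> C) \<longrightarrow> cmod (N f) \<le> K * C"
    by (intro exI[of _ "\<bar>K\<bar>"]) simp
qed

context unital_weight
begin

lemma J_map_alt:
  "J_map \<omega> k f g = complex_of_real (\<omega> k * \<omega> (- k)) * (Om k g * Om (- g) (- k) * f (k + g))"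
  by (simp add: J_map_def)

lemma Om_inverse: "Om (- k) k * complex_of_real (\<omega> k * \<omega> (- k)) = 1"
  by (simp add: weight_quot_def unit)

text \<open>
  Let \<open>B g x\<close> be the value of \<open>D(\<delta>\<^sub>g)\<close> at \<open>x\<close>, and \<open>F x\<close> the bounded function whose value at \<open>g\<close> is the
  value of \<open>e \<cdot> D(\<delta>\<^sub>g) \<cdot> \<delta>\<^bsub>- g\<^esub>\<close> at \<open>x\<close>. The Leibniz rule expresses the translate of \<open>F x\<close> under
  \<open>J_map\<close> by \<open>F\<close> again and by a multiple of \<open>\<Omega>(g, - g)\<close>, on which \<open>N\<close> is normalised; so \<open>N (F x)\<close>
  solves the equation of an implementing functional.
\<close>

lemma weight_amenable_imp_amenable_at_delta:
  assumes "pointwise_weight_amenable_at \<omega> k"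
  shows "pointwise_amenable_at TYPE('v) A (delta k)"
  unfolding pointwise_amenable_at_def
proof (intro allI impI)
  fix E :: "('g \<Rightarrow> complex, 'v) normed_bimodule" and D
  assume E: "banach_bimodule A E" and D: "derivation A (dual_bimodule E) D"
  interpret E: banach_bimodule A E by fact
  obtain N where N: "N \<in> carrier (dual_space ell_infinity)" and N1: "N (\<lambda>g. Om g (- g)) = 1"
    and NJ: "adjoint_map ell_infinity (J_map \<omega> k) N = N"
    using assms by (auto simp: pointwise_weight_amenable_at_def)
  note Nadd = functional_ell_infinity(1)[OF N] and Nsmult = functional_ell_infinity(2)[OF N]
  obtain KN where KN: "KN \<ge> 0" "\<And>f C. \<forall>g. cmod (f g) \<le> C \<Longrightarrow> cmod (N f) \<le> KN * C"
    using functional_ell_infinity(3)[OF N] by blast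
  define w where "w = complex_of_real (\<omega> k * \<omega> (- k))"
  define l where "l = (\<lambda>g x. lact E (delta g) x)"
  define r where "r = (\<lambda>g x. ract E x (delta g))"
  define B where "B = (\<lambda>g x. D (delta g) x)"
  have cl [simp]: "l g x \<in> carrier E" "r g x \<in> carrier E" if "x \<in> carrier E" for g x
    using that by (simp_all add: l_def r_def E.lact_closed E.ract_closed)
  have ll: "l g (l h x) = Om g h \<odot>\<^bsub>E\<^esub> l (g + h) x" if "x \<in> carrier E" for g h x
    using that E.lact_lact[of "delta g" "delta h" x] E.lact_smult_left[of "delta (g + h)" x "Om g h"]
    by (simp add: l_def delta_mult)
  have rr: "r h (r g x) = Om g h \<odot>\<^bsub>E\<^esub> r (g + h) x" if "x \<in> carrier E" for g h x
    using that E.ract_ract[of "delta g" "delta h" x] E.ract_smult_right[of "delta (g + h)" x "Om g h"]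
    by (simp add: r_def delta_mult)
  have lr: "l g (r h x) = r h (l g x)" if "x \<in> carrier E" for g h x
    using that E.lact_ract[of "delta g" "delta h" x] by (simp add: l_def r_def)
  have one: "1 \<odot>\<^bsub>E\<^esub> x = x" if "x \<in> carrier E" for x
    using E.smult_one[of x] that by simp
  have l0 [simp]: "l 0 (l g x) = l g x" "l g (l 0 x) = l g x"
    and r0 [simp]: "r 0 (r g x) = r g x" "r g (r 0 x) = r g x" if "x \<in> carrier E" for g x
    using that by (simp_all add: ll rr one)
  have ladd: "l g (x \<oplus>\<^bsub>E\<^esub> y) = l g x \<oplus>\<^bsub>E\<^esub> l g y" and radd: "r g (x \<oplus>\<^bsub>E\<^esub> y) = r g x \<oplus>\<^bsub>E\<^esub> r g y"
    and lsmult: "l g (c \<odot>\<^bsub>E\<^esub> x) = c \<odot>\<^bsub>E\<^esub> l g x" and rsmult: "r g (c \<odot>\<^bsub>E\<^esub> x) = c \<odot>\<^bsub>E\<^esub> r g x"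
    if "x \<in> carrier E" "y \<in> carrier E" for g x y c
    using that by (simp_all add: l_def r_def E.lact_add_right E.ract_add_left E.lact_smult_right
        E.ract_smult_left)
  have Ddual: "D a \<in> carrier (dual_space E)" if "a \<in> carrier A" for a
    using D that by (auto simp: derivation_def cbounded_linear_def)
  have Badd: "B g (x \<oplus>\<^bsub>E\<^esub> y) = B g x + B g y" and Bsmult: "B g (c \<odot>\<^bsub>E\<^esub> x) = c * B g x"
    if "x \<in> carrier E" "y \<in> carrier E" for g x y c
    using that dual_spaceD(2,3)[OF Ddual[OF delta_in]] by (simp_all add: B_def)
  have leibniz: "Om g h * B (g + h) x = B g (l h x) + B h (r g x)" if "x \<in> carrier E" for g h x
  proof -
    have D1: "D (Om g h \<odot>\<^bsub>A\<^esub> delta (g + h)) = Om g h \<odot>\<^bsub>dual_bimodule E\<^esub> D (delta (g + h))"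
      using D unfolding derivation_def cbounded_linear_def by (metis delta_in)
    have D2: "D (delta g \<otimes>\<^bsub>A\<^esub> delta h) = ract (dual_bimodule E) (D (delta g)) (delta h)
        \<oplus>\<^bsub>dual_bimodule E\<^esub> lact (dual_bimodule E) (delta g) (D (delta h))"
      using D unfolding derivation_def by (metis delta_in)
    have "Om g h * B (g + h) x = D (delta g \<otimes>\<^bsub>A\<^esub> delta h) x"
      unfolding delta_mult D1 using that by (simp add: B_def)
    also have "\<dots> = B g (l h x) + B h (r g x)"
      unfolding D2 using that by (simp add: B_def l_def r_def)
    finally show ?thesis .
  qed
  obtain KD where "\<And>a. a \<in> carrier A \<Longrightarrow> nrm (dual_space E) (D a) \<le> KD * nrm A a"
    using D unfolding derivation_def cbounded_linear_def dual_bimodule_simps(5) by blast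
  from this[OF delta_in] have KD: "nrm (dual_space E) (D (delta g)) \<le> KD" for g
    by simp
  have KD0: "0 \<le> KD"
    using KD[of 0] E.dual_nrm_nonneg[OF Ddual[OF delta_in[of 0]]] by linarith
  obtain Kl where Kl: "0 \<le> Kl" "\<And>g x. x \<in> carrier E \<Longrightarrow> nrm E (l g x) \<le> Kl * nrm E x"
    using A.bounded_mult_nonneg[OF E.lact_bounded E.complex_normed_space_axioms] delta_in nrm_delta
    unfolding l_def by (metis mult.right_neutral)
  obtain Kr where Kr: "0 \<le> Kr" "\<And>g x. x \<in> carrier E \<Longrightarrow> nrm E (r g x) \<le> Kr * nrm E x"
    using A.bounded_mult_nonneg[OF E.ract_bounded E.complex_normed_space_axioms] delta_in nrm_delta
    unfolding r_def by (metis mult.right_neutral)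
  have Bbound: "cmod (B g x) \<le> KD * nrm E x" if "x \<in> carrier E" for g x
  proof -
    have "cmod (B g x) \<le> nrm (dual_space E) (D (delta g)) * nrm E x"
      unfolding B_def by (rule E.dual_nrm_bound[OF Ddual[OF delta_in] that])
    also have "\<dots> \<le> KD * nrm E x"
      by (intro mult_right_mono KD E.nrm_nonneg that)
    finally show ?thesis .
  qed
  define F where "F = (\<lambda>x g. B g (l (- g) (r 0 x)))"
  have Fbound: "cmod (F x g) \<le> KD * (Kl * (Kr * nrm E x))" if x: "x \<in> carrier E" for x g
  proof -
    have "cmod (F x g) \<le> KD * nrm E (l (- g) (r 0 x))"
      unfolding F_def using x by (intro Bbound) simp
    also have "\<dots> \<le> KD * (Kl * nrm E (r 0 x))"
      using x KD0 by (intro mult_left_mono Kl) simp_all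
    also have "\<dots> \<le> KD * (Kl * (Kr * nrm E x))"
      using x KD0 Kl(1) by (intro mult_left_mono Kr) simp_all
    finally show ?thesis .
  qed
  have Fbdd: "bounded (range (F x))" if "x \<in> carrier E" for x
    using Fbound[OF that] by (auto simp: bounded_iff)
  have Fadd: "F (x \<oplus>\<^bsub>E\<^esub> y) = (\<lambda>g. F x g + F y g)" if "x \<in> carrier E" "y \<in> carrier E" for x y
    using that by (simp add: F_def ladd radd Badd)
  have Fsmult: "F (c \<odot>\<^bsub>E\<^esub> x) = (\<lambda>g. c * F x g)" if "x \<in> carrier E" for c x
    using that by (simp add: F_def lsmult[OF _ E.M.zero_closed] rsmult[OF _ E.M.zero_closed]
        Bsmult[OF _ E.M.zero_closed])
  \<comment> \<open>The first two terms implement the difference between \<open>D\<close> and its corner \<open>e \<cdot> D \<cdot> e\<close>.\<close>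
  define \<phi> where "\<phi> = (\<lambda>x\<in>carrier E. B 0 (r 0 x) - B 0 (l 0 x) - N (F x))"
  have \<phi>: "\<phi> \<in> carrier (dual_space E)"
  proof (rule dual_spaceI)
    show "\<phi> (x \<oplus>\<^bsub>E\<^esub> y) = \<phi> x + \<phi> y" if "x \<in> carrier E" "y \<in> carrier E" for x y
      using that by (simp add: \<phi>_def ladd radd Badd Fadd Nadd Fbdd)
    show "\<phi> (c \<odot>\<^bsub>E\<^esub> x) = c * \<phi> x" if "x \<in> carrier E" for c x
      using that by (simp add: \<phi>_def lsmult[OF _ E.M.zero_closed] rsmult[OF _ E.M.zero_closed]
        Bsmult[OF _ E.M.zero_closed] Fsmult Nsmult Fbdd algebra_simps)
    show "cmod (\<phi> x) \<le> (KD * Kr + KD * Kl + KN * (KD * (Kl * Kr))) * nrm E x" if x: "x \<in> carrier E" for x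
    proof -
      have 1: "cmod (B 0 (r 0 x)) \<le> KD * (Kr * nrm E x)"
        using Bbound[of "r 0 x" 0] mult_left_mono[OF Kr(2)[OF x, of 0] KD0] x by simp
      have 2: "cmod (B 0 (l 0 x)) \<le> KD * (Kl * nrm E x)"
        using Bbound[of "l 0 x" 0] mult_left_mono[OF Kl(2)[OF x, of 0] KD0] x by simp
      have 3: "cmod (N (F x)) \<le> KN * (KD * (Kl * (Kr * nrm E x)))"
        using KN(2) Fbound[OF x] by blast
      have "cmod (\<phi> x) \<le> cmod (B 0 (r 0 x)) + cmod (B 0 (l 0 x)) + cmod (N (F x))"
        using x norm_triangle_ineq4[of "B 0 (r 0 x) - B 0 (l 0 x)" "N (F x)"]
          norm_triangle_ineq4[of "B 0 (r 0 x)" "B 0 (l 0 x)"] by (simp add: \<phi>_def)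
      then show ?thesis
        using 1 2 3 by (simp add: algebra_simps)
    qed
  qed (simp add: \<phi>_def)
  \<comment> \<open>In the dual module: the average is \<open>w(k) (e \<cdot> D(\<delta>\<^sub>k) \<cdot> \<delta>\<^bsub>- k\<^esub> + \<delta>\<^sub>k \<cdot> average \<cdot> \<delta>\<^bsub>- k\<^esub>)\<close>.\<close>
  have average: "N (F y) = w * (B k (r 0 (l (- k) y)) + N (F (l (- k) (r k y))))" if y: "y \<in> carrier E" for y
  proof -
    let ?z = "l (- k) (r k y)"
    let ?b = "B k (r 0 (l (- k) y))"
    have J: "J_map \<omega> k (F y) g = w * (?b * Om g (- g) + F ?z g)" for g
    proof -
      have "Om k g * Om (- g) (- k) * F y (k + g) = Om k g * B (k + g) (Om (- g) (- k) \<odot>\<^bsub>E\<^esub> l (- g + - k) (r 0 y))"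
        using y by (simp add: F_def Bsmult[OF _ E.M.zero_closed] minus_add)
      also have "\<dots> = Om k g * B (k + g) (l (- g) (l (- k) (r 0 y)))"
        using y ll[of "r 0 y" "- g" "- k"] by simp
      also have "\<dots> = B k (l g (l (- g) (l (- k) (r 0 y)))) + B g (r k (l (- g) (l (- k) (r 0 y))))"
        using y by (intro leibniz) simp
      also have "l g (l (- g) (l (- k) (r 0 y))) = Om g (- g) \<odot>\<^bsub>E\<^esub> r 0 (l (- k) y)"
        using y ll[of "l (- k) (r 0 y)" g "- g"] by (simp add: lr)
      also have "r k (l (- g) (l (- k) (r 0 y))) = l (- g) (r 0 ?z)"
        using y by (simp flip: lr)
      finally show ?thesis
        using y by (simp add: J_map_alt w_def Bsmult[OF _ E.M.zero_closed] F_def mult.commute)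
    qed
    have bO: "bounded (range (\<lambda>g. Om g (- g)))"
      using cmod_Om_le_1 by (auto simp: bounded_iff)
    have "cmod (?b * Om g (- g)) \<le> cmod ?b" for g
      using mult_left_mono[OF cmod_Om_le_1 norm_ge_zero] by (simp add: norm_mult)
    then have bdd: "bounded (range (\<lambda>g. ?b * Om g (- g)))" "bounded (range (F ?z))"
      using Fbdd y by (auto simp: bounded_iff)
    then have bdd': "bounded (range (\<lambda>g. ?b * Om g (- g) + F ?z g))"
      by (rule bounded_plus_comp)
    have "N (F y) = N (J_map \<omega> k (F y))"
    proof -
      have "F y \<in> carrier ell_infinity"
        using Fbdd[OF y] by (simp add: ell_infinity_def)
      then show ?thesis
        using fun_cong[OF NJ, of "F y"] by simp
    qed
    also have "\<dots> = N (\<lambda>g. w * (?b * Om g (- g) + F ?z g))"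
      by (rule arg_cong[where f = N]) (rule ext, rule J)
    also have "\<dots> = w * (?b + N (F ?z))"
      by (simp add: Nsmult[OF bdd'] Nadd[OF bdd] Nsmult[OF bO] N1)
    finally show ?thesis .
  qed
  have inner: "B k x = \<phi> (r k x) - \<phi> (l k x)" if x: "x \<in> carrier E" for x
  proof -
    \<comment> \<open>The Leibniz rule at \<open>e = e e\<close> makes \<open>D(e)\<close> vanish on \<open>e \<cdot> x \<cdot> e\<close>.\<close>
    have B0: "B 0 y = B 0 (l 0 y) + B 0 (r 0 y)" if "y \<in> carrier E" for y
      using leibniz[OF that, of 0 0] by simp
    have v1: "B 0 (l 0 (r k x)) = 0"
      using B0[of "r k x"] x by simp
    have v2: "B 0 (r 0 (l k x)) = 0"
      using B0[of "l k x"] x by simp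
    have "B k x = B k (l 0 x) + B 0 (r k x)"
      using leibniz[OF x, of k 0] by simp
    also have "B k (l 0 x) = B 0 (l k x) + B k (r 0 (l 0 x))"
      using leibniz[of "l 0 x" 0 k] x by simp
    finally have corner: "B k x = B k (r 0 (l 0 x)) + B 0 (l k x) + B 0 (r k x)"
      by simp
    have lkl: "l (- k) (l k x) = Om (- k) k \<odot>\<^bsub>E\<^esub> l 0 x"
      using ll[OF x, of "- k" k] by simp
    have Fl0: "F (l 0 y) = F y" if "y \<in> carrier E" for y
      using that by (simp add: F_def lr flip: lr)
    have zk: "l (- k) (r k (l k x)) = Om (- k) k \<odot>\<^bsub>E\<^esub> l 0 (r k x)"
      using x ll[of "r k x" "- k" k] by (simp flip: lr)
    \<comment> \<open>Multiplying the averaging identity by \<open>\<delta>\<^sub>k\<close> from the right cancels \<open>w(k)\<close>.\<close>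
    have "N (F (l k x)) = w * (Om (- k) k * B k (r 0 (l 0 x)) + Om (- k) k * N (F (r k x)))"
      using average[of "l k x"] x unfolding lkl zk
      by (simp add: rsmult[OF _ E.M.zero_closed] Bsmult[OF _ E.M.zero_closed] Fsmult Fl0 Nsmult Fbdd)
    also have "\<dots> = (Om (- k) k * w) * (B k (r 0 (l 0 x)) + N (F (r k x)))"
      by (simp add: algebra_simps)
    also have "Om (- k) k * w = 1"
      unfolding w_def by (rule Om_inverse)
    finally show ?thesis
      using x corner by (simp add: \<phi>_def v1 v2)
  qed
  have acts: "adjoint_map E (\<lambda>x. ract E x (delta k)) \<phi> \<in> carrier (dual_space E)"
      "adjoint_map E (lact E (delta k)) \<phi> \<in> carrier (dual_space E)"
    using E.adjoint_map_closed[OF A.ract_cbounded_linear \<phi>] E.adjoint_map_closed[OF A.lact_cbounded_linear \<phi>]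
      E by (simp_all)
  have "D (delta k) = lact (dual_bimodule E) (delta k) \<phi> \<ominus>\<^bsub>dual_bimodule E\<^esub> ract (dual_bimodule E) \<phi> (delta k)"
  proof (rule dual_space_eqI[of _ E])
    interpret DE: complex_normed_space "dual_bimodule E"
      by (rule dual_bimodule_normed[OF E.complex_normed_space_axioms])
    show "lact (dual_bimodule E) (delta k) \<phi> \<ominus>\<^bsub>dual_bimodule E\<^esub> ract (dual_bimodule E) \<phi> (delta k)
        \<in> carrier (dual_space E)"
      using DE.M.minus_closed acts by simp
    show "D (delta k) x = (lact (dual_bimodule E) (delta k) \<phi>
        \<ominus>\<^bsub>dual_bimodule E\<^esub> ract (dual_bimodule E) \<phi> (delta k)) x" if x: "x \<in> carrier E" for x
      using inner[OF x] dual_bimodule_minus_apply[OF E.complex_normed_space_axioms acts x] x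
      by (simp add: B_def l_def r_def)
  qed (rule Ddual[OF delta_in])
  then show "\<exists>\<phi>\<in>carrier (dual_bimodule E). D (delta k) =
      lact (dual_bimodule E) (delta k) \<phi> \<ominus>\<^bsub>dual_bimodule E\<^esub> ract (dual_bimodule E) \<phi> (delta k)"
    using \<phi> by auto
qed

end

section \<open>A space of slices and the operators on it\<close>

lemma cbounded_linear_compose:
  assumes S: "cbounded_linear E F S" and T: "cbounded_linear F G T"
    and "\<And>y. y \<in> carrier F \<Longrightarrow> 0 \<le> nrm F y"
  shows "cbounded_linear E G (\<lambda>x. T (S x))"
proof -
  obtain K where K: "\<And>x. x \<in> carrier E \<Longrightarrow> nrm F (S x) \<le> K * nrm E x"
    using S unfolding cbounded_linear_def by blast
  obtain L where L: "\<And>y. y \<in> carrier F \<Longrightarrow> nrm G (T y) \<le> L * nrm F y"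
    using T unfolding cbounded_linear_def by blast
  have S': "S x \<in> carrier F" if "x \<in> carrier E" for x
    using S that unfolding cbounded_linear_def by blast
  have "nrm G (T (S x)) \<le> (\<bar>L\<bar> * K) * nrm E x" if x: "x \<in> carrier E" for x
  proof -
    have "nrm G (T (S x)) \<le> \<bar>L\<bar> * nrm F (S x)"
      using L[OF S'[OF x]] assms(3)[OF S'[OF x]] by (meson abs_ge_self mult_right_mono order_trans)
    also have "\<dots> \<le> \<bar>L\<bar> * (K * nrm E x)"
      by (intro mult_left_mono K x) simp
    finally show ?thesis
      by (simp add: mult.assoc)
  qed
  then have "\<exists>K. \<forall>x\<in>carrier E. nrm G (T (S x)) \<le> K * nrm E x"
    by blast
  then show ?thesis
    using S T S' unfolding cbounded_linear_def by auto
qed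

lemma cbounded_linear_plus:
  assumes "cbounded_linear E scalars \<phi>" "cbounded_linear E scalars \<psi>"
  shows "cbounded_linear E scalars (\<lambda>x. \<phi> x + \<psi> x)"
proof -
  obtain K where K: "\<And>x. x \<in> carrier E \<Longrightarrow> cmod (\<phi> x) \<le> K * nrm E x"
    using assms(1) unfolding cbounded_linear_def scalars_simps by blast
  obtain L where L: "\<And>x. x \<in> carrier E \<Longrightarrow> cmod (\<psi> x) \<le> L * nrm E x"
    using assms(2) unfolding cbounded_linear_def scalars_simps by blast
  have "cmod (\<phi> x + \<psi> x) \<le> (K + L) * nrm E x" if "x \<in> carrier E" for x
    using norm_triangle_ineq[of "\<phi> x" "\<psi> x"] K[OF that] L[OF that] by (simp add: distrib_right)
  then have "\<exists>K. \<forall>x\<in>carrier E. cmod (\<phi> x + \<psi> x) \<le> K * nrm E x"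
    by blast
  then show ?thesis
    using assms unfolding cbounded_linear_def by (auto simp: algebra_simps)
qed

lemma dual_space_cbounded_linear: "m \<in> carrier (dual_space E) \<Longrightarrow> cbounded_linear E scalars m"
  by (simp add: dual_space_def)

text \<open>
  The \<open>c\<^sub>0\<close>-sum, indexed by the first coordinate, of copies of the bounded functions of the second
  coordinate, with the supremum norm.
\<close>

definition c0_ell_infinity :: "('i \<times> 'j \<Rightarrow> complex) normed_module" where
  "c0_ell_infinity =
     \<lparr>carrier = {\<Phi>. bounded (range \<Phi>) \<and> uniform_limit UNIV (\<lambda>s g. \<Phi> (s, g)) (\<lambda>_. 0) cofinite},
      mult = undefined, one = undefined,
      zero = (\<lambda>p. 0), add = (\<lambda>\<Phi> \<Psi> p. \<Phi> p + \<Psi> p), smult = (\<lambda>c \<Phi> p. c * \<Phi> p),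
      nrm = (\<lambda>\<Phi>. SUP p. cmod (\<Phi> p))\<rparr>"

lemma c0li_simps [simp]:
  "zero c0_ell_infinity = (\<lambda>p. 0)" "add c0_ell_infinity = (\<lambda>\<Phi> \<Psi> p. \<Phi> p + \<Psi> p)"
  "smult c0_ell_infinity = (\<lambda>c \<Phi> p. c * \<Phi> p)"
  by (simp_all add: c0_ell_infinity_def)

abbreviation c0li :: "('i \<times> 'j \<Rightarrow> complex) set" where
  "c0li \<equiv> carrier c0_ell_infinity"

lemma c0li_iff:
  "\<Phi> \<in> c0li \<longleftrightarrow> (\<exists>C. \<forall>p. cmod (\<Phi> p) \<le> C) \<and> (\<forall>e>0. \<forall>\<^sub>F s in cofinite. \<forall>g. cmod (\<Phi> (s, g)) < e)"
  by (auto simp: c0_ell_infinity_def uniform_limit_iff bounded_iff)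

lemma c0li_bound:
  assumes "\<Phi> \<in> c0li"
  shows "cmod (\<Phi> p) \<le> nrm c0_ell_infinity \<Phi>"
proof -
  obtain C where "\<And>p. cmod (\<Phi> p) \<le> C"
    using assms unfolding c0li_iff by blast
  then show ?thesis
    unfolding c0_ell_infinity_def by (auto intro!: cSUP_upper bdd_aboveI2)
qed

lemma c0li_least: "(\<And>p. cmod (\<Phi> p) \<le> C) \<Longrightarrow> nrm c0_ell_infinity \<Phi> \<le> C"
  unfolding c0_ell_infinity_def by (auto intro!: cSUP_least)

lemma c0li_nonneg: "\<Phi> \<in> c0li \<Longrightarrow> 0 \<le> nrm c0_ell_infinity \<Phi>"
  using c0li_bound[of \<Phi> undefined] norm_ge_zero order_trans by blast

lemma c0li_dominated:
  assumes "\<Phi> \<in> c0li" "\<And>p. cmod (\<Psi> p) \<le> C * cmod (\<Phi> p)"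
  shows "\<Psi> \<in> c0li"
  unfolding c0li_iff
proof (intro conjI allI impI)
  have le: "cmod (\<Psi> p) \<le> (\<bar>C\<bar> + 1) * cmod (\<Phi> p)" for p
  proof -
    have "C * cmod (\<Phi> p) \<le> (\<bar>C\<bar> + 1) * cmod (\<Phi> p)"
      by (intro mult_right_mono) auto
    then show ?thesis
      using assms(2)[of p] by linarith
  qed
  have "cmod (\<Psi> p) \<le> (\<bar>C\<bar> + 1) * nrm c0_ell_infinity \<Phi>" for p
  proof -
    have "(\<bar>C\<bar> + 1) * cmod (\<Phi> p) \<le> (\<bar>C\<bar> + 1) * nrm c0_ell_infinity \<Phi>"
      by (intro mult_left_mono c0li_bound assms(1)) auto
    then show ?thesis
      using le[of p] by linarith
  qed
  then show "\<exists>C. \<forall>p. cmod (\<Psi> p) \<le> C"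
    by blast
  fix e :: real assume "e > 0"
  then have "e / (\<bar>C\<bar> + 1) > 0"
    by (simp add: add_nonneg_pos)
  then have "\<forall>\<^sub>F s in cofinite. \<forall>g. cmod (\<Phi> (s, g)) < e / (\<bar>C\<bar> + 1)"
    using assms(1) unfolding c0li_iff by blast
  then show "\<forall>\<^sub>F s in cofinite. \<forall>g. cmod (\<Psi> (s, g)) < e"
  proof (rule eventually_mono, intro allI)
    fix s g assume "\<forall>g. cmod (\<Phi> (s, g)) < e / (\<bar>C\<bar> + 1)"
    then have "(\<bar>C\<bar> + 1) * cmod (\<Phi> (s, g)) < e"
      by (simp add: pos_less_divide_eq mult.commute add_nonneg_pos)
    then show "cmod (\<Psi> (s, g)) < e"
      using le[of "(s, g)"] by linarith
  qed
qed

lemma c0li_add: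
  assumes "\<Phi> \<in> c0li" "\<Psi> \<in> c0li"
  shows "(\<lambda>p. \<Phi> p + \<Psi> p) \<in> c0li"
  unfolding c0li_iff
proof (intro conjI allI impI)
  have "cmod (\<Phi> p + \<Psi> p) \<le> nrm c0_ell_infinity \<Phi> + nrm c0_ell_infinity \<Psi>" for p
    using norm_triangle_ineq[of "\<Phi> p" "\<Psi> p"] c0li_bound[OF assms(1), of p] c0li_bound[OF assms(2), of p]
    by linarith
  then show "\<exists>C. \<forall>p. cmod (\<Phi> p + \<Psi> p) \<le> C"
    by blast
  fix e :: real assume "e > 0"
  then have "\<forall>\<^sub>F s in cofinite. \<forall>g. cmod (\<Phi> (s, g)) < e / 2"
    "\<forall>\<^sub>F s in cofinite. \<forall>g. cmod (\<Psi> (s, g)) < e / 2"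
    using assms half_gt_zero unfolding c0li_iff by blast+
  then show "\<forall>\<^sub>F s in cofinite. \<forall>g. cmod (\<Phi> (s, g) + \<Psi> (s, g)) < e"
    by eventually_elim (metis norm_triangle_lt field_sum_of_halves add_strict_mono)
qed

lemma c0li_smult:
  assumes "\<Phi> \<in> c0li"
  shows "(\<lambda>p. c * \<Phi> p) \<in> c0li"
  by (rule c0li_dominated[OF assms, of _ "cmod c"]) (simp add: norm_mult)

lemma c0li_zero: "(\<lambda>p. 0) \<in> c0li"
  by (auto simp: c0li_iff)

lemma c0li_sum: "(\<And>h. h \<in> H \<Longrightarrow> \<Phi> h \<in> c0li) \<Longrightarrow> (\<lambda>p. \<Sum>h\<in>H. \<Phi> h p) \<in> c0li"
  by (induction H rule: infinite_finite_induct) (simp_all add: c0li_zero c0li_add)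

lemma c0li_closed:
  assumes "\<And>e. e > 0 \<Longrightarrow> \<exists>\<Phi>\<in>c0li. \<forall>p. cmod (\<Psi> p - \<Phi> p) \<le> e"
  shows "\<Psi> \<in> c0li"
  unfolding c0li_iff
proof (intro conjI allI impI)
  obtain \<Phi> where \<Phi>: "\<Phi> \<in> c0li" "\<And>p. cmod (\<Psi> p - \<Phi> p) \<le> 1"
    using assms[of 1] by auto
  have "cmod (\<Psi> p) \<le> nrm c0_ell_infinity \<Phi> + 1" for p
    using norm_triangle_sub[of "\<Psi> p" "\<Phi> p"] \<Phi>(2)[of p] c0li_bound[OF \<Phi>(1), of p] by linarith
  then show "\<exists>C. \<forall>p. cmod (\<Psi> p) \<le> C"
    by blast
  fix e :: real assume "e > 0"
  then obtain \<Phi> where \<Phi>: "\<Phi> \<in> c0li" "\<And>p. cmod (\<Psi> p - \<Phi> p) \<le> e / 2"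
    using assms[of "e / 2"] by auto
  then have "\<forall>\<^sub>F s in cofinite. \<forall>g. cmod (\<Phi> (s, g)) < e / 2"
    using \<open>e > 0\<close> half_gt_zero unfolding c0li_iff by blast
  then show "\<forall>\<^sub>F s in cofinite. \<forall>g. cmod (\<Psi> (s, g)) < e"
  proof (rule eventually_mono, intro allI)
    fix s g assume "\<forall>g. cmod (\<Phi> (s, g)) < e / 2"
    then have "cmod (\<Phi> (s, g)) < e / 2"
      by blast
    then show "cmod (\<Psi> (s, g)) < e"
      using norm_triangle_sub[of "\<Psi> (s, g)" "\<Phi> (s, g)"] \<Phi>(2)[of "(s, g)"] by linarith
  qed
qed

lemma c0li_normed: "complex_normed_space c0_ell_infinity"
proof (rule complex_normed_spaceI)
  show "\<Phi> = \<zero>\<^bsub>c0_ell_infinity\<^esub>" if "\<Phi> \<in> c0li" "nrm c0_ell_infinity \<Phi> = 0" for \<Phi> :: "'i \<times> 'j \<Rightarrow> complex"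
    using c0li_bound[OF that(1)] that(2) by auto
  have le: "nrm c0_ell_infinity (\<lambda>p. c * \<Phi> p) \<le> cmod c * nrm c0_ell_infinity \<Phi>"
    if "\<Phi> \<in> c0li" for c and \<Phi> :: "'i \<times> 'j \<Rightarrow> complex"
    by (rule c0li_least) (simp add: norm_mult mult_left_mono c0li_bound[OF that])
  show "nrm c0_ell_infinity (c \<odot>\<^bsub>c0_ell_infinity\<^esub> \<Phi>) = cmod c * nrm c0_ell_infinity \<Phi>"
    if \<Phi>: "\<Phi> \<in> c0li" for c and \<Phi> :: "'i \<times> 'j \<Rightarrow> complex"
  proof (cases "c = 0")
    case True
    then show ?thesis
      using le[OF \<Phi>, of c] c0li_nonneg[OF c0li_smult[OF \<Phi>, of c]] by simp
  next
    case False
    then have "(\<lambda>p. inverse c * (c * \<Phi> p)) = \<Phi>"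
      by auto
    then have "nrm c0_ell_infinity \<Phi> \<le> cmod (inverse c) * nrm c0_ell_infinity (\<lambda>p. c * \<Phi> p)"
      using le[OF c0li_smult[OF \<Phi>, of c], of "inverse c"] by simp
    then show ?thesis
      using le[OF \<Phi>, of c] False by (intro antisym) (simp_all add: norm_inverse norm_divide field_simps)
  qed
  show "nrm c0_ell_infinity (\<Phi> \<oplus>\<^bsub>c0_ell_infinity\<^esub> \<Psi>) \<le> nrm c0_ell_infinity \<Phi> + nrm c0_ell_infinity \<Psi>"
    if "\<Phi> \<in> c0li" "\<Psi> \<in> c0li" for \<Phi> \<Psi> :: "'i \<times> 'j \<Rightarrow> complex"
  proof (rule c0li_least)
    show "cmod ((\<Phi> \<oplus>\<^bsub>c0_ell_infinity\<^esub> \<Psi>) p) \<le> nrm c0_ell_infinity \<Phi> + nrm c0_ell_infinity \<Psi>" for p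
      using norm_triangle_ineq[of "\<Phi> p" "\<Psi> p"] c0li_bound[OF that(1), of p] c0li_bound[OF that(2), of p]
      by simp
  qed
qed (simp_all add: c0li_add c0li_smult c0li_zero c0li_nonneg algebra_simps)

interpretation c0li: complex_normed_space c0_ell_infinity
  by (rule c0li_normed)

lemma c0li_minus: "\<Phi> \<in> c0li \<Longrightarrow> \<Psi> \<in> c0li \<Longrightarrow> \<Phi> \<ominus>\<^bsub>c0_ell_infinity\<^esub> \<Psi> = (\<lambda>p. \<Phi> p - \<Psi> p)"
  by (simp add: c0li.minus_eq_smult)

lemma c0li_banach: "complex_banach_space c0_ell_infinity"
proof (rule c0li.complex_banach_spaceI)
  fix \<sigma> :: "nat \<Rightarrow> 'i \<times> 'j \<Rightarrow> complex"
  assume "range \<sigma> \<subseteq> c0li"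
    and C: "\<forall>e>0. \<exists>N. \<forall>m\<ge>N. \<forall>n\<ge>N. nrm c0_ell_infinity (\<sigma> m \<ominus>\<^bsub>c0_ell_infinity\<^esub> \<sigma> n) < e"
  then have \<sigma>: "\<sigma> n \<in> c0li" for n
    by auto
  have diff: "cmod (\<sigma> m p - \<sigma> n p) \<le> nrm c0_ell_infinity (\<sigma> m \<ominus>\<^bsub>c0_ell_infinity\<^esub> \<sigma> n)" for m n p
    using c0li_bound[OF c0li.M.minus_closed[OF \<sigma> \<sigma>], of m n p] by (simp add: c0li_minus \<sigma>)
  have "uniformly_Cauchy_on UNIV \<sigma>"
    unfolding uniformly_Cauchy_on_def
  proof (intro allI impI)
    fix e :: real assume "e > 0"
    then obtain N where "\<forall>m\<ge>N. \<forall>n\<ge>N. nrm c0_ell_infinity (\<sigma> m \<ominus>\<^bsub>c0_ell_infinity\<^esub> \<sigma> n) < e"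
      using C by blast
    then have "\<forall>m\<ge>N. \<forall>n\<ge>N. \<forall>p\<in>UNIV. dist (\<sigma> m p) (\<sigma> n p) < e"
      using diff unfolding dist_norm by (meson le_less_trans)
    then show "\<exists>N. \<forall>p\<in>UNIV. \<forall>m\<ge>N. \<forall>n\<ge>N. dist (\<sigma> m p) (\<sigma> n p) < e"
      by blast
  qed
  then obtain \<Phi> where \<Phi>: "uniform_limit UNIV \<sigma> \<Phi> sequentially"
    using uniformly_convergent_eq_Cauchy uniformly_convergent_on_def by metis
  have close: "\<exists>N. \<forall>n\<ge>N. \<forall>p. cmod (\<sigma> n p - \<Phi> p) < e" if "e > 0" for e
    using uniform_limitD[OF \<Phi> that] by (simp add: eventually_sequentially dist_norm)
  have "\<Phi> \<in> c0li"
  proof (rule c0li_closed)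
    fix e :: real assume "e > 0"
    then obtain N where N: "\<And>p. cmod (\<sigma> N p - \<Phi> p) < e"
      using close[of e] by blast
    show "\<exists>\<Psi>\<in>c0li. \<forall>p. cmod (\<Phi> p - \<Psi> p) \<le> e"
      using N by (intro bexI[OF _ \<sigma>[of N]]) (simp add: norm_minus_commute less_imp_le)
  qed
  moreover have "\<exists>N. \<forall>n\<ge>N. nrm c0_ell_infinity (\<sigma> n \<ominus>\<^bsub>c0_ell_infinity\<^esub> \<Phi>) < e" if e: "e > 0" for e
  proof -
    obtain N where N: "\<forall>n\<ge>N. \<forall>p. cmod (\<sigma> n p - \<Phi> p) < e / 2"
      using close[of "e / 2"] e by auto
    have "nrm c0_ell_infinity (\<sigma> n \<ominus>\<^bsub>c0_ell_infinity\<^esub> \<Phi>) < e" if "n \<ge> N" for n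
    proof -
      have "nrm c0_ell_infinity (\<lambda>p. \<sigma> n p - \<Phi> p) \<le> e / 2"
        using N that by (intro c0li_least less_imp_le) blast
      then show ?thesis
        using e by (simp add: c0li_minus \<sigma> \<open>\<Phi> \<in> c0li\<close>)
    qed
    then show ?thesis
      by blast
  qed
  ultimately show "\<exists>l\<in>c0li. \<forall>e>0. \<exists>N. \<forall>n\<ge>N. nrm c0_ell_infinity (\<sigma> n \<ominus>\<^bsub>c0_ell_infinity\<^esub> l) < e"
    by blast
qed

definition slices :: "'i set \<Rightarrow> ('i \<times> 'j \<Rightarrow> complex) \<Rightarrow> 'i \<times> 'j \<Rightarrow> complex" where
  "slices S \<Phi> = (\<lambda>p. if fst p \<in> S then \<Phi> p else 0)"

lemma slices_c0li: "\<Phi> \<in> c0li \<Longrightarrow> slices S \<Phi> \<in> c0li"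
  by (erule c0li_dominated[where C = 1]) (simp add: slices_def)

lemma single_slice_c0li: "bounded (range f) \<Longrightarrow> (\<lambda>p. if fst p = s then f (snd p) else 0) \<in> c0li"
  unfolding c0li_iff
proof (intro conjI allI impI)
  assume "bounded (range f)"
  then obtain C where "C > 0" "\<And>g. cmod (f g) \<le> C"
    using bounded_pos by (metis rangeI)
  then show "\<exists>C. \<forall>p. cmod (if fst p = s then f (snd p) else 0) \<le> C"
    by (intro exI[of _ C]) simp
  show "\<forall>\<^sub>F t in cofinite. \<forall>g. cmod (if fst (t, g) = s then f (snd (t, g)) else 0) < e" if "e > 0" for e
  proof -
    have "\<forall>\<^sub>F t in cofinite. t \<noteq> s"
      by (simp add: eventually_cofinite)
    then show ?thesis
      by (rule eventually_mono) (simp add: that)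
  qed
qed

text \<open>
  Operators indexed by a group such that the slice over \<open>s\<close> of \<open>T h \<Phi>\<close> depends only on the slice of \<open>\<Phi>\<close>
  over \<open>\<sigma> h s\<close>. By \<open>inj_slice\<close> each of them preserves the vanishing at infinity. By \<open>inj_group\<close> the
  images under different \<open>h\<close> of a function on a single slice are disjointly supported. The constant \<open>2\<close>
  makes room for an operator that is a difference of two contractions.
\<close>

locale slice_operators =
  fixes T :: "'g::group_add \<Rightarrow> ('i \<times> 'j \<Rightarrow> complex) \<Rightarrow> 'i \<times> 'j \<Rightarrow> complex"
    and \<sigma> :: "'g \<Rightarrow> 'i \<Rightarrow> 'i"
  assumes T_add: "T h (\<lambda>p. \<Phi> p + \<Psi> p) q = T h \<Phi> q + T h \<Psi> q"
    and T_smult: "T h (\<lambda>p. c * \<Phi> p) q = c * T h \<Phi> q"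
    and T_bound: "(\<And>g. cmod (\<Phi> (\<sigma> h s, g)) \<le> C) \<Longrightarrow> cmod (T h \<Phi> (s, g)) \<le> 2 * C"
    and inj_slice: "inj (\<sigma> h)"
    and inj_group: "inj (\<lambda>h. \<sigma> h s)"
begin

lemma T_bound': "\<Phi> \<in> c0li \<Longrightarrow> cmod (T h \<Phi> p) \<le> 2 * nrm c0_ell_infinity \<Phi>"
  using T_bound[of \<Phi> h "fst p" _ "snd p"] c0li_bound by fastforce

lemma T_c0li:
  assumes \<Phi>: "\<Phi> \<in> c0li"
  shows "T h \<Phi> \<in> c0li"
  unfolding c0li_iff
proof (intro conjI allI impI)
  show "\<exists>C. \<forall>p. cmod (T h \<Phi> p) \<le> C"
    using T_bound'[OF \<Phi>] by blast
  fix e :: real assume "e > 0"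
  then have "e / 3 > 0"
    by simp
  then have "finite {s. \<not> (\<forall>g. cmod (\<Phi> (s, g)) < e / 3)}"
    using \<Phi> unfolding c0li_iff eventually_cofinite by blast
  then have "finite (\<sigma> h -` {s. \<not> (\<forall>g. cmod (\<Phi> (s, g)) < e / 3)})"
    using inj_slice by (rule finite_vimageI)
  then have "\<forall>\<^sub>F s in cofinite. \<forall>g. cmod (\<Phi> (\<sigma> h s, g)) < e / 3"
    by (simp add: eventually_cofinite vimage_def)
  then show "\<forall>\<^sub>F s in cofinite. \<forall>g. cmod (T h \<Phi> (s, g)) < e"
  proof (rule eventually_mono, intro allI)
    fix s g assume "\<forall>g. cmod (\<Phi> (\<sigma> h s, g)) < e / 3"
    then have "cmod (T h \<Phi> (s, g)) \<le> 2 * (e / 3)"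
      by (intro T_bound) (simp add: less_imp_le)
    then show "cmod (T h \<Phi> (s, g)) < e"
      using \<open>e > 0\<close> by simp
  qed
qed

text \<open>
  The extension of the operators from the group to its absolutely summable functions.
\<close>

definition act :: "('g \<Rightarrow> complex) \<Rightarrow> ('i \<times> 'j \<Rightarrow> complex) \<Rightarrow> 'i \<times> 'j \<Rightarrow> complex" where
  "act a \<Phi> = (\<lambda>p. \<Sum>\<^sub>\<infinity>h. a h * T h \<Phi> p)"

lemma act_summand_bound: "\<Phi> \<in> c0li \<Longrightarrow> cmod (a h * T h \<Phi> p) \<le> cmod (a h) * (2 * nrm c0_ell_infinity \<Phi>)"
  by (simp add: norm_mult mult_left_mono T_bound' del: mult.assoc)

context
  fixes \<omega> :: "'g \<Rightarrow> real"
begin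

lemma act_majorant:
  assumes "a \<in> carrier (beurling \<omega>)"
  shows "((\<lambda>h. cmod (a h) * (2 * C)) has_sum nrm (beurling \<omega>) a * (2 * C)) UNIV"
  using has_sum_cmult_left[OF has_sum_infsum] assms by (simp add: beurling_simps)

lemma act_abs_summable:
  assumes "a \<in> carrier (beurling \<omega>)" "\<Phi> \<in> c0li"
  shows "(\<lambda>h. cmod (a h * T h \<Phi> p)) summable_on UNIV"
  by (rule Infinite_Sum.abs_summable_on_comparison_test'[OF
        has_sum_imp_summable[OF act_majorant[OF assms(1), of "nrm c0_ell_infinity \<Phi>"]]
        act_summand_bound[OF assms(2), of a]])

lemma act_summable:
  assumes "a \<in> carrier (beurling \<omega>)" "\<Phi> \<in> c0li"
  shows "(\<lambda>h. a h * T h \<Phi> p) summable_on UNIV"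
  by (rule abs_summable_summable[OF act_abs_summable[OF assms]])

lemma act_bound:
  assumes "a \<in> carrier (beurling \<omega>)" "\<Phi> \<in> c0li"
  shows "cmod (act a \<Phi> p) \<le> 2 * nrm (beurling \<omega>) a * nrm c0_ell_infinity \<Phi>"
  using norm_infsum_le[OF has_sum_infsum[OF act_summable[OF assms]] 
      act_majorant[OF assms(1), of "nrm c0_ell_infinity \<Phi>"]
      act_summand_bound[OF assms(2), of a]] by (simp add: act_def mult_ac)

lemma act_c0li:
  assumes a: "a \<in> carrier (beurling \<omega>)" and \<Phi>: "\<Phi> \<in> c0li"
  shows "act a \<Phi> \<in> c0li"
proof (rule c0li_closed)
  fix e :: real assume "e > 0"
  have "uniform_limit UNIV (\<lambda>H p. \<Sum>h\<in>H. a h * T h \<Phi> p) (act a \<Phi>) (finite_subsets_at_top UNIV)"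
    unfolding act_def
    by (rule Weierstrass_m_test_general[OF act_summand_bound[OF \<Phi>, of a]
          has_sum_imp_summable[OF act_majorant[OF a, of "nrm c0_ell_infinity \<Phi>"]]])
  then have "\<forall>\<^sub>F H in finite_subsets_at_top UNIV. \<forall>p\<in>UNIV. dist (\<Sum>h\<in>H. a h * T h \<Phi> p) (act a \<Phi> p) < e"
    using \<open>e > 0\<close> by (rule uniform_limitD)
  then obtain H where H: "\<And>p. dist (\<Sum>h\<in>H. a h * T h \<Phi> p) (act a \<Phi> p) < e"
    unfolding eventually_finite_subsets_at_top by auto
  have "(\<lambda>p. \<Sum>h\<in>H. a h * T h \<Phi> p) \<in> c0li"
    by (intro c0li_sum c0li_smult T_c0li \<Phi>)
  then show "\<exists>\<Psi>\<in>c0li. \<forall>p. cmod (act a \<Phi> p - \<Psi> p) \<le> e"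
    using H by (intro bexI) (auto simp: dist_norm norm_minus_commute intro: less_imp_le)
qed

lemma act_linear_left:
  assumes \<Phi>: "\<Phi> \<in> c0li"
  shows "cbounded_linear (beurling \<omega>) c0_ell_infinity (\<lambda>a. act a \<Phi>)"
proof -
  have "nrm c0_ell_infinity (act a \<Phi>) \<le> (2 * nrm c0_ell_infinity \<Phi>) * nrm (beurling \<omega>) a"
    if "a \<in> carrier (beurling \<omega>)" for a
    using act_bound[OF that \<Phi>] by (intro c0li_least) (simp add: mult_ac)
  moreover have "act (\<lambda>g. a g + b g) \<Phi> = (\<lambda>p. act a \<Phi> p + act b \<Phi> p)"
    if "a \<in> carrier (beurling \<omega>)" "b \<in> carrier (beurling \<omega>)" for a b
    using infsum_add[OF act_summable[OF that(1) \<Phi>] act_summable[OF that(2) \<Phi>]]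
    by (simp add: act_def distrib_right)
  moreover have "act (\<lambda>g. c * a g) \<Phi> = (\<lambda>p. c * act a \<Phi> p)" for a c
    by (simp add: act_def mult.assoc infsum_cmult_right')
  ultimately show ?thesis
    unfolding cbounded_linear_def using act_c0li[OF _ \<Phi>]
    by (auto simp: beurling_simps(3,4))
qed

lemma act_linear_right:
  assumes a: "a \<in> carrier (beurling \<omega>)"
  shows "cbounded_linear c0_ell_infinity c0_ell_infinity (act a)"
proof -
  have "nrm c0_ell_infinity (act a \<Phi>) \<le> (2 * nrm (beurling \<omega>) a) * nrm c0_ell_infinity \<Phi>"
    if "\<Phi> \<in> c0li" for \<Phi>
    using act_bound[OF a that] by (intro c0li_least) (simp add: mult_ac)
  moreover have "act a (\<lambda>p. \<Phi> p + \<Psi> p) = (\<lambda>p. act a \<Phi> p + act a \<Psi> p)"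
    if "\<Phi> \<in> c0li" "\<Psi> \<in> c0li" for \<Phi> \<Psi>
    using infsum_add[OF act_summable[OF a that(1)] act_summable[OF a that(2)]]
    by (simp add: act_def T_add distrib_left)
  moreover have "act a (\<lambda>p. c * \<Phi> p) = (\<lambda>p. c * act a \<Phi> p)" for \<Phi> c
    by (simp add: act_def T_smult mult.left_commute infsum_cmult_right')
  ultimately show ?thesis
    unfolding cbounded_linear_def using act_c0li[OF a] by auto
qed

end

lemma act_delta: "act (delta g) \<Phi> = T g \<Phi>"
proof
  fix p
  have "(\<Sum>\<^sub>\<infinity>h. delta g h * T h \<Phi> p) = (\<Sum>\<^sub>\<infinity>h\<in>{g}. delta g h * T h \<Phi> p)"
    by (rule infsum_cong_neutral) (auto simp: delta_def)
  then show "act (delta g) \<Phi> p = T g \<Phi> p"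
    by (simp add: act_def delta_def)
qed

lemma T_slice_supported:
  assumes "\<And>g. \<Phi> (\<sigma> h s, g) = 0"
  shows "T h \<Phi> (s, g) = 0"
  using T_bound[of \<Phi> h s 0 g] assms by simp

text \<open>
  The functions \<open>T h \<Phi>\<close> are uniformly bounded and disjointly supported if \<open>\<Phi>\<close> lives on one slice. Hence
  their combinations with coefficients of modulus at most one are bounded, and choosing the coefficients
  according to the phases of \<open>m (T h \<Phi>)\<close> shows that these numbers are absolutely summable over \<open>h\<close>.
\<close>

lemma dual_coefficients_single_slice:
  assumes m: "m \<in> carrier (dual_space c0_ell_infinity)" and \<Phi>: "\<Phi> \<in> c0li"
  shows "((\<lambda>h. m (T h (slices {s} \<Phi>))) \<longlongrightarrow> 0) cofinite"
proof (rule tendstoI)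
  fix e :: real assume e: "e > 0"
  let ?\<Psi> = "slices {s} \<Phi>"
  have \<Psi>: "?\<Psi> \<in> c0li"
    by (rule slices_c0li[OF \<Phi>])
  define C where "C = 2 * nrm c0_ell_infinity ?\<Psi>"
  have C0: "C \<ge> 0"
    using c0li_nonneg[OF \<Psi>] by (simp add: C_def)
  let ?m = "nrm (dual_space c0_ell_infinity) m"
  have sum_le: "(\<Sum>h\<in>H. cmod (m (T h ?\<Psi>))) \<le> ?m * C" if H: "finite H" for H
  proof -
    define c where "c = (\<lambda>h. cnj (sgn (m (T h ?\<Psi>))))"
    define \<Theta> where "\<Theta> = (\<lambda>p. \<Sum>h\<in>H. c h * T h ?\<Psi> p)"
    have c1: "cmod (c h) \<le> 1" for h
      by (simp add: c_def norm_sgn)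
    have \<Theta>: "\<Theta> \<in> c0li"
      unfolding \<Theta>_def by (intro c0li_sum c0li_smult T_c0li \<Psi>)
    have m\<Theta>: "m \<Theta> = (\<Sum>h\<in>H. c h * m (T h ?\<Psi>))"
      unfolding \<Theta>_def using H
    proof (induction H rule: finite_induct)
      case empty
      then show ?case
        using c0li.dual_zero_arg[OF m] by simp
    next
      case (insert h H)
      have "m (\<lambda>p. c h * T h ?\<Psi> p + (\<Sum>h\<in>H. c h * T h ?\<Psi> p))
          = m (\<lambda>p. c h * T h ?\<Psi> p) + m (\<lambda>p. \<Sum>h\<in>H. c h * T h ?\<Psi> p)"
        using dual_spaceD(2)[OF m c0li_smult[OF T_c0li[OF \<Psi>]] c0li_sum[OF c0li_smult[OF T_c0li[OF \<Psi>]]]]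
        by simp
      moreover have "m (\<lambda>p. c h * T h ?\<Psi> p) = c h * m (T h ?\<Psi>)"
        using dual_spaceD(3)[OF m T_c0li[OF \<Psi>]] by simp
      ultimately show ?case
        using insert by simp
    qed
    have "cmod (\<Theta> (t, g)) \<le> C" for t g
    proof (cases "\<exists>k\<in>H. \<sigma> k t = s")
      case True
      then obtain k where k: "k \<in> H" "\<sigma> k t = s"
        by blast
      have zero: "c h * T h ?\<Psi> (t, g) = 0" if "h \<in> H - {k}" for h
      proof -
        have "\<sigma> h t \<noteq> s"
          using that k inj_group[of t] by (auto simp: inj_def)
        then show ?thesis
          using T_slice_supported[of ?\<Psi> h t g] by (simp add: slices_def)
      qed
      have "\<Theta> (t, g) = c k * T k ?\<Psi> (t, g) + (\<Sum>h\<in>H - {k}. c h * T h ?\<Psi> (t, g))"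
        unfolding \<Theta>_def by (rule sum.remove[OF H k(1)])
      also have "(\<Sum>h\<in>H - {k}. c h * T h ?\<Psi> (t, g)) = 0"
        by (rule sum.neutral) (use zero in blast)
      finally have "\<Theta> (t, g) = c k * T k ?\<Psi> (t, g)"
        by simp
      moreover have "cmod (c k * T k ?\<Psi> (t, g)) \<le> 1 * C"
        unfolding norm_mult C_def by (intro mult_mono c1 T_bound' \<Psi>) auto
      ultimately show ?thesis
        by simp
    next
      case False
      then have "T h ?\<Psi> (t, g) = 0" if "h \<in> H" for h
        using T_slice_supported[of ?\<Psi> h t g] that by (auto simp: slices_def)
      then have "\<Theta> (t, g) = 0"
        unfolding \<Theta>_def by (intro sum.neutral) simp
      then show ?thesis
        using C0 by simp
    qed
    then have "nrm c0_ell_infinity \<Theta> \<le> C"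
      by (intro c0li_least) (metis surj_pair)
    have "c h * m (T h ?\<Psi>) = complex_of_real (cmod (m (T h ?\<Psi>)))" for h
    proof -
      let ?z = "m (T h ?\<Psi>)"
      have "cnj ?z * ?z = complex_of_real (cmod ?z) * complex_of_real (cmod ?z)"
        by (metis complex_norm_square mult.commute of_real_mult of_real_power power2_eq_square)
      then show ?thesis
        by (cases "?z = 0") (simp_all add: c_def sgn_eq field_simps)
    qed
    then have "m \<Theta> = complex_of_real (\<Sum>h\<in>H. cmod (m (T h ?\<Psi>)))"
      by (simp add: m\<Theta>)
    then have "(\<Sum>h\<in>H. cmod (m (T h ?\<Psi>))) \<le> cmod (m \<Theta>)"
      by (metis abs_ge_self norm_of_real)
    also have "\<dots> \<le> ?m * nrm c0_ell_infinity \<Theta>"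
      by (rule c0li.dual_nrm_bound[OF m \<Theta>])
    also have "\<dots> \<le> ?m * C"
      by (intro mult_left_mono c0li.dual_nrm_nonneg m) fact
    finally show ?thesis .
  qed
  have "card H \<le> nat \<lceil>?m * C / e\<rceil>" if "H \<subseteq> {h. \<not> dist (m (T h ?\<Psi>)) 0 < e}" "finite H" for H
  proof -
    have "real (card H) * e = (\<Sum>h\<in>H. e)"
      by simp
    also have "\<dots> \<le> (\<Sum>h\<in>H. cmod (m (T h ?\<Psi>)))"
      using that by (intro sum_mono) auto
    also have "\<dots> \<le> ?m * C"
      by (rule sum_le[OF that(2)])
    finally have "real (card H) \<le> ?m * C / e"
      using e by (simp add: pos_le_divide_eq)
    then show ?thesis
      by linarith
  qed
  then show "\<forall>\<^sub>F h in cofinite. dist (m (T h ?\<Psi>)) 0 < e"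
    unfolding eventually_cofinite using finite_if_finite_subsets_card_bdd by blast
qed

text \<open>
  Up to a small error in norm, \<open>\<Phi>\<close> is a sum of finitely many slices.
\<close>

lemma dual_coefficients_vanish:
  assumes m: "m \<in> carrier (dual_space c0_ell_infinity)" and \<Phi>: "\<Phi> \<in> c0li"
  shows "((\<lambda>h. m (T h \<Phi>)) \<longlongrightarrow> 0) cofinite"
proof (rule tendstoI)
  fix e :: real assume e: "e > 0"
  let ?m = "nrm (dual_space c0_ell_infinity) m"
  have m_add: "m (T h (\<lambda>p. \<Phi> p + \<Psi> p)) = m (T h \<Phi>) + m (T h \<Psi>)" if "\<Phi> \<in> c0li" "\<Psi> \<in> c0li" for \<Phi> \<Psi> h
  proof -
    have "T h (\<lambda>p. \<Phi> p + \<Psi> p) = (\<lambda>p. T h \<Phi> p + T h \<Psi> p)"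
      by (rule ext) (rule T_add)
    then show ?thesis
      using dual_spaceD(2)[OF m T_c0li[of _ h] T_c0li[of _ h], OF that] by simp
  qed
  have fin: "((\<lambda>h. m (T h (slices S \<Phi>))) \<longlongrightarrow> 0) cofinite" if "finite S" for S
    using that
  proof (induction S rule: finite_induct)
    case empty
    have "slices {} \<Phi> = (\<lambda>p. 0 * \<Phi> p)"
      by (simp add: slices_def)
    then have "T h (slices {} \<Phi>) = (\<lambda>p. 0)" for h
      using T_smult[of h 0 \<Phi>] by auto
    then show ?case
      using c0li.dual_zero_arg[OF m] by simp
  next
    case (insert s S)
    have "slices (insert s S) \<Phi> = (\<lambda>p. slices {s} \<Phi> p + slices S \<Phi> p)"
      using insert(2) by (auto simp: slices_def fun_eq_iff)
    then show ?case
      using tendsto_add[OF dual_coefficients_single_slice[OF m \<Phi>, of s] insert(3)]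
      by (simp add: m_add slices_c0li[OF \<Phi>])
  qed
  \<comment> \<open>The error is at most \<open>2 d\<close> times the norm of \<open>m\<close>; adding one avoids a division by zero.\<close>
  define d where "d = e / (4 * (?m + 1))"
  have m0: "?m \<ge> 0"
    by (rule c0li.dual_nrm_nonneg[OF m])
  then have d: "d > 0"
    using e by (simp add: d_def)
  define S where "S = {s. \<not> (\<forall>g. cmod (\<Phi> (s, g)) < d)}"
  have "finite S"
    using \<Phi> d unfolding c0li_iff eventually_cofinite S_def by blast
  have split: "\<Phi> = (\<lambda>p. slices S \<Phi> p + slices (- S) \<Phi> p)"
    by (auto simp: slices_def)
  have small: "cmod (m (T h (slices (- S) \<Phi>))) \<le> e / 2" for h
  proof -
    have "nrm c0_ell_infinity (slices (- S) \<Phi>) \<le> d"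
    proof (rule c0li_least)
      fix p :: "'i \<times> 'j"
      show "cmod (slices (- S) \<Phi> p) \<le> d"
        using d by (cases p) (auto simp: slices_def S_def intro: less_imp_le)
    qed
    then have "cmod (T h (slices (- S) \<Phi>) p) \<le> 2 * d" for p
      using T_bound'[OF slices_c0li[OF \<Phi>], of h "- S" p] by linarith
    then have "nrm c0_ell_infinity (T h (slices (- S) \<Phi>)) \<le> 2 * d"
      by (rule c0li_least)
    then have "cmod (m (T h (slices (- S) \<Phi>))) \<le> ?m * (2 * d)"
      using c0li.dual_nrm_bound[OF m T_c0li[OF slices_c0li[OF \<Phi>]], of h "- S"] m0
      by (meson mult_left_mono order_trans)
    also have "\<dots> \<le> e / 2"
      using m0 e by (simp add: d_def field_simps)
    finally show ?thesis .
  qed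
  have "\<forall>\<^sub>F h in cofinite. dist (m (T h (slices S \<Phi>))) 0 < e / 2"
    by (intro tendstoD[OF fin[OF \<open>finite S\<close>]]) (simp add: e)
  then show "\<forall>\<^sub>F h in cofinite. dist (m (T h \<Phi>)) 0 < e"
  proof (rule eventually_mono)
    fix h assume h: "dist (m (T h (slices S \<Phi>))) 0 < e / 2"
    have "m (T h \<Phi>) = m (T h (slices S \<Phi>)) + m (T h (slices (- S) \<Phi>))"
      by (subst split, rule m_add) (intro slices_c0li \<Phi>)+
    then show "dist (m (T h \<Phi>)) 0 < e"
      using h small[of h] norm_triangle_ineq[of "m (T h (slices S \<Phi>))" "m (T h (slices (- S) \<Phi>))"]
      by simp
  qed
qed

end

section \<open>Functionals on Beurling algebras and weak-star continuity\<close>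

lemma weak_star_topspace: "topspace (weak_star E P) = carrier E"
  by (auto simp: weak_star_def topspace_pullback_topology topspace_product_topology eval_on_def)

text \<open>
  The weak-star topology is the initial topology of the predual.
\<close>

lemma continuous_map_weak_starI:
  assumes f: "f \<in> carrier A \<rightarrow> carrier E"
    and "\<And>\<phi>. \<phi> \<in> P \<Longrightarrow> \<exists>q\<in>Q. \<forall>a\<in>carrier A. \<phi> (f a) = q a"
  shows "continuous_map (weak_star A Q) (weak_star E P) f"
  unfolding weak_star_def[of E P]
proof (rule continuous_map_pullback')
  show "topspace (weak_star A Q) \<subseteq> f -` carrier E"
    using f by (auto simp: weak_star_topspace)
  show "continuous_map (weak_star A Q) (product_topology (\<lambda>_. euclidean) P) (eval_on P \<circ> f)"
    unfolding continuous_map_componentwise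
  proof (intro conjI ballI)
    show "(eval_on P \<circ> f) ` topspace (weak_star A Q) \<subseteq> extensional P"
      by (auto simp: eval_on_def)
    fix \<phi> assume \<phi>: "\<phi> \<in> P"
    then obtain q where q: "q \<in> Q" "\<forall>a\<in>carrier A. \<phi> (f a) = q a"
      using assms(2) by blast
    have "continuous_map (weak_star A Q) euclidean ((\<lambda>z. z q) \<circ> eval_on Q)"
      unfolding weak_star_def using q(1)
      by (intro continuous_map_pullback continuous_map_product_projection)
    then show "continuous_map (weak_star A Q) euclidean (\<lambda>a. (eval_on P \<circ> f) a \<phi>)"
      by (rule continuous_map_eq) (use q \<phi> in \<open>auto simp: weak_star_topspace eval_on_def\<close>)
  qed
qed

text \<open>
  The right summand of the universe of a dual module is the one that is known to contain functionals on
  functions of two group elements.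
\<close>

definition sum_copy :: "('a, 'e) normed_bimodule \<Rightarrow> ('a, 'u + 'e) normed_bimodule" where
  "sum_copy V = \<lparr>carrier = Inr ` carrier V, mult = undefined, one = undefined,
     zero = Inr \<zero>\<^bsub>V\<^esub>, add = (\<lambda>x y. Inr (projr x \<oplus>\<^bsub>V\<^esub> projr y)),
     smult = (\<lambda>c x. Inr (c \<odot>\<^bsub>V\<^esub> projr x)), nrm = (\<lambda>x. nrm V (projr x)),
     lact = (\<lambda>a x. Inr (lact V a (projr x))), ract = (\<lambda>x a. Inr (ract V (projr x) a))\<rparr>"

lemma sum_copy_simps [simp]:
  "carrier (sum_copy V) = Inr ` carrier V"
  "zero (sum_copy V) = Inr \<zero>\<^bsub>V\<^esub>" "add (sum_copy V) x y = Inr (projr x \<oplus>\<^bsub>V\<^esub> projr y)"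
  "smult (sum_copy V) c x = Inr (c \<odot>\<^bsub>V\<^esub> projr x)" "nrm (sum_copy V) x = nrm V (projr x)"
  "lact (sum_copy V) a x = Inr (lact V a (projr x))" "ract (sum_copy V) x a = Inr (ract V (projr x) a)"
  by (simp_all add: sum_copy_def)

lemma sum_copy_iso:
  assumes "complex_normed_space V"
  shows "isometric_iso (sum_copy V) V projr"
proof -
  interpret V: complex_normed_space V by fact
  show ?thesis
    by (auto simp: isometric_iso_def intro!: bij_betwI[where g = Inr])
qed

context unital_weight
begin

text \<open>
  The finitely supported functions, which are combinations of the \<open>delta g\<close>, are dense.
\<close>

lemma functional_has_sum:
  assumes \<phi>: "cbounded_linear A scalars \<phi>" and a: "a \<in> carrier A"
  shows "((\<lambda>g. \<phi> (delta g) * a g) has_sum \<phi> a) UNIV"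
proof -
  obtain K where K: "\<And>b. b \<in> carrier A \<Longrightarrow> cmod (\<phi> b) \<le> K * nrm A b"
    using \<phi> unfolding cbounded_linear_def scalars_simps by blast
  have add: "\<phi> (b \<oplus>\<^bsub>A\<^esub> c) = \<phi> b + \<phi> c" if "b \<in> carrier A" "c \<in> carrier A" for b c
    using \<phi> that unfolding cbounded_linear_def by simp
  have smult: "\<phi> (c \<odot>\<^bsub>A\<^esub> b) = c * \<phi> b" if "b \<in> carrier A" for b c
    using \<phi> that unfolding cbounded_linear_def by simp
  have as: "(\<lambda>g. cmod (a g)) summable_on UNIV"
    using a by (simp add: beurling_simps)
  define head where "head = (\<lambda>F g. if g \<in> F then a g else 0)"
  have head_in: "head F \<in> carrier A" for F
    using Infinite_Sum.abs_summable_on_comparison_test'[OF as, of "head F"]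
    by (simp add: beurling_simps head_def)
  have head_sum: "\<phi> (head F) = (\<Sum>g\<in>F. \<phi> (delta g) * a g)" if "finite F" for F
    using that
  proof (induction F rule: finite_induct)
    case empty
    have "head {} = 0 \<odot>\<^bsub>A\<^esub> a"
      by (simp add: head_def beurling_simps)
    then show ?case
      using smult[OF a, of 0] by simp
  next
    case (insert g F)
    have "head (insert g F) = (a g \<odot>\<^bsub>A\<^esub> delta g) \<oplus>\<^bsub>A\<^esub> head F"
      using insert(2) by (auto simp: head_def delta_def beurling_simps fun_eq_iff)
    then have "\<phi> (head (insert g F)) = \<phi> (a g \<odot>\<^bsub>A\<^esub> delta g) + \<phi> (head F)"
      using add[OF A.smult_in[OF delta_in] head_in] by simp
    then show ?case
      using insert smult[OF delta_in] by (simp add: mult.commute)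
  qed
  have err: "cmod (\<phi> a - (\<Sum>g\<in>F. \<phi> (delta g) * a g)) \<le> \<bar>K\<bar> * (nrm A a - (\<Sum>g\<in>F. cmod (a g)))"
    if F: "finite F" for F
  proof -
    have a': "a = head F \<oplus>\<^bsub>A\<^esub> head (- F)"
      by (auto simp: head_def beurling_simps fun_eq_iff)
    have "nrm A (head (- F)) = (\<Sum>\<^sub>\<infinity>g\<in>UNIV - F. cmod (a g))"
      unfolding beurling_simps by (rule infsum_cong_neutral) (auto simp: head_def)
    also have "\<dots> = nrm A a - (\<Sum>g\<in>F. cmod (a g))"
      using infsum_Diff[OF as summable_on_finite[OF F], of] F by (simp add: beurling_simps)
    finally have n: "nrm A (head (- F)) = nrm A a - (\<Sum>g\<in>F. cmod (a g))" .
    have "\<phi> a = \<phi> (head F) + \<phi> (head (- F))"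
      by (subst a', rule add) (rule head_in)+
    then have "\<phi> a - (\<Sum>g\<in>F. \<phi> (delta g) * a g) = \<phi> (head (- F))"
      by (simp add: head_sum[OF F])
    then show ?thesis
      using K[OF head_in, of "- F"] A.nrm_nonneg[OF head_in, of "- F"] unfolding n
      by (metis (no_types, lifting) abs_ge_self mult_right_mono order_trans)
  qed
  have "((\<lambda>F. \<Sum>g\<in>F. cmod (a g)) \<longlongrightarrow> nrm A a) (finite_subsets_at_top UNIV)"
    using has_sum_infsum[OF as] by (simp add: has_sum_def beurling_simps)
  from tendsto_mult_left[OF tendsto_diff[OF tendsto_const this]]
  have "((\<lambda>F. \<bar>K\<bar> * (nrm A a - (\<Sum>g\<in>F. cmod (a g)))) \<longlongrightarrow> \<bar>K\<bar> * (nrm A a - nrm A a))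
      (finite_subsets_at_top UNIV)" .
  then have lim: "((\<lambda>F. \<bar>K\<bar> * (nrm A a - (\<Sum>g\<in>F. cmod (a g)))) \<longlongrightarrow> 0) (finite_subsets_at_top UNIV)"
    by (simp only: diff_self mult_zero_right)
  have "\<forall>\<^sub>F F in finite_subsets_at_top UNIV.
      norm (\<phi> a - (\<Sum>g\<in>F. \<phi> (delta g) * a g)) \<le> \<bar>K\<bar> * (nrm A a - (\<Sum>g\<in>F. cmod (a g)))"
    by (rule eventually_finite_subsets_at_top_weakI) (rule err)
  then have "((\<lambda>F. \<phi> a - (\<Sum>g\<in>F. \<phi> (delta g) * a g)) \<longlongrightarrow> 0) (finite_subsets_at_top UNIV)"
    using lim by (rule Lim_null_comparison)
  from tendsto_diff[OF tendsto_const[of "\<phi> a"] this]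
  have "((\<lambda>F. \<Sum>g\<in>F. \<phi> (delta g) * a g) \<longlongrightarrow> \<phi> a) (finite_subsets_at_top UNIV)"
    by simp
  then show ?thesis
    by (simp add: has_sum_def)
qed

lemma functional_eqI:
  assumes "cbounded_linear A scalars \<phi>" "cbounded_linear A scalars \<psi>" "a \<in> carrier A"
    and "\<And>g. \<phi> (delta g) = \<psi> (delta g)"
  shows "\<phi> a = \<psi> a"
  using functional_has_sum[OF assms(1,3)] functional_has_sum[OF assms(2,3)] assms(4)
  by (simp add: has_sum_unique)

text \<open>
  This reduces the bimodule axioms and the Leibniz rule to identities between weight quotients.
\<close>

lemma bilinear_eqI:
  assumes "\<And>b. b \<in> carrier A \<Longrightarrow> cbounded_linear A scalars (\<lambda>a. \<phi> a b)"
      "\<And>a. a \<in> carrier A \<Longrightarrow> cbounded_linear A scalars (\<phi> a)"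
      "\<And>b. b \<in> carrier A \<Longrightarrow> cbounded_linear A scalars (\<lambda>a. \<psi> a b)"
      "\<And>a. a \<in> carrier A \<Longrightarrow> cbounded_linear A scalars (\<psi> a)"
    and "\<And>g h. \<phi> (delta g) (delta h) = \<psi> (delta g) (delta h)"
    and "a \<in> carrier A" "b \<in> carrier A"
  shows "\<phi> a b = \<psi> a b"
proof (rule functional_eqI[of "\<lambda>a. \<phi> a b" "\<lambda>a. \<psi> a b"])
  show "\<phi> (delta g) b = \<psi> (delta g) b" for g
    by (rule functional_eqI) (use assms in auto)
qed (use assms in auto)

text \<open>
  A functional is represented by its values at the \<open>delta g\<close>; it belongs to the predual once these vanish
  at infinity.
\<close>

lemma c0_predualI:
  assumes "cbounded_linear A scalars \<phi>" and "((\<lambda>g. \<phi> (delta g)) \<longlongrightarrow> 0) cofinite"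
  shows "\<exists>q\<in>c0_predual \<omega>. \<forall>a\<in>carrier A. \<phi> a = q a"
proof
  show "(\<lambda>a\<in>carrier A. \<Sum>\<^sub>\<infinity>g. \<phi> (delta g) * a g) \<in> c0_predual \<omega>"
    unfolding c0_predual_def using assms(2) by (intro image_eqI) auto
  show "\<forall>a\<in>carrier A. \<phi> a = (\<lambda>a\<in>carrier A. \<Sum>\<^sub>\<infinity>g. \<phi> (delta g) * a g) a"
    using infsumI[OF functional_has_sum[OF assms(1)]] by simp
qed

lemma mult_linear_left:
  assumes b: "b \<in> carrier A"
  shows "cbounded_linear A A (\<lambda>a. a \<otimes>\<^bsub>A\<^esub> b)"
proof -
  have "(a \<oplus>\<^bsub>A\<^esub> c) \<otimes>\<^bsub>A\<^esub> b = (a \<otimes>\<^bsub>A\<^esub> b) \<oplus>\<^bsub>A\<^esub> (c \<otimes>\<^bsub>A\<^esub> b)" if "a \<in> carrier A" "c \<in> carrier A" for a c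
    using infsum_add[OF mult_bounds(1)[OF that(1) b] mult_bounds(1)[OF that(2) b]]
    by (simp add: beurling_simps algebra_simps)
  moreover have "(c \<odot>\<^bsub>A\<^esub> a) \<otimes>\<^bsub>A\<^esub> b = c \<odot>\<^bsub>A\<^esub> (a \<otimes>\<^bsub>A\<^esub> b)" for a c
    by (simp add: beurling_simps mult_ac flip: infsum_cmult_right')
  moreover have "\<exists>K. \<forall>a\<in>carrier A. nrm A (a \<otimes>\<^bsub>A\<^esub> b) \<le> K * nrm A a"
    using mult_bounds(3)[OF _ b] by (intro exI[of _ "nrm A b"]) (simp add: mult.commute)
  ultimately show ?thesis
    unfolding cbounded_linear_def using b by auto
qed

lemma mult_linear_right:
  assumes a: "a \<in> carrier A"
  shows "cbounded_linear A A (\<lambda>b. a \<otimes>\<^bsub>A\<^esub> b)"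
proof -
  have "a \<otimes>\<^bsub>A\<^esub> (b \<oplus>\<^bsub>A\<^esub> c) = (a \<otimes>\<^bsub>A\<^esub> b) \<oplus>\<^bsub>A\<^esub> (a \<otimes>\<^bsub>A\<^esub> c)" if "b \<in> carrier A" "c \<in> carrier A" for b c
    using infsum_add[OF mult_bounds(1)[OF a that(1)] mult_bounds(1)[OF a that(2)]]
    by (simp add: beurling_simps algebra_simps)
  moreover have "a \<otimes>\<^bsub>A\<^esub> (c \<odot>\<^bsub>A\<^esub> b) = c \<odot>\<^bsub>A\<^esub> (a \<otimes>\<^bsub>A\<^esub> b)" for b c
    by (simp add: beurling_simps mult_ac flip: infsum_cmult_right')
  moreover have "\<exists>K. \<forall>b\<in>carrier A. nrm A (a \<otimes>\<^bsub>A\<^esub> b) \<le> K * nrm A b"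
    using mult_bounds(3)[OF a] by (intro exI[of _ "nrm A a"]) simp
  ultimately show ?thesis
    unfolding cbounded_linear_def using a by auto
qed

section \<open>A normal dual bimodule of functions on the square of the group\<close>

text \<open>
  A function \<open>\<Phi>\<close> is regarded as a functional on the tensor square of the Beurling algebra, with
  \<open>\<Phi> (s, g)\<close> as its value at \<open>\<delta>\<^sub>g \<otimes> \<delta>\<^bsub>- g + s\<^esub>\<close>; the slices are then the fibres of the group operation.
  In these coordinates \<open>left_op h\<close> is dual to \<open>b \<otimes> c \<mapsto> b \<otimes> c \<delta>\<^sub>h\<close>, and \<open>right_op h\<close> is dual to
  \<open>b \<otimes> c \<mapsto> \<delta>\<^sub>h b \<otimes> c - \<delta>\<^sub>h \<otimes> b c\<close>.
\<close>

definition left_op :: "'g \<Rightarrow> ('g \<times> 'g \<Rightarrow> complex) \<Rightarrow> 'g \<times> 'g \<Rightarrow> complex" where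
  "left_op h \<Phi> = (\<lambda>(s, g). Om (- g + s) h * \<Phi> (s + h, g))"

definition right_op :: "'g \<Rightarrow> ('g \<times> 'g \<Rightarrow> complex) \<Rightarrow> 'g \<times> 'g \<Rightarrow> complex" where
  "right_op h \<Phi> = (\<lambda>(s, g). Om h g * \<Phi> (h + s, h + g) - Om g (- g + s) * \<Phi> (h + s, h))"

lemma cmod_Om_mult_le: "cmod z \<le> C \<Longrightarrow> cmod (Om g h * z) \<le> C"
  using mult_mono[OF cmod_Om_le_1, of "cmod z" C g h] by (simp add: norm_mult)

sublocale L: slice_operators left_op "\<lambda>h s. s + h"
proof
  fix \<Phi> :: "'g \<times> 'g \<Rightarrow> complex" and h s g C
  assume C: "\<And>g. cmod (\<Phi> (s + h, g)) \<le> C"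
  have "C \<ge> 0"
    using C[of 0] norm_ge_zero order_trans by blast
  then show "cmod (left_op h \<Phi> (s, g)) \<le> 2 * C"
    using cmod_Om_mult_le[OF C[of g], of "- g + s" h] by (simp add: left_op_def)
qed (auto simp: left_op_def distrib_left mult.left_commute split: prod.splits intro: injI)

sublocale R: slice_operators right_op "\<lambda>h s. h + s"
proof
  fix \<Phi> :: "'g \<times> 'g \<Rightarrow> complex" and h s g C
  assume C: "\<And>g. cmod (\<Phi> (h + s, g)) \<le> C"
  show "cmod (right_op h \<Phi> (s, g)) \<le> 2 * C"
    using cmod_Om_mult_le[OF C[of "h + g"], of h g] cmod_Om_mult_le[OF C[of h], of g "- g + s"]
      norm_triangle_ineq4[of "Om h g * \<Phi> (h + s, h + g)" "Om g (- g + s) * \<Phi> (h + s, h)"]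
    by (simp add: right_op_def)
qed (auto simp: right_op_def algebra_simps split: prod.splits intro: injI)

definition slice_bimodule :: "('g \<Rightarrow> complex, 'g \<times> 'g \<Rightarrow> complex) normed_bimodule" where
  "slice_bimodule = normed_module.extend c0_ell_infinity (normed_bimodule.fields L.act (\<lambda>\<Phi> a. R.act a \<Phi>))"

lemma slice_bimodule_simps [simp]:
  "carrier slice_bimodule = c0li" "zero slice_bimodule = (\<lambda>p. 0)"
  "add slice_bimodule = (\<lambda>\<Phi> \<Psi> p. \<Phi> p + \<Psi> p)" "smult slice_bimodule = (\<lambda>c \<Phi> p. c * \<Phi> p)"
  "nrm slice_bimodule = nrm c0_ell_infinity"
  "lact slice_bimodule = L.act" "ract slice_bimodule \<Phi> a = R.act a \<Phi>"
  by (simp_all add: slice_bimodule_def c0_ell_infinity_def normed_module.extend_def normed_bimodule.fields_def)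

lemma eval_linear: "cbounded_linear c0_ell_infinity scalars (\<lambda>\<Phi>. \<Phi> p)"
  unfolding cbounded_linear_def using c0li_bound[of _ p] by (auto intro!: exI[of _ 1])

lemma eval_compose: "cbounded_linear E c0_ell_infinity S \<Longrightarrow> cbounded_linear E scalars (\<lambda>x. S x p)"
  by (rule cbounded_linear_compose[OF _ eval_linear]) (simp_all add: c0li_nonneg)

lemma left_op_left_op: "left_op g (left_op h \<Phi>) p = Om g h * left_op (g + h) \<Phi> p"
proof (cases p)
  case (Pair s x)
  then show ?thesis
    using Om_cocycle[of "- x + s" g h] by (simp add: left_op_def add.assoc mult_ac)
qed

lemma right_op_right_op: "right_op h (right_op g \<Phi>) p = Om g h * right_op (g + h) \<Phi> p"
proof (cases p)
  case (Pair s x)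
  have "- x - h + (h + s) = - x + s"
    by (metis add.assoc diff_add_cancel)
  then have "Om h x * Om (h + x) (- x + s) = Om x (- x + s) * Om h s"
    using Om_cocycle[of h x "- x + s"] by (simp add: add.assoc mult.commute)
  moreover have "Om h x * Om g (h + x) = Om g h * Om (g + h) x"
    using Om_cocycle[of g h x] by (simp add: mult.commute)
  moreover have "a * (e * P - j * Q) - k * (b * R - l * Q) = b * (f * P - k * R)"
    if "a * j = k * l" "a * e = b * f" for a b e f j k l P Q R :: complex
  proof -
    have "a * (e * P - j * Q) - k * (b * R - l * Q) = (a * e) * P - (a * j) * Q - b * k * R + (k * l) * Q"
      by (simp add: algebra_simps)
    also have "\<dots> = b * (f * P - k * R)"
      unfolding that by (simp add: algebra_simps)
    finally show ?thesis .
  qed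
  ultimately have "Om h x * (Om g (h + x) * P - Om (h + x) (- x + s) * Q)
      - Om x (- x + s) * (Om g h * R - Om h s * Q)
      = Om g h * (Om (g + h) x * P - Om x (- x + s) * R)" for P Q R :: complex
    by blast
  then show ?thesis
    using Pair \<open>- x - h + (h + s) = - x + s\<close> by (simp add: right_op_def add.assoc minus_add)
qed

lemma left_op_right_op: "left_op g (right_op h \<Phi>) p = right_op h (left_op g \<Phi>) p"
proof (cases p)
  case (Pair s x)
  have "- x - h + (h + s) = - x + s"
    by (metis add.assoc diff_add_cancel)
  then show ?thesis
    using Pair Om_cocycle[of x "- x + s" g]
    by (simp add: left_op_def right_op_def add.assoc minus_add algebra_simps)
qed

lemma slice_bimodule_banach: "banach_bimodule A slice_bimodule"
proof (intro banach_bimodule.intro banach_bimodule_axioms.intro)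
  show "complex_banach_space slice_bimodule"
    by (rule complex_banach_space_iso[OF c0li_banach, of _ "\<lambda>\<Phi>. \<Phi>"])
      (auto simp: isometric_iso_def bij_betw_def c0li_zero c0li_add c0li_smult)
  note left = L.act_linear_left[where \<omega> = \<omega>] R.act_linear_left[where \<omega> = \<omega>]
  note right = L.act_linear_right[where \<omega> = \<omega>] R.act_linear_right[where \<omega> = \<omega>]
  have compose_right: "cbounded_linear E c0_ell_infinity (\<lambda>x. T (S x))"
    if "cbounded_linear E c0_ell_infinity S" "cbounded_linear c0_ell_infinity c0_ell_infinity T"
    for E :: "('g \<Rightarrow> complex) normed_module" and S and T :: "('g \<times> 'g \<Rightarrow> complex) \<Rightarrow> 'g \<times> 'g \<Rightarrow> complex"
    by (rule cbounded_linear_compose[OF that]) (simp add: c0li_nonneg)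
  have compose_left: "cbounded_linear A c0_ell_infinity (\<lambda>x. T (S x))"
    if "cbounded_linear A A S" "cbounded_linear A c0_ell_infinity T"
    for S and T :: "('g \<Rightarrow> complex) \<Rightarrow> 'g \<times> 'g \<Rightarrow> complex"
    by (rule cbounded_linear_compose[OF that]) (rule A.nrm_nonneg)
  fix a b :: "'g \<Rightarrow> complex" and \<Phi> \<Psi> :: "'g \<times> 'g \<Rightarrow> complex" and c
  assume a: "a \<in> carrier A" and b: "b \<in> carrier A"
    and "\<Phi> \<in> carrier slice_bimodule" "\<Psi> \<in> carrier slice_bimodule"
  then have \<Phi>: "\<Phi> \<in> c0li" and \<Psi>: "\<Psi> \<in> c0li"
    by simp_all
  show "lact slice_bimodule a \<Phi> \<in> carrier slice_bimodule" "ract slice_bimodule \<Phi> a \<in> carrier slice_bimodule"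
    using L.act_c0li[OF a \<Phi>] R.act_c0li[OF a \<Phi>] by simp_all
  show "lact slice_bimodule (a \<oplus>\<^bsub>A\<^esub> b) \<Phi> = lact slice_bimodule a \<Phi> \<oplus>\<^bsub>slice_bimodule\<^esub> lact slice_bimodule b \<Phi>"
    "ract slice_bimodule \<Phi> (a \<oplus>\<^bsub>A\<^esub> b) = ract slice_bimodule \<Phi> a \<oplus>\<^bsub>slice_bimodule\<^esub> ract slice_bimodule \<Phi> b"
    "lact slice_bimodule (c \<odot>\<^bsub>A\<^esub> a) \<Phi> = c \<odot>\<^bsub>slice_bimodule\<^esub> lact slice_bimodule a \<Phi>"
    "ract slice_bimodule \<Phi> (c \<odot>\<^bsub>A\<^esub> a) = c \<odot>\<^bsub>slice_bimodule\<^esub> ract slice_bimodule \<Phi> a"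
    using left[OF \<Phi>] a b by (simp_all add: cbounded_linear_def)
  show "lact slice_bimodule a (\<Phi> \<oplus>\<^bsub>slice_bimodule\<^esub> \<Psi>) = lact slice_bimodule a \<Phi> \<oplus>\<^bsub>slice_bimodule\<^esub> lact slice_bimodule a \<Psi>"
    "ract slice_bimodule (\<Phi> \<oplus>\<^bsub>slice_bimodule\<^esub> \<Psi>) a = ract slice_bimodule \<Phi> a \<oplus>\<^bsub>slice_bimodule\<^esub> ract slice_bimodule \<Psi> a"
    "lact slice_bimodule a (c \<odot>\<^bsub>slice_bimodule\<^esub> \<Phi>) = c \<odot>\<^bsub>slice_bimodule\<^esub> lact slice_bimodule a \<Phi>"
    "ract slice_bimodule (c \<odot>\<^bsub>slice_bimodule\<^esub> \<Phi>) a = c \<odot>\<^bsub>slice_bimodule\<^esub> ract slice_bimodule \<Phi> a"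
    using right[OF a] \<Phi> \<Psi> by (simp_all add: cbounded_linear_def)
  have "L.act a (L.act b \<Phi>) p = L.act (a \<otimes>\<^bsub>A\<^esub> b) \<Phi> p" for p
  proof (rule bilinear_eqI[where \<phi> = "\<lambda>a b. L.act a (L.act b \<Phi>) p" and \<psi> = "\<lambda>a b. L.act (a \<otimes>\<^bsub>A\<^esub> b) \<Phi> p", OF _ _ _ _ _ a b])
    show "L.act (delta g) (L.act (delta h) \<Phi>) p = L.act (delta g \<otimes>\<^bsub>A\<^esub> delta h) \<Phi> p" for g h
      using left(1)[OF \<Phi>] delta_in[of "g + h"]
      by (simp add: delta_mult L.act_delta left_op_left_op cbounded_linear_def)
  qed (intro eval_compose compose_right[OF left(1)[OF \<Phi>] right(1)] left(1) L.act_c0li \<Phi>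
      compose_left[OF mult_linear_left left(1)[OF \<Phi>]] compose_left[OF mult_linear_right left(1)[OF \<Phi>]]; assumption)+
  then show "lact slice_bimodule a (lact slice_bimodule b \<Phi>) = lact slice_bimodule (a \<otimes>\<^bsub>A\<^esub> b) \<Phi>"
    by (simp add: fun_eq_iff)
  have "R.act b (R.act a \<Phi>) p = R.act (a \<otimes>\<^bsub>A\<^esub> b) \<Phi> p" for p
  proof (rule bilinear_eqI[where \<phi> = "\<lambda>a b. R.act b (R.act a \<Phi>) p" and \<psi> = "\<lambda>a b. R.act (a \<otimes>\<^bsub>A\<^esub> b) \<Phi> p", OF _ _ _ _ _ a b])
    show "R.act (delta h) (R.act (delta g) \<Phi>) p = R.act (delta g \<otimes>\<^bsub>A\<^esub> delta h) \<Phi> p" for g h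
      using left(2)[OF \<Phi>] delta_in[of "g + h"]
      by (simp add: delta_mult R.act_delta right_op_right_op cbounded_linear_def)
  qed (intro eval_compose compose_right[OF left(2)[OF \<Phi>] right(2)] left(2) R.act_c0li \<Phi>
      compose_left[OF mult_linear_left left(2)[OF \<Phi>]] compose_left[OF mult_linear_right left(2)[OF \<Phi>]]; assumption)+
  then show "ract slice_bimodule (ract slice_bimodule \<Phi> a) b = ract slice_bimodule \<Phi> (a \<otimes>\<^bsub>A\<^esub> b)"
    by (simp add: fun_eq_iff)
  have "L.act a (R.act b \<Phi>) p = R.act b (L.act a \<Phi>) p" for p
  proof (rule bilinear_eqI[where \<phi> = "\<lambda>a b. L.act a (R.act b \<Phi>) p" and \<psi> = "\<lambda>a b. R.act b (L.act a \<Phi>) p", OF _ _ _ _ _ a b])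
    show "L.act (delta g) (R.act (delta h) \<Phi>) p = R.act (delta h) (L.act (delta g) \<Phi>) p" for g h
      by (simp add: L.act_delta R.act_delta left_op_right_op)
  qed (intro eval_compose compose_right[OF left(2)[OF \<Phi>] right(1)] compose_right[OF left(1)[OF \<Phi>] right(2)]
      left L.act_c0li R.act_c0li \<Phi>; assumption)+
  then show "lact slice_bimodule a (ract slice_bimodule \<Phi> b) = ract slice_bimodule (lact slice_bimodule a \<Phi>) b"
    by (simp add: fun_eq_iff)
next
  show "\<exists>K. \<forall>a\<in>carrier A. \<forall>\<Phi>\<in>carrier slice_bimodule.
      nrm slice_bimodule (lact slice_bimodule a \<Phi>) \<le> K * nrm A a * nrm slice_bimodule \<Phi>"
    by (intro exI[of _ 2]) (auto intro: c0li_least L.act_bound)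
  show "\<exists>K. \<forall>a\<in>carrier A. \<forall>\<Phi>\<in>carrier slice_bimodule.
      nrm slice_bimodule (ract slice_bimodule \<Phi> a) \<le> K * nrm A a * nrm slice_bimodule \<Phi>"
    by (intro exI[of _ 2]) (auto intro: c0li_least R.act_bound)
qed

section \<open>Invariant functionals from a derivation\<close>

text \<open>
  The functional that pairs \<open>\<Phi>\<close> with \<open>a \<otimes> 1\<close>: the coordinates of \<open>\<delta>\<^sub>g \<otimes> \<delta>\<^sub>0\<close> are \<open>(g, g)\<close>.
\<close>

definition diagonal_sum :: "('g \<Rightarrow> complex) \<Rightarrow> ('g \<times> 'g \<Rightarrow> complex) \<Rightarrow> complex" where
  "diagonal_sum a = (\<lambda>\<Phi>\<in>c0li. \<Sum>\<^sub>\<infinity>g. a g * \<Phi> (g, g))"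

lemma diagonal_summable:
  assumes "a \<in> carrier A" "\<Phi> \<in> c0li"
  shows "(\<lambda>g. a g * \<Phi> (g, g)) summable_on UNIV"
    and "cmod (\<Sum>\<^sub>\<infinity>g. a g * \<Phi> (g, g)) \<le> nrm A a * nrm c0_ell_infinity \<Phi>"
proof -
  have le: "cmod (a g * \<Phi> (g, g)) \<le> cmod (a g) * nrm c0_ell_infinity \<Phi>" for g
    unfolding norm_mult by (intro mult_left_mono c0li_bound assms(2)) simp
  have major: "((\<lambda>g. cmod (a g) * nrm c0_ell_infinity \<Phi>) has_sum nrm A a * nrm c0_ell_infinity \<Phi>) UNIV"
    using has_sum_cmult_left[OF has_sum_infsum] assms(1) by (simp add: beurling_simps)
  show *: "(\<lambda>g. a g * \<Phi> (g, g)) summable_on UNIV"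
    by (rule abs_summable_summable)
      (rule Infinite_Sum.abs_summable_on_comparison_test'[OF has_sum_imp_summable[OF major] le])
  show "cmod (\<Sum>\<^sub>\<infinity>g. a g * \<Phi> (g, g)) \<le> nrm A a * nrm c0_ell_infinity \<Phi>"
    by (rule norm_infsum_le[OF has_sum_infsum[OF *] major le])
qed

lemma diagonal_sum_dual:
  assumes a: "a \<in> carrier A"
  shows "diagonal_sum a \<in> carrier (dual_space slice_bimodule)"
proof (rule dual_spaceI)
  show "diagonal_sum a (\<Phi> \<oplus>\<^bsub>slice_bimodule\<^esub> \<Psi>) = diagonal_sum a \<Phi> + diagonal_sum a \<Psi>"
    if "\<Phi> \<in> carrier slice_bimodule" "\<Psi> \<in> carrier slice_bimodule" for \<Phi> \<Psi>
    using that infsum_add[OF diagonal_summable(1)[OF a, of \<Phi>] diagonal_summable(1)[OF a, of \<Psi>]]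
    by (simp add: diagonal_sum_def c0li_add distrib_left)
  show "diagonal_sum a (c \<odot>\<^bsub>slice_bimodule\<^esub> \<Phi>) = c * diagonal_sum a \<Phi>"
    if "\<Phi> \<in> carrier slice_bimodule" for c \<Phi>
    using that by (simp add: diagonal_sum_def c0li_smult mult.left_commute infsum_cmult_right')
  show "cmod (diagonal_sum a \<Phi>) \<le> nrm A a * nrm slice_bimodule \<Phi>" if "\<Phi> \<in> carrier slice_bimodule" for \<Phi>
    using that diagonal_summable(2)[OF a] by (simp add: diagonal_sum_def)
qed (simp add: diagonal_sum_def)

lemma diagonal_sum_linear:
  assumes \<Phi>: "\<Phi> \<in> c0li"
  shows "cbounded_linear A scalars (\<lambda>a. diagonal_sum a \<Phi>)"
proof -
  have "diagonal_sum (a \<oplus>\<^bsub>A\<^esub> b) \<Phi> = diagonal_sum a \<Phi> + diagonal_sum b \<Phi>"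
    if "a \<in> carrier A" "b \<in> carrier A" for a b
    using infsum_add[OF diagonal_summable(1)[OF that(1) \<Phi>] diagonal_summable(1)[OF that(2) \<Phi>]] \<Phi>
    by (simp add: diagonal_sum_def beurling_simps distrib_right)
  moreover have "diagonal_sum (c \<odot>\<^bsub>A\<^esub> a) \<Phi> = c * diagonal_sum a \<Phi>" for a c
    using \<Phi> by (simp add: diagonal_sum_def beurling_simps mult.assoc infsum_cmult_right')
  moreover have "\<exists>K. \<forall>a\<in>carrier A. cmod (diagonal_sum a \<Phi>) \<le> K * nrm A a"
    using diagonal_summable(2)[OF _ \<Phi>] \<Phi>
    by (intro exI[of _ "nrm c0_ell_infinity \<Phi>"]) (simp add: diagonal_sum_def mult.commute)
  ultimately show ?thesis
    unfolding cbounded_linear_def by auto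
qed

lemma diagonal_sum_delta: "\<Phi> \<in> c0li \<Longrightarrow> diagonal_sum (delta g) \<Phi> = \<Phi> (g, g)"
proof -
  assume \<Phi>: "\<Phi> \<in> c0li"
  have "(\<Sum>\<^sub>\<infinity>h. delta g h * \<Phi> (h, h)) = (\<Sum>\<^sub>\<infinity>h\<in>{g}. delta g h * \<Phi> (h, h))"
    by (rule infsum_cong_neutral) (auto simp: delta_def)
  then show ?thesis
    using \<Phi> by (simp add: diagonal_sum_def delta_def)
qed

text \<open>
  Under the twisted left action \<open>a \<cdot> (b \<otimes> 1) = ab \<otimes> 1 - a \<otimes> b\<close>, and \<open>(a \<otimes> 1) \<cdot> b = a \<otimes> b\<close>.
\<close>

lemma diagonal_sum_leibniz:
  assumes a: "a \<in> carrier A" and b: "b \<in> carrier A" and \<Phi>: "\<Phi> \<in> c0li"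
  shows "diagonal_sum (a \<otimes>\<^bsub>A\<^esub> b) \<Phi> = diagonal_sum a (L.act b \<Phi>) + diagonal_sum b (R.act a \<Phi>)"
proof (rule bilinear_eqI[where \<phi> = "\<lambda>a b. diagonal_sum (a \<otimes>\<^bsub>A\<^esub> b) \<Phi>" and
      \<psi> = "\<lambda>a b. diagonal_sum a (L.act b \<Phi>) + diagonal_sum b (R.act a \<Phi>)", OF _ _ _ _ _ a b])
  fix c assume c: "c \<in> carrier A"
  show "cbounded_linear A scalars (\<lambda>a. diagonal_sum (a \<otimes>\<^bsub>A\<^esub> c) \<Phi>)"
    by (rule cbounded_linear_compose[OF mult_linear_left[OF c] diagonal_sum_linear[OF \<Phi>]])
      (rule A.nrm_nonneg)
  show "cbounded_linear A scalars (\<lambda>b. diagonal_sum (c \<otimes>\<^bsub>A\<^esub> b) \<Phi>)"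
    by (rule cbounded_linear_compose[OF mult_linear_right[OF c] diagonal_sum_linear[OF \<Phi>]])
      (rule A.nrm_nonneg)
  have c_lin: "cbounded_linear c0_ell_infinity scalars (diagonal_sum c)"
    using diagonal_sum_dual[OF c] unfolding cbounded_linear_def dual_space_def by simp
  show "cbounded_linear A scalars (\<lambda>a. diagonal_sum a (L.act c \<Phi>) + diagonal_sum c (R.act a \<Phi>))"
    by (intro cbounded_linear_plus diagonal_sum_linear L.act_c0li[OF c \<Phi>]
        cbounded_linear_compose[OF R.act_linear_left[OF \<Phi>] c_lin]) (rule c0li_nonneg)
  show "cbounded_linear A scalars (\<lambda>b. diagonal_sum c (L.act b \<Phi>) + diagonal_sum b (R.act c \<Phi>))"
    by (intro cbounded_linear_plus diagonal_sum_linear R.act_c0li[OF c \<Phi>]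
        cbounded_linear_compose[OF L.act_linear_left[OF \<Phi>] c_lin]) (rule c0li_nonneg)
next
  fix g h
  have "diagonal_sum (delta g \<otimes>\<^bsub>A\<^esub> delta h) \<Phi> = Om g h * diagonal_sum (delta (g + h)) \<Phi>"
    using diagonal_sum_linear[OF \<Phi>] delta_in by (simp add: delta_mult cbounded_linear_def)
  moreover have "diagonal_sum (delta g) (L.act (delta h) \<Phi>) = left_op h \<Phi> (g, g)"
    using diagonal_sum_delta[OF L.T_c0li[OF \<Phi>]] by (simp add: L.act_delta)
  moreover have "diagonal_sum (delta h) (R.act (delta g) \<Phi>) = right_op g \<Phi> (h, h)"
    using diagonal_sum_delta[OF R.T_c0li[OF \<Phi>]] by (simp add: R.act_delta)
  ultimately show "diagonal_sum (delta g \<otimes>\<^bsub>A\<^esub> delta h) \<Phi> =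
      diagonal_sum (delta g) (L.act (delta h) \<Phi>) + diagonal_sum (delta h) (R.act (delta g) \<Phi>)"
    by (simp add: diagonal_sum_delta[OF \<Phi>] left_op_def right_op_def)
qed

lemma dual_slice_space: "dual_space slice_bimodule = dual_space c0_ell_infinity"
  by (simp add: dual_space_def cbounded_linear_def)

text \<open>
  Pointwise Connes amenability for the derivation \<open>diagonal_sum\<close> into the dual of \<open>slice_bimodule\<close>. Both
  actions and the derivation are weak-star continuous because their coefficients at the \<open>delta g\<close> vanish
  at infinity.
\<close>

lemma connes_amenable_imp_implementing_functional:
  assumes "pointwise_connes_amenable TYPE('u + (('g \<times> 'g \<Rightarrow> complex) \<Rightarrow> complex)) A (c0_predual \<omega>)"
  obtains m where "m \<in> carrier (dual_space c0_ell_infinity)"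
    "\<And>\<Phi>. \<Phi> \<in> c0li \<Longrightarrow> \<Phi> (h, h) = m (right_op h \<Phi>) - m (left_op h \<Phi>)"
proof -
  define V where "V = dual_bimodule slice_bimodule"
  define E :: "('g \<Rightarrow> complex, 'u + (('g \<times> 'g \<Rightarrow> complex) \<Rightarrow> complex)) normed_bimodule"
    where "E = sum_copy V"
  define P where "P = (\<lambda>\<Phi>. \<lambda>M\<in>carrier E. projr M \<Phi>) ` carrier slice_bimodule"
  interpret X: banach_bimodule A slice_bimodule by (rule slice_bimodule_banach)
  interpret V: banach_bimodule A V
    unfolding V_def by (rule A.dual_bimodule_banach[OF slice_bimodule_banach])
  have iso: "isometric_iso E V projr"
    unfolding E_def by (rule sum_copy_iso[OF V.complex_normed_space_axioms])
  have acts: "lact E a M \<in> carrier E" "projr (lact E a M) = lact V a (projr M)"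
    "ract E M a \<in> carrier E" "projr (ract E M a) = ract V (projr M) a"
    if "a \<in> carrier A" "M \<in> carrier E" for a M
    using that V.lact_closed V.ract_closed by (auto simp: E_def)
  interpret E: dual_banach_bimodule A E P
    unfolding P_def
  proof (rule A.dual_banach_bimodule_evaluations[OF slice_bimodule_banach])
    show "isometric_iso E (dual_bimodule slice_bimodule) projr"
      using iso by (simp add: V_def)
    show "nrm slice_bimodule \<Phi> \<le> c"
      if \<Phi>: "\<Phi> \<in> carrier slice_bimodule" and
        c: "\<And>m. m \<in> carrier (dual_space slice_bimodule) \<Longrightarrow> nrm (dual_space slice_bimodule) m \<le> 1 \<Longrightarrow> cmod (m \<Phi>) \<le> c"
      for \<Phi> c
    proof -
      have "cmod (\<Phi> p) \<le> c" for p
      proof -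
        let ?m = "\<lambda>\<Phi>\<in>c0li. \<Phi> p"
        have "?m \<in> carrier (dual_space slice_bimodule)"
          by (rule dual_spaceI[where K = 1]) (auto simp: c0li_add c0li_smult c0li_bound)
        moreover have "nrm (dual_space slice_bimodule) ?m \<le> 1"
          by (rule X.dual_nrm_least') (auto simp: c0li_bound)
        ultimately show ?thesis
          using c[of ?m] \<Phi> by simp
      qed
      then show ?thesis
        by (simp add: c0li_least)
    qed
  qed (use acts in \<open>simp_all add: V_def\<close>)
  have V_carrier: "carrier V = carrier (dual_space c0_ell_infinity)"
    by (simp add: V_def dual_slice_space)
  have E_carrier: "projr M \<in> carrier (dual_space c0_ell_infinity)" if M: "M \<in> carrier E" for M
  proof -
    obtain x where "M = Inr x" "x \<in> carrier V"
      using M unfolding E_def sum_copy_simps by blast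
    then show ?thesis
      by (simp only: V_carrier sum.sel)
  qed
  have P_apply: "\<exists>\<Phi>\<in>c0li. \<forall>M\<in>carrier E. \<phi> M = projr M \<Phi>" if "\<phi> \<in> P" for \<phi>
    using that by (auto simp: P_def)
  have lact_eval: "projr (lact E a M) \<Phi> = projr M (R.act a \<Phi>)"
    and ract_eval: "projr (ract E M a) \<Phi> = projr M (L.act a \<Phi>)" if "\<Phi> \<in> c0li" for a M \<Phi>
    using that by (simp_all add: E_def V_def)
  have "normal_bimodule A (c0_predual \<omega>) E P"
    unfolding normal_bimodule_def
  proof (intro ballI conjI continuous_map_weak_starI)
    fix M assume M: "M \<in> carrier E"
    note m = E_carrier[OF M]
    show "(\<lambda>a. lact E a M) \<in> carrier A \<rightarrow> carrier E" "(\<lambda>a. ract E M a) \<in> carrier A \<rightarrow> carrier E"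
      using acts M by auto
    fix \<phi> assume "\<phi> \<in> P"
    then obtain \<Phi> where \<Phi>: "\<Phi> \<in> c0li" and \<phi>: "\<And>M. M \<in> carrier E \<Longrightarrow> \<phi> M = projr M \<Phi>"
      using P_apply by blast
    have "\<exists>q\<in>c0_predual \<omega>. \<forall>a\<in>carrier A. projr M (R.act a \<Phi>) = q a"
    proof (rule c0_predualI)
      show "cbounded_linear A scalars (\<lambda>a. projr M (R.act a \<Phi>))"
        by (rule cbounded_linear_compose[OF R.act_linear_left[OF \<Phi>] dual_space_cbounded_linear[OF m]])
          (rule c0li_nonneg)
      show "((\<lambda>g. projr M (R.act (delta g) \<Phi>)) \<longlongrightarrow> 0) cofinite"
        unfolding R.act_delta by (rule R.dual_coefficients_vanish[OF m \<Phi>])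
    qed
    then show "\<exists>q\<in>c0_predual \<omega>. \<forall>a\<in>carrier A. \<phi> (lact E a M) = q a"
      using \<phi> acts(1) M lact_eval[OF \<Phi>] by simp
    have "\<exists>q\<in>c0_predual \<omega>. \<forall>a\<in>carrier A. projr M (L.act a \<Phi>) = q a"
    proof (rule c0_predualI)
      show "cbounded_linear A scalars (\<lambda>a. projr M (L.act a \<Phi>))"
        by (rule cbounded_linear_compose[OF L.act_linear_left[OF \<Phi>] dual_space_cbounded_linear[OF m]])
          (rule c0li_nonneg)
      show "((\<lambda>g. projr M (L.act (delta g) \<Phi>)) \<longlongrightarrow> 0) cofinite"
        unfolding L.act_delta by (rule L.dual_coefficients_vanish[OF m \<Phi>])
    qed
    then show "\<exists>q\<in>c0_predual \<omega>. \<forall>a\<in>carrier A. \<phi> (ract E M a) = q a"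
      using \<phi> acts(3) M ract_eval[OF \<Phi>] by simp
  qed
  moreover define D :: "('g \<Rightarrow> complex) \<Rightarrow> 'u + (('g \<times> 'g \<Rightarrow> complex) \<Rightarrow> complex)"
    where "D = (\<lambda>a. Inr (diagonal_sum a))"
  have D_in: "D a \<in> carrier E" if "a \<in> carrier A" for a
    using diagonal_sum_dual[OF that] by (simp add: D_def E_def V_def)
  have "derivation A E D"
    unfolding derivation_def cbounded_linear_def
  proof (intro conjI ballI allI)
    show "D \<in> carrier A \<rightarrow> carrier E"
      using D_in by auto
    fix a b c assume a: "a \<in> carrier A" and b: "b \<in> carrier A"
    show "D (a \<oplus>\<^bsub>A\<^esub> b) = D a \<oplus>\<^bsub>E\<^esub> D b"
      using diagonal_sum_linear a b
      by (auto simp: D_def E_def V_def restrict_def fun_eq_iff cbounded_linear_def)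
         (auto simp: diagonal_sum_def)
    show "D (a \<otimes>\<^bsub>A\<^esub> b) = ract E (D a) b \<oplus>\<^bsub>E\<^esub> lact E a (D b)"
      using diagonal_sum_leibniz[OF a b]
      by (auto simp: D_def E_def V_def restrict_def fun_eq_iff)
         (auto simp: diagonal_sum_def)
    show "D (c \<odot>\<^bsub>A\<^esub> a) = c \<odot>\<^bsub>E\<^esub> D a" for c
      using diagonal_sum_linear a
      by (auto simp: D_def E_def V_def restrict_def fun_eq_iff cbounded_linear_def)
         (auto simp: diagonal_sum_def)
  next
    have "nrm (dual_space slice_bimodule) (diagonal_sum a) \<le> nrm A a" if a: "a \<in> carrier A" for a
      by (rule X.dual_nrm_least')
        (use A.nrm_nonneg[OF a] diagonal_summable(2)[OF a] in \<open>auto simp: diagonal_sum_def\<close>)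
    then show "\<exists>K. \<forall>a\<in>carrier A. nrm E (D a) \<le> K * nrm A a"
      by (intro exI[of _ 1]) (simp add: D_def E_def V_def)
  qed
  moreover have "continuous_map (weak_star A (c0_predual \<omega>)) (weak_star E P) D"
  proof (rule continuous_map_weak_starI)
    show "D \<in> carrier A \<rightarrow> carrier E"
      using D_in by auto
    fix \<phi> assume "\<phi> \<in> P"
    then obtain \<Phi> where \<Phi>: "\<Phi> \<in> c0li" and \<phi>: "\<And>M. M \<in> carrier E \<Longrightarrow> \<phi> M = projr M \<Phi>"
      using P_apply by blast
    have "\<exists>q\<in>c0_predual \<omega>. \<forall>a\<in>carrier A. diagonal_sum a \<Phi> = q a"
    proof (rule c0_predualI[OF diagonal_sum_linear[OF \<Phi>]], unfold diagonal_sum_delta[OF \<Phi>], rule tendstoI)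
      fix e :: real assume "e > 0"
      then have "\<forall>\<^sub>F s in cofinite. \<forall>g. cmod (\<Phi> (s, g)) < e"
        using \<Phi> unfolding c0li_iff by blast
      then show "\<forall>\<^sub>F g in cofinite. dist (\<Phi> (g, g)) 0 < e"
        by (rule eventually_mono) simp
    qed
    then show "\<exists>q\<in>c0_predual \<omega>. \<forall>a\<in>carrier A. \<phi> (D a) = q a"
      using \<phi> D_in by (simp add: D_def)
  qed
  ultimately obtain M where M: "M \<in> carrier E"
    "D (delta h) = lact E (delta h) M \<ominus>\<^bsub>E\<^esub> ract E M (delta h)"
    using assms E.dual_banach_bimodule_axioms delta_in unfolding pointwise_connes_amenable_def by blast
  show thesis
  proof
    show "projr M \<in> carrier (dual_space c0_ell_infinity)"
      by (rule E_carrier[OF M(1)])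
    fix \<Phi> assume \<Phi>: "\<Phi> \<in> (c0li :: ('g \<times> 'g \<Rightarrow> complex) set)"
    have "D (delta h) = lact E (delta h) M \<oplus>\<^bsub>E\<^esub> (- 1) \<odot>\<^bsub>E\<^esub> ract E M (delta h)"
      using M E.minus_eq_smult acts delta_in by simp
    then have "diagonal_sum (delta h) \<Phi> = (projr (lact E (delta h) M)
        \<oplus>\<^bsub>V\<^esub> (- 1) \<odot>\<^bsub>V\<^esub> projr (ract E M (delta h))) \<Phi>"
      by (simp add: D_def E_def)
    also have "\<dots> = projr (lact E (delta h) M) \<Phi> - projr (ract E M (delta h)) \<Phi>"
      using \<Phi> by (simp add: V_def)
    finally show "\<Phi> (h, h) = projr M (right_op h \<Phi>) - projr M (left_op h \<Phi>)"
      using \<Phi> by (simp add: diagonal_sum_delta lact_eval ract_eval L.act_delta R.act_delta)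
  qed
qed

text \<open>
  The functional \<open>n\<close> restricts the implementing functional to the slice over \<open>0\<close>, to which both operators
  carry the slice over \<open>h\<close>. It is minus the functional that is sought.
\<close>

lemma connes_amenable_imp_weight_amenable:
  assumes "pointwise_connes_amenable TYPE('u + (('g \<times> 'g \<Rightarrow> complex) \<Rightarrow> complex)) A (c0_predual \<omega>)"
  shows "pointwise_weight_amenable_at \<omega> h"
proof -
  obtain m where m: "m \<in> carrier (dual_space c0_ell_infinity)"
    and eq: "\<And>\<Phi>. \<Phi> \<in> c0li \<Longrightarrow> \<Phi> (h, h) = m (right_op h \<Phi>) - m (left_op h \<Phi>)"
    using connes_amenable_imp_implementing_functional[OF assms, of h] by blast
  define slice where "slice = (\<lambda>(s :: 'g) (f :: 'g \<Rightarrow> complex) p. if fst p = s then f (snd p) else 0)"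
  have slice: "slice s f \<in> c0li" if "bounded (range f)" for s :: 'g and f
    unfolding slice_def by (rule single_slice_c0li[OF that])
  define n where "n = (\<lambda>f. m (slice 0 f))"
  have n_add: "n (\<lambda>g. f g + f' g) = n f + n f'" if "bounded (range f)" "bounded (range f')" for f f'
  proof -
    have "slice 0 (\<lambda>g. f g + f' g) = (\<lambda>p. slice 0 f p + slice 0 f' p)"
      by (auto simp: slice_def)
    then show ?thesis
      using dual_spaceD(2)[OF m slice slice, OF that, of 0 0] by (simp add: n_def)
  qed
  have n_smult: "n (\<lambda>g. c * f g) = c * n f" if "bounded (range f)" for c f
  proof -
    have "slice 0 (\<lambda>g. c * f g) = (\<lambda>p. c * slice 0 f p)"
      by (auto simp: slice_def)
    then show ?thesis
      using dual_spaceD(3)[OF m slice[OF that], of c 0] by (simp add: n_def)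
  qed
  have bdd_Om: "bounded (range (\<lambda>g. Om (a g) (b g) * f g))" if f: "bounded (range f)" for a b f
  proof -
    obtain C where "\<And>g. cmod (f g) \<le> C"
      using f by (auto simp: bounded_iff)
    then show ?thesis
      by (auto simp: bounded_iff intro!: exI[of _ C] cmod_Om_mult_le)
  qed
  have bdd_scale: "bounded (range (\<lambda>g. k * f g))" if f: "bounded (range f)" for k and f :: "'g \<Rightarrow> complex"
  proof -
    obtain C where "\<And>g. cmod (f g) \<le> C"
      using f by (auto simp: bounded_iff)
    then have "cmod (k * f g) \<le> cmod k * C" for g
      unfolding norm_mult by (rule mult_left_mono) simp
    then show ?thesis
      by (auto simp: bounded_iff)
  qed
  have bdd_shift: "bounded (range (\<lambda>g. f (h + g)))" if "bounded (range f)" for f :: "'g \<Rightarrow> complex"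
    by (rule bounded_subset[OF that]) auto
  define c where "c = n (\<lambda>g. Om g (- g))"
  have bdd_one: "bounded (range (\<lambda>g. Om g (- g)))"
    using bdd_Om[of "\<lambda>_. 1" "\<lambda>g. g" uminus] by simp
  \<comment> \<open>Here \<open>f\<close> is placed on the slice over \<open>h\<close>.\<close>
  have key: "f h = n (\<lambda>g. Om h g * f (h + g)) - c * f h - n (\<lambda>g. Om (- g) h * f g)"
    if f: "bounded (range f)" for f
  proof -
    have hs: "h + s = h \<longleftrightarrow> s = 0" "s + h = h \<longleftrightarrow> s = 0" for s
      by (metis add.right_neutral add_left_cancel) (metis add.left_neutral add_right_cancel)
    have r: "right_op h (slice h f) = (\<lambda>p. slice 0 (\<lambda>g. Om h g * f (h + g)) p
        + (- f h) * slice 0 (\<lambda>g. Om g (- g)) p)"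
      by (auto simp: right_op_def slice_def fun_eq_iff hs)
    have l: "left_op h (slice h f) = slice 0 (\<lambda>g. Om (- g) h * f g)"
      by (auto simp: left_op_def slice_def fun_eq_iff hs)
    have b: "bounded (range (\<lambda>g. Om h g * f (h + g)))"
      using bdd_Om[OF bdd_shift[OF f], of "\<lambda>_. h" "\<lambda>g. g"] .
    have "m (right_op h (slice h f)) = n (\<lambda>g. Om h g * f (h + g)) - c * f h"
      unfolding r
      using dual_spaceD(2)[OF m slice[OF b] c0li_smult[OF slice[OF bdd_one]], of 0 "- f h" 0]
        dual_spaceD(3)[OF m slice[OF bdd_one], of "- f h" 0]
      by (simp add: n_def c_def)
    moreover have "slice h f (h, h) = f h"
      by (simp add: slice_def)
    ultimately show ?thesis
      using eq[OF slice[OF f], of h] by (simp add: l n_def)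
  qed
  have c: "c = - 1"
  proof -
    \<comment> \<open>Both operators map this function to \<open>g \<mapsto> Om g (- g)\<close>, and its value at \<open>h\<close> is one.\<close>
    have b: "bounded (range (\<lambda>g. Om g (- g + h)))"
      using bdd_Om[of "\<lambda>_. 1" "\<lambda>g. g" "\<lambda>g. - g + h"] by simp
    have "Om h g * Om (h + g) (- (h + g) + h) = Om g (- g)" for g
      by (simp add: weight_quot_def minus_add add.assoc unit)
    moreover have "Om (- g) h * Om g (- g + h) = Om g (- g)" for g
      by (simp add: weight_quot_def unit flip: add.assoc)
    ultimately show ?thesis
      using key[OF b] by (simp add: c_def eq_neg_iff_add_eq_0 add.commute)
  qed
  have invariant: "n (\<lambda>g. Om h g * f (h + g)) = n (\<lambda>g. Om (- g) h * f g)" if "bounded (range f)" for f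
    using key[OF that] c by simp
  define N where "N = (\<lambda>f\<in>carrier ell_infinity. - n f)"
  have N_apply: "N f = - n f" if "bounded (range f)" for f
    using that by (simp add: N_def ell_infinity_def)
  have N: "N \<in> carrier (dual_space ell_infinity)"
  proof (rule dual_spaceI)
    show "N (f \<oplus>\<^bsub>ell_infinity\<^esub> f') = N f + N f'"
      if "f \<in> carrier ell_infinity" "f' \<in> carrier ell_infinity" for f f'
      using that n_add bounded_plus_comp[of f UNIV f'] by (simp add: ell_infinity_def N_apply)
    show "N (k \<odot>\<^bsub>ell_infinity\<^esub> f) = k * N f" if "f \<in> carrier ell_infinity" for k f
    proof -
      have "bounded (range f)"
        using that by (simp add: ell_infinity_def)
      moreover from this have "bounded (range (\<lambda>g. k * f g))"
        by (rule bdd_scale)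
      ultimately show ?thesis
        by (simp add: ell_infinity_def N_apply n_smult)
    qed
    show "cmod (N f) \<le> nrm (dual_space c0_ell_infinity) m * nrm ell_infinity f"
      if f: "f \<in> carrier ell_infinity" for f
    proof -
      have b: "bounded (range f)"
        using f by (simp add: ell_infinity_def)
      then obtain C where C: "\<And>g. cmod (f g) \<le> C"
        by (auto simp: bounded_iff)
      have le: "cmod (f g) \<le> nrm ell_infinity f" for g
        unfolding ell_infinity_def by (auto intro!: cSUP_upper bdd_aboveI2 C)
      have "0 \<le> nrm ell_infinity f"
        using le[of 0] norm_ge_zero order_trans by blast
      then have "nrm c0_ell_infinity (slice 0 f) \<le> nrm ell_infinity f"
        using le by (intro c0li_least) (simp add: slice_def)
      then have "nrm (dual_space c0_ell_infinity) m * nrm c0_ell_infinity (slice 0 f)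
          \<le> nrm (dual_space c0_ell_infinity) m * nrm ell_infinity f"
        by (intro mult_left_mono c0li.dual_nrm_nonneg m)
      then show ?thesis
        using c0li.dual_nrm_bound[OF m slice[OF b], of 0] by (simp add: N_apply[OF b] n_def)
    qed
  qed (simp add: N_def)
  moreover have "N (\<lambda>g. Om g (- g)) = 1"
    using c by (simp add: N_apply bdd_one c_def)
  moreover have "adjoint_map ell_infinity (J_map \<omega> h) N = N"
  proof (rule extensionalityI[of _ "carrier ell_infinity"])
    fix f :: "'g \<Rightarrow> complex" assume "f \<in> carrier ell_infinity"
    then have f: "bounded (range f)"
      by (simp add: ell_infinity_def)
    define w where "w = complex_of_real (\<omega> h * \<omega> (- h))"
    \<comment> \<open>The factor turns the translation in \<open>invariant\<close> into \<open>J_map\<close>, up to \<open>w\<close>.\<close>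
    define f1 where "f1 = (\<lambda>g. Om (- g + h) (- h) * f g)"
    have f1: "bounded (range f1)"
      unfolding f1_def by (rule bdd_Om[OF f])
    have b: "bounded (range (\<lambda>g. Om h g * f1 (h + g)))"
      using bdd_Om[OF bdd_shift[OF f1], of "\<lambda>_. h" "\<lambda>g. g"] .
    have "J_map \<omega> h f g = w * (Om h g * f1 (h + g))" for g
      by (simp add: J_map_alt w_def f1_def minus_add mult.left_commute)
    then have J: "J_map \<omega> h f = (\<lambda>g. w * (Om h g * f1 (h + g)))"
      by blast
    have bJ: "bounded (range (J_map \<omega> h f))"
      unfolding J by (rule bdd_scale[OF b])
    have cancel: "w * (Om (- g) h * f1 g) = f g" for g
      by (simp add: f1_def w_def weight_quot_def)
    have b2: "bounded (range (\<lambda>g. Om (- g) h * f1 g))"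
      by (rule bdd_Om[OF f1])
    have "n (J_map \<omega> h f) = w * n (\<lambda>g. Om (- g) h * f1 g)"
      by (simp add: J n_smult[OF b] invariant[OF f1])
    also have "\<dots> = n f"
      by (simp add: n_smult[OF b2, symmetric] cancel)
    finally show "adjoint_map ell_infinity (J_map \<omega> h) N f = N f"
      using f bJ \<open>f \<in> carrier ell_infinity\<close> by (simp add: N_apply)
  qed (simp_all add: N_def adjoint_map_def)
  ultimately show ?thesis
    unfolding pointwise_weight_amenable_at_def by blast
qed

end

theorem theorem4p7:
  fixes \<omega> :: "'g::group_add \<Rightarrow> real"
  assumes "weight \<omega>" and "\<omega> 0 = 1"
  shows "(pointwise_amenable TYPE(('g, 'u) predual_universe) (beurling \<omega>) \<longrightarrow>
            pointwise_connes_amenable TYPE(('g, 'u) dual_universe) (beurling \<omega>) (c0_predual \<omega>)) \<and>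
         (pointwise_connes_amenable TYPE(('g, 'u) dual_universe) (beurling \<omega>) (c0_predual \<omega>) \<longrightarrow>
            pointwise_weight_amenable \<omega>) \<and>
         (pointwise_weight_amenable \<omega> \<longrightarrow>
            (\<forall>k. pointwise_amenable_at TYPE('v) (beurling \<omega>) (delta k)))"
proof -
  interpret unital_weight \<omega>
    by (rule unital_weight.intro[OF assms])
  show ?thesis
    using A.pointwise_amenable_imp_pointwise_connes_amenable connes_amenable_imp_weight_amenable
      weight_amenable_imp_amenable_at_delta
    unfolding pointwise_weight_amenable_def by blast
qed

end
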